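(* Let $G$ be an open quasi-Polish groupoid, $H$ a standard Borel groupoid, and $F:G\to H$ a full Borel functor. Then the essential image $[F(G^0)]_H:=\{y\in H^0:\exists x\in G^0\ (H(F(x),y)\neq\emptyset)\}$ of $F$ is a Borel subset of $H^0$, and there is a Borel map assigning to each $y\in[F(G^0)]_H$ an object $x_y\in G^0$ and a morphism $h_y:F(x_y)\to y$ in $H$. In particular, if $F$ is full and faithful, then $F$ is a Borel equivalence from $G$ to its essential image (i.e., to the full subgroupoid $H|[F(G^0)]_H$ of $H$ on the set of objects $[F(G^0)]_H$).
   Context: Let $\mathbb S=\{0,1\}$ with open sets $\emptyset,\{1\},\{0,1\}$. A set is $\mathbf\Pi^0_2$ if it is of the form $\bigcap_{i\in\mathbb N}(F_i\cup U_i)$ with $F_i$ closed, $U_i$ open. A space is quasi-Polish if it is homeomorphic to a $\mathbf\Pi^0_2$ subspace of $\mathbb S^{\mathbb N}$; such spaces are standard Borel. A groupoid $G$ is a small category with all morphisms invertible; $G$ also denotes its set of morphisms, $G^0$ its set of objects, $G(x,y)$ the set of morphisms $x\to y$. A topological groupoid has topologies on $G^0,G$ making source $\sigma$, target $\tau$, unit, multiplication and inverse continuous; it is open if $\sigma:G\to G^0$ is an open map, and quasi-Polish if $G^0,G$ are quasi-Polish. A standard Borel groupoid has standard Borel $G^0,G$ and Borel structure maps; a quasi-Polish groupoid is regarded as a standard Borel groupoid. A Borel functor is a functor which is a Borel map on objects and morphisms. $F:G\to H$ is full (faithful) if each $F:G(x,y)\to H(F(x),F(y))$ is surjective (injective).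 A Borel equivalence $F:G\to K$ is a Borel functor admitting a Borel functor $F':K\to G$ and natural isomorphisms $F\circ F'\cong1_K$, $F'\circ F\cong1_G$ which are Borel as maps from objects to morphisms. *)

theory Defs
  imports "HOL-Analysis.Analysis"
begin

section \<open>Quasi-Polish and standard Borel spaces\<close>

definition sierpinski :: "bool topology" where
  "sierpinski = topology (\<lambda>U. U \<in> {{}, {True}, {False, True}})"

lemma openin_sierpinski: "openin sierpinski U \<longleftrightarrow> U \<in> {{}, {True}, {False, True}}"
proof -
  have eq: "U \<in> {{}, {True}, {False, True}} \<longleftrightarrow> (False \<in> U \<longrightarrow> True \<in> U)" for U :: "bool set"
    by (auto; (metis (full_types)))
  have "istopology (\<lambda>U. U \<in> {{}, {True}, {False, True}})"
    unfolding istopology_def eq by blast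
  then show ?thesis
    unfolding sierpinski_def by (simp add: topology_inverse')
qed

lemma topspace_sierpinski: "topspace sierpinski = UNIV"
  unfolding topspace_def openin_sierpinski by (auto; metis (full_types))

definition pi02_in :: "'a topology \<Rightarrow> 'a set \<Rightarrow> bool" where
  "pi02_in X A \<longleftrightarrow>
     (\<exists>F U. (\<forall>i::nat. closedin X (F i) \<and> openin X (U i)) \<and> A = (\<Inter>i. F i \<union> U i))"

definition quasi_polish :: "'a topology \<Rightarrow> bool" where
  "quasi_polish X \<longleftrightarrow>
     (let P = product_topology (\<lambda>_::nat. sierpinski) UNIV
      in \<exists>A. pi02_in P A \<and> X homeomorphic_space subtopology P A)"

definition borel_of :: "'a topology \<Rightarrow> 'a measure" where
  "borel_of X = sigma (topspace X) {U. openin X U}"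

text \<open>Measures serve only as carriers of \<open>\<sigma>\<close>-algebras; their values are irrelevant.\<close>

definition standard_borel :: "'a measure \<Rightarrow> bool" where
  "standard_borel M \<longleftrightarrow>
     (\<exists>X. completely_metrizable_space X \<and> second_countable X \<and>
          space M = topspace X \<and> sets M = sets (borel_of X))"

section \<open>Groupoids\<close>

text \<open>The product \<open>mult G g h\<close> is the composite of \<open>h\<close> followed by \<open>g\<close>; it is
  meaningful when \<open>src G g = tgt G h\<close>.\<close>

record ('o, 'm) groupoid_data =
  objs :: "'o set"
  mors :: "'m set"
  src :: "'m \<Rightarrow> 'o"
  tgt :: "'m \<Rightarrow> 'o"
  ident :: "'o \<Rightarrow> 'm"
  mult :: "'m \<Rightarrow> 'm \<Rightarrow> 'm"
  invm :: "'m \<Rightarrow> 'm"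

definition homset :: "('o, 'm, 'z) groupoid_data_scheme \<Rightarrow> 'o \<Rightarrow> 'o \<Rightarrow> 'm set" where
  "homset G x y = {g \<in> mors G. src G g = x \<and> tgt G g = y}"

definition composable :: "('o, 'm, 'z) groupoid_data_scheme \<Rightarrow> ('m \<times> 'm) set" where
  "composable G = {(g, h). g \<in> mors G \<and> h \<in> mors G \<and> src G g = tgt G h}"

locale groupoid =
  fixes G :: "('o, 'm, 'z) groupoid_data_scheme"
  assumes src_closed: "g \<in> mors G \<Longrightarrow> src G g \<in> objs G"
    and tgt_closed: "g \<in> mors G \<Longrightarrow> tgt G g \<in> objs G"
    and ident_hom: "x \<in> objs G \<Longrightarrow> ident G x \<in> homset G x x"
    and mult_hom: "(g, h) \<in> composable G \<Longrightarrow> mult G g h \<in> homset G (src G h) (tgt G g)"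
    and invm_hom: "g \<in> mors G \<Longrightarrow> invm G g \<in> homset G (tgt G g) (src G g)"
    and mult_assoc: "(f, g) \<in> composable G \<Longrightarrow> (g, h) \<in> composable G \<Longrightarrow>
           mult G (mult G f g) h = mult G f (mult G g h)"
    and mult_ident: "g \<in> mors G \<Longrightarrow> mult G g (ident G (src G g)) = g"
    and ident_mult: "g \<in> mors G \<Longrightarrow> mult G (ident G (tgt G g)) g = g"
    and invm_mult: "g \<in> mors G \<Longrightarrow> mult G (invm G g) g = ident G (src G g)"
    and mult_invm: "g \<in> mors G \<Longrightarrow> mult G g (invm G g) = ident G (tgt G g)"

record ('o, 'm) top_groupoid_data = "('o, 'm) groupoid_data" +
  obj_top :: "'o topology"
  mor_top :: "'m topology"

locale top_groupoid = groupoid G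
  for G :: "('o, 'm, 'z) top_groupoid_data_scheme" +
  assumes topspace_obj_top: "topspace (obj_top G) = objs G"
    and topspace_mor_top: "topspace (mor_top G) = mors G"
    and continuous_src: "continuous_map (mor_top G) (obj_top G) (src G)"
    and continuous_tgt: "continuous_map (mor_top G) (obj_top G) (tgt G)"
    and continuous_ident: "continuous_map (obj_top G) (mor_top G) (ident G)"
    and continuous_mult:
      "continuous_map (subtopology (prod_topology (mor_top G) (mor_top G)) (composable G))
         (mor_top G) (\<lambda>(g, h). mult G g h)"
    and continuous_invm: "continuous_map (mor_top G) (mor_top G) (invm G)"

locale open_quasi_polish_groupoid = top_groupoid G
  for G :: "('o, 'm, 'z) top_groupoid_data_scheme" +
  assumes quasi_polish_obj: "quasi_polish (obj_top G)"
    and quasi_polish_mor: "quasi_polish (mor_top G)"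
    and open_src: "open_map (mor_top G) (obj_top G) (src G)"

record ('o, 'm) borel_groupoid_data = "('o, 'm) groupoid_data" +
  obj_alg :: "'o measure"
  mor_alg :: "'m measure"

locale standard_borel_groupoid = groupoid G
  for G :: "('o, 'm, 'z) borel_groupoid_data_scheme" +
  assumes space_obj_alg: "space (obj_alg G) = objs G"
    and space_mor_alg: "space (mor_alg G) = mors G"
    and standard_borel_obj: "standard_borel (obj_alg G)"
    and standard_borel_mor: "standard_borel (mor_alg G)"
    and measurable_src: "src G \<in> mor_alg G \<rightarrow>\<^sub>M obj_alg G"
    and measurable_tgt: "tgt G \<in> mor_alg G \<rightarrow>\<^sub>M obj_alg G"
    and measurable_ident: "ident G \<in> obj_alg G \<rightarrow>\<^sub>M mor_alg G"
    and measurable_mult: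
      "(\<lambda>(g, h). mult G g h)
         \<in> restrict_space (mor_alg G \<Otimes>\<^sub>M mor_alg G) (composable G) \<rightarrow>\<^sub>M mor_alg G"
    and measurable_invm: "invm G \<in> mor_alg G \<rightarrow>\<^sub>M mor_alg G"

definition borel_groupoid_of :: "('o, 'm) top_groupoid_data \<Rightarrow> ('o, 'm) borel_groupoid_data" where
  "borel_groupoid_of G =
     \<lparr>objs = objs G, mors = mors G, src = src G, tgt = tgt G, ident = ident G,
      mult = mult G, invm = invm G,
      obj_alg = borel_of (obj_top G), mor_alg = borel_of (mor_top G)\<rparr>"

definition full_subgroupoid ::
  "('o, 'm) borel_groupoid_data \<Rightarrow> 'o set \<Rightarrow> ('o, 'm) borel_groupoid_data" where
  "full_subgroupoid H E =
     (let N = {h \<in> mors H. src H h \<in> E \<and> tgt H h \<in> E}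
      in H\<lparr>objs := objs H \<inter> E, mors := N,
           obj_alg := restrict_space (obj_alg H) E, mor_alg := restrict_space (mor_alg H) N\<rparr>)"

section \<open>Functors\<close>

text \<open>A functor is given by its object map \<open>Fo\<close> and its morphism map \<open>Fm\<close>.\<close>

locale groupoid_functor =
  fixes G :: "('a, 'b, 'y) groupoid_data_scheme"
    and H :: "('c, 'd, 'z) groupoid_data_scheme"
    and Fo :: "'a \<Rightarrow> 'c"
    and Fm :: "'b \<Rightarrow> 'd"
  assumes obj_closed: "x \<in> objs G \<Longrightarrow> Fo x \<in> objs H"
    and mor_hom: "g \<in> mors G \<Longrightarrow> Fm g \<in> homset H (Fo (src G g)) (Fo (tgt G g))"
    and map_ident: "x \<in> objs G \<Longrightarrow> Fm (ident G x) = ident H (Fo x)"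
    and map_mult: "(g, h) \<in> composable G \<Longrightarrow> Fm (mult G g h) = mult H (Fm g) (Fm h)"

definition full_functor ::
  "('a, 'b, 'y) groupoid_data_scheme \<Rightarrow> ('c, 'd, 'z) groupoid_data_scheme
    \<Rightarrow> ('a \<Rightarrow> 'c) \<Rightarrow> ('b \<Rightarrow> 'd) \<Rightarrow> bool" where
  "full_functor G H Fo Fm \<longleftrightarrow>
     (\<forall>x\<in>objs G. \<forall>y\<in>objs G. Fm ` homset G x y = homset H (Fo x) (Fo y))"

definition faithful_functor :: "('a, 'b, 'y) groupoid_data_scheme \<Rightarrow> ('b \<Rightarrow> 'd) \<Rightarrow> bool" where
  "faithful_functor G Fm \<longleftrightarrow> (\<forall>x\<in>objs G. \<forall>y\<in>objs G. inj_on Fm (homset G x y))"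

definition essential_image ::
  "('a, 'b, 'y) groupoid_data_scheme \<Rightarrow> ('c, 'd, 'z) groupoid_data_scheme
    \<Rightarrow> ('a \<Rightarrow> 'c) \<Rightarrow> 'c set" where
  "essential_image G H Fo = {y \<in> objs H. \<exists>x\<in>objs G. homset H (Fo x) y \<noteq> {}}"

locale borel_functor = groupoid_functor G H Fo Fm
  for G :: "('a, 'b, 'y) borel_groupoid_data_scheme"
    and H :: "('c, 'd, 'z) borel_groupoid_data_scheme"
    and Fo :: "'a \<Rightarrow> 'c"
    and Fm :: "'b \<Rightarrow> 'd" +
  assumes measurable_obj: "Fo \<in> obj_alg G \<rightarrow>\<^sub>M obj_alg H"
    and measurable_mor: "Fm \<in> mor_alg G \<rightarrow>\<^sub>M mor_alg H"

text \<open>A Borel natural isomorphism \<open>\<eta>\<close> from \<open>(Po, Pm)\<close> to \<open>(Qo, Qm)\<close>, both functors from \<open>G\<close> to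
  \<open>H\<close>. Invertibility of the components is automatic in a groupoid.\<close>

definition borel_nat_iso ::
  "('a, 'b, 'y) borel_groupoid_data_scheme \<Rightarrow> ('c, 'd, 'z) borel_groupoid_data_scheme
    \<Rightarrow> ('a \<Rightarrow> 'c) \<Rightarrow> ('b \<Rightarrow> 'd) \<Rightarrow> ('a \<Rightarrow> 'c) \<Rightarrow> ('b \<Rightarrow> 'd) \<Rightarrow> ('a \<Rightarrow> 'd) \<Rightarrow> bool" where
  "borel_nat_iso G H Po Pm Qo Qm \<eta> \<longleftrightarrow>
     \<eta> \<in> obj_alg G \<rightarrow>\<^sub>M mor_alg H \<and>
     (\<forall>x\<in>objs G. \<eta> x \<in> homset H (Po x) (Qo x)) \<and>
     (\<forall>g\<in>mors G. mult H (\<eta> (tgt G g)) (Pm g) = mult H (Qm g) (\<eta> (src G g)))"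

definition borel_equivalence ::
  "('a, 'b) borel_groupoid_data \<Rightarrow> ('c, 'd) borel_groupoid_data
    \<Rightarrow> ('a \<Rightarrow> 'c) \<Rightarrow> ('b \<Rightarrow> 'd) \<Rightarrow> bool" where
  "borel_equivalence G K Fo Fm \<longleftrightarrow>
     standard_borel_groupoid G \<and> standard_borel_groupoid K \<and> borel_functor G K Fo Fm \<and>
     (\<exists>Fo' Fm'. borel_functor K G Fo' Fm' \<and>
        (\<exists>\<eta>. borel_nat_iso K K (Fo \<circ> Fo') (Fm \<circ> Fm') id id \<eta>) \<and>
        (\<exists>\<epsilon>. borel_nat_iso G G (Fo' \<circ> Fo) (Fm' \<circ> Fm) id id \<epsilon>))"

end

theory Submission
  imports Defs
begin

text \<open>Let \<open>R\<close> be the space of pairs \<open>(x, h)\<close> with \<open>x\<close> an object of \<open>G\<close> and \<open>h\<close> an arrow of \<open>H\<close> starting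
  at \<open>F x\<close>, and let \<open>p (x, h)\<close> be the target of \<open>h\<close>. The image of \<open>p\<close> is the essential image, and a
  Borel section of \<open>p\<close> is exactly a Borel choice of \<open>(x\<^sub>y, h\<^sub>y)\<close>. The groupoid \<open>G\<close> acts on \<open>R\<close> by
  \<open>g \<cdot> (x, h) = (tgt g, h (F g)\<^sup>-\<^sup>1)\<close>, and fullness says precisely that the fibres of \<open>p\<close> are
  the orbits. So a Borel section has to be found for a map whose fibres are orbits.

  The orbits carry a notion of largeness: a Borel set \<open>B \<subseteq> R\<close> is large at \<open>r = (x, h)\<close> if
  \<open>{g. g \<cdot> r \<in> B}\<close> is nonmeager in the space of arrows of \<open>G\<close> with source \<open>x\<close>. That space is quasi-Polish,
  hence Baire, so \<open>R\<close> itself is large everywhere; right translation by an arrow is a homeomorphism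
  between two such spaces, so largeness is constant on the fibres of \<open>p\<close>; and since the source map of
  \<open>G\<close> is open, the set of points where \<open>B\<close> is large is Borel (\<open>category_quantifier_measurable\<close>, the
  Vaught transform).

  Now put on \<open>R\<close> a complete metric with the given Borel sets that makes \<open>p\<close> continuous
  (\<open>borel_closed_graph_domain\<close>), cover \<open>R\<close> by countably many balls of radius \<open>2\<^sup>-\<^sup>n\<close> for each \<open>n\<close>, and
  at each point take the first ball whose intersection with the previous choices is large. These
  choices depend only on the orbit, they converge, and the limit lies in the same fibre: this is a
  Borel selector \<open>s : R \<rightarrow> R\<close>, constant on the fibres of \<open>p\<close>, with \<open>p \<circ> s = p\<close> (\<open>borel_selector\<close>).

  It remains to pass from \<open>s\<close> to the image of \<open>p\<close>. If \<open>s\<close> is a Borel function that is constant on the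
  fibres of \<open>p\<close>, then for each coordinate \<open>n\<close> and rational \<open>q\<close> the sets \<open>{s\<^sub>n < q}\<close> and \<open>{s\<^sub>n \<ge> q}\<close>
  have disjoint images under \<open>p\<close>; by Lusin's theorem these are separated by a Borel set, and the
  separating sets define a Borel \<open>t\<close>, on the whole target space, with \<open>t \<circ> p = s\<close>
  (\<open>borel_factorization\<close>). The image of \<open>p\<close> is then the Borel set of \<open>y\<close> with \<open>t y \<in> R\<close> and
  \<open>p (t y) = y\<close>, and \<open>t\<close> is the section. With \<open>s\<close> the identity, the same argument shows that an
  injective Borel map has a Borel inverse on a Borel image; for faithful \<open>F\<close> this makes
  \<open>g \<mapsto> (src g, tgt g, F g)\<close> invertible, so that \<open>k : y \<rightarrow> z\<close> can be sent in a Borel way to the unique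
  arrow \<open>x\<^sub>y \<rightarrow> x\<^sub>z\<close> lying over \<open>h\<^sub>z\<^sup>-\<^sup>1 k h\<^sub>y\<close>. This is the inverse equivalence.\<close>

section \<open>Closed graphs over Borel sets\<close>

instance prod :: (polish_space, polish_space) polish_space ..

lemma continuous_on_snd_coordinate: "continuous_on S (\<lambda>z :: 'a::topological_space \<times> ('i \<Rightarrow> 'b::topological_space). snd z n)"
  by (intro continuous_on_compose2[OF continuous_on_product_coordinates continuous_on_snd] continuous_on_id) auto

lemma continuous_on_snd_reindex:
  "continuous_on S (\<lambda>z :: 'a::topological_space \<times> ('i \<Rightarrow> 'b::topological_space). (fst z, \<lambda>j. snd z (h j)))"
  by (intro continuous_on_Pair continuous_on_fst continuous_on_id continuous_on_coordinatewise_then_product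
      continuous_on_snd_coordinate)

text \<open>Refining the topology of a Polish space so that a given Borel set \<open>B\<close> becomes closed amounts to
  replacing points by points of a graph. The sets for which this is possible with a map into the
  Polish space of real sequences turn out to be all Borel sets.\<close>

definition closed_graph_domain ::
  "('a::metric_space) set \<Rightarrow> bool" where
  "closed_graph_domain B \<longleftrightarrow> (\<exists>f :: 'a \<Rightarrow> nat \<Rightarrow> real. f \<in> borel_measurable borel \<and>
     closed ((\<lambda>x. (x, f x)) ` B))"

lemma closed_graph_domain_closed:
  assumes "closed B" shows "closed_graph_domain B"
  unfolding closed_graph_domain_def
proof (intro exI conjI)
  have "(\<lambda>x. (x, (\<lambda>_. 0) :: nat \<Rightarrow> real)) ` B = B \<times> {\<lambda>_. 0}" by auto
  then show "closed ((\<lambda>x. (x, (\<lambda>_. 0) :: nat \<Rightarrow> real)) ` B)"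
    using assms by (simp add: closed_Times)
qed auto

text \<open>The reciprocal of the distance to the complement blows up at the boundary, so the graph has no
  limit points over it.\<close>

lemma closed_graph_domain_open:
  assumes "open U" shows "closed_graph_domain U"
proof (cases "U = UNIV")
  case True then show ?thesis by (simp add: closed_graph_domain_closed)
next
  case False
  let ?d = "\<lambda>x. infdist x (- U)"
  have pos: "?d x = 0 \<longleftrightarrow> x \<notin> U" for x
    using in_closed_iff_infdist_zero[of "- U" x] assms False by auto
  \<comment> \<open>The graph is cut out by equations that have no solution outside \<open>U\<close>.\<close>
  have eq: "(\<lambda>x. (x, \<lambda>_::nat. inverse (?d x))) ` U = (\<Inter>n. {z. snd z n * ?d (fst z) = 1})"
  proof (intro equalityI subsetI)
    fix z :: "'a \<times> (nat \<Rightarrow> real)" assume "z \<in> (\<Inter>n. {z. snd z n * ?d (fst z) = 1})"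
    then have h: "snd z n * ?d (fst z) = 1" for n :: nat by auto
    then have "?d (fst z) \<noteq> 0" by (metis mult_zero_right zero_neq_one)
    then have "fst z \<in> U" using pos by blast
    moreover have "snd z = (\<lambda>_. inverse (?d (fst z)))"
      using h \<open>?d (fst z) \<noteq> 0\<close> by (simp add: fun_eq_iff field_simps)
    ultimately show "z \<in> (\<lambda>x. (x, \<lambda>_::nat. inverse (?d x))) ` U"
      by (intro image_eqI[of _ _ "fst z"]) (simp_all add: prod_eq_iff)
  next
    fix z assume "z \<in> (\<lambda>x. (x, \<lambda>_::nat. inverse (?d x))) ` U"
    then obtain x where "x \<in> U" "z = (x, \<lambda>_::nat. inverse (?d x))" by blast
    then show "z \<in> (\<Inter>n. {z. snd z n * ?d (fst z) = 1})"
      using pos[of x] by simp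
  qed
  have "closed (\<Inter>n. {z :: 'a \<times> (nat \<Rightarrow> real). snd z n * ?d (fst z) = 1})"
  proof (rule closed_INT, rule ballI, rule closed_Collect_eq)
    fix n :: nat
    have "continuous_on UNIV (\<lambda>z :: 'a \<times> (nat \<Rightarrow> real). ?d (fst z))"
      by (rule continuous_on_infdist[OF continuous_on_fst[OF continuous_on_id]])
    then show "continuous_on UNIV (\<lambda>z :: 'a \<times> (nat \<Rightarrow> real). snd z n * ?d (fst z))"
      by (rule continuous_on_mult[OF continuous_on_snd_coordinate])
  qed simp
  then have "closed ((\<lambda>x. (x, \<lambda>_::nat. inverse (?d x))) ` U)" by (simp only: eq)
  moreover have "?d \<in> borel_measurable borel"
    by (intro borel_measurable_continuous_onI continuous_on_infdist continuous_on_id)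
  then have "(\<lambda>x (_::nat). inverse (?d x)) \<in> borel_measurable borel"
    by (intro measurable_coordinatewise_then_product borel_measurable_inverse)
  ultimately show ?thesis unfolding closed_graph_domain_def by blast
qed

text \<open>Countably many sequences are interleaved into one by the pairing function; the graph over the
  intersection is then an intersection of preimages of the given closed graphs.\<close>

lemma closed_graph_domain_INT:
  fixes B :: "nat \<Rightarrow> 'a::metric_space set"
  assumes "\<And>i. closed_graph_domain (B i)" shows "closed_graph_domain (\<Inter>i. B i)"
proof -
  from assms obtain f :: "nat \<Rightarrow> 'a \<Rightarrow> nat \<Rightarrow> real"
    where f [measurable]: "\<And>i. f i \<in> borel_measurable borel"
      and cl: "\<And>i. closed ((\<lambda>x. (x, f i x)) ` B i)"
    unfolding closed_graph_domain_def by metis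
  define g where "g x n = (case prod_decode n of (i, j) \<Rightarrow> f i x j)" for x n
  have [measurable]: "(\<lambda>x. f i x j) \<in> borel_measurable borel" for i j
    by (rule measurable_product_then_coordinatewise) simp
  have g: "g \<in> borel_measurable borel"
    unfolding g_def by (intro measurable_coordinatewise_then_product) (auto split: prod.split)
  have "(\<lambda>x. (x, g x)) ` (\<Inter>i. B i) =
      (\<Inter>i. (\<lambda>z. (fst z, \<lambda>j. snd z (prod_encode (i, j)))) -` ((\<lambda>x. (x, f i x)) ` B i))"
  proof (intro equalityI subsetI)
    fix z assume z: "z \<in> (\<Inter>i. (\<lambda>z. (fst z, \<lambda>j. snd z (prod_encode (i, j)))) -` ((\<lambda>x. (x, f i x)) ` B i))"
    then have h: "fst z \<in> B i" "(\<lambda>j. snd z (prod_encode (i, j))) = f i (fst z)" for i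
      by auto
    have "snd z = g (fst z)"
    proof
      fix n obtain i j where ij: "prod_decode n = (i, j)" by fastforce
      then have n: "n = prod_encode (i, j)" by (metis prod_decode_inverse)
      show "snd z n = g (fst z) n"
        using fun_cong[OF h(2)[of i], of j] by (simp add: g_def ij) (simp add: n)
    qed
    then show "z \<in> (\<lambda>x. (x, g x)) ` (\<Inter>i. B i)" using h(1)
      by (intro image_eqI[of _ _ "fst z"]) (simp_all add: prod_eq_iff)
  qed (auto simp: g_def)
  moreover have "closed \<dots>"
    by (intro closed_INT ballI closed_vimage cl continuous_on_snd_reindex)
  ultimately have "closed ((\<lambda>x. (x, g x)) ` (\<Inter> i. B i))" by (simp only:)
  with g show ?thesis unfolding closed_graph_domain_def by blast
qed

text \<open>Coordinate 0 records the index of the piece containing the point. It takes values in a discrete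
  closed set, which keeps the graphs over different pieces apart.\<close>

lemma closed_graph_domain_disjoint_UN:
  fixes B :: "nat \<Rightarrow> 'a::metric_space set"
  assumes dom: "\<And>i. closed_graph_domain (B i)" and meas: "\<And>i. B i \<in> sets borel" and disj: "disjoint_family B"
  shows "closed_graph_domain (\<Union>i. B i)"
proof -
  from dom obtain f :: "nat \<Rightarrow> 'a \<Rightarrow> nat \<Rightarrow> real"
    where f [measurable]: "\<And>i. f i \<in> borel_measurable borel"
      and cl: "\<And>i. closed ((\<lambda>x. (x, f i x)) ` B i)"
    unfolding closed_graph_domain_def by metis
  define idx where "idx x = (LEAST i. x \<in> B i)" for x
  have idx: "idx x = i" if "x \<in> B i" for x i
  proof -
    have "x \<in> B (idx x)" unfolding idx_def using that by (rule LeastI)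
    then show ?thesis using that disj unfolding disjoint_family_on_def by blast
  qed
  define g where "g x n = (case n of 0 \<Rightarrow> real (idx x) | Suc j \<Rightarrow> f (idx x) x j)" for x n
  have [measurable]: "(\<lambda>x. f i x j) \<in> borel_measurable borel" for i j
    by (rule measurable_product_then_coordinatewise) simp
  have [measurable]: "idx \<in> borel \<rightarrow>\<^sub>M count_space UNIV"
    unfolding idx_def using meas by measurable
  have "(\<lambda>x. g x n) \<in> borel_measurable borel" for n
    unfolding g_def by (cases n) auto
  then have g: "g \<in> borel_measurable borel"
    by (rule measurable_coordinatewise_then_product)
  have "(\<lambda>x. (x, g x)) ` (\<Union>i. B i) =
     {z. snd z 0 \<in> range real} \<inter> (\<Inter>i. {z. snd z 0 \<le> real i - 1/2} \<union> {z. real i + 1/2 \<le> snd z 0}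
        \<union> (\<lambda>z. (fst z, \<lambda>j. snd z (Suc j))) -` ((\<lambda>x. (x, f i x)) ` B i))" (is "_ = ?R")
  proof (intro equalityI subsetI)
    fix z assume z: "z \<in> ?R"
    then obtain i where i: "snd z 0 = real i" by auto
    have "z \<in> {z. snd z 0 \<le> real i - 1/2} \<union> {z. real i + 1/2 \<le> snd z 0}
        \<union> (\<lambda>z. (fst z, \<lambda>j. snd z (Suc j))) -` ((\<lambda>x. (x, f i x)) ` B i)"
      using z by blast
    with i have "(fst z, \<lambda>j. snd z (Suc j)) \<in> (\<lambda>x. (x, f i x)) ` B i"
      by simp
    then have h: "fst z \<in> B i" "(\<lambda>j. snd z (Suc j)) = f i (fst z)" by auto
    have "snd z = g (fst z)"
    proof
      fix n show "snd z n = g (fst z) n"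
        using fun_cong[OF h(2)] i idx[OF h(1)] by (cases n) (auto simp: g_def)
    qed
    then show "z \<in> (\<lambda>x. (x, g x)) ` (\<Union>i. B i)" using h(1)
      by (intro image_eqI[of _ _ "fst z"]) (auto simp: prod_eq_iff)
  next
    fix z assume "z \<in> (\<lambda>x. (x, g x)) ` (\<Union>i. B i)"
    then obtain x i where xi: "x \<in> B i" "z = (x, g x)" by auto
    have gx: "g x 0 = real i" "(\<lambda>j. g x (Suc j)) = f i x" by (simp_all add: g_def idx[OF xi(1)])
    show "z \<in> ?R" 
    proof (intro IntI INT_I)
      fix j :: nat
      consider "j = i" | "j < i" | "i < j" by linarith
      then show "z \<in> {z. snd z 0 \<le> real j - 1/2} \<union> {z. real j + 1/2 \<le> snd z 0}
        \<union> (\<lambda>z. (fst z, \<lambda>j. snd z (Suc j))) -` ((\<lambda>x. (x, f j x)) ` B j)"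
        by cases (use xi gx in auto)
    qed (use xi gx in auto)
  qed
  moreover have "closed ?R"
  proof (intro closed_Int closed_INT ballI closed_Un)
    have "closed ((\<lambda>z :: 'a \<times> (nat \<Rightarrow> real). snd z 0) -` range real)"
      by (intro closed_vimage closed_of_nat_image continuous_on_snd_coordinate)
    then show "closed {z :: 'a \<times> (nat \<Rightarrow> real). snd z 0 \<in> range real}" by (simp add: vimage_def)
  qed (intro closed_vimage cl closed_Collect_le continuous_on_const continuous_on_snd_coordinate
        continuous_on_snd_reindex)+
  ultimately have "closed ((\<lambda>x. (x, g x)) ` (\<Union> i. B i))" by (simp only:)
  with g show ?thesis unfolding closed_graph_domain_def by blast
qed

lemma borel_closed_graph_domain:
  assumes "B \<in> sets borel" shows "closed_graph_domain B"
proof -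
  have "B \<in> sigma_sets UNIV {U. open U}" using assms by (simp add: sets_borel)
  then have "B \<in> sets borel \<and> closed_graph_domain B \<and> closed_graph_domain (- B)"
  proof (induction rule: sigma_sets.induct)
    case (Union A)
    define A' where "A' = disjointed A"
    have int: "closed_graph_domain (- (\<Union>i. A i))"
      using closed_graph_domain_INT[of "\<lambda>i. - A i"] Union.IH by simp
    have "closed_graph_domain (A' n)" for n
    proof -
      \<comment> \<open>Written as an intersection so that the induction hypotheses for the complements apply.\<close>
      have "A' n = (\<Inter>j. if j < n then - A j else A n)"
      proof (intro equalityI subsetI)
        fix x assume x: "x \<in> (\<Inter>j. if j < n then - A j else A n)"
        have "x \<in> (if j < n then - A j else A n)" for j using x by blast
        have "x \<notin> A j" if "j < n" for j
          using that \<open>\<And>j. x \<in> (if j < n then - A j else A n)\<close>[of j] by simp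
        moreover have "x \<in> A n" using \<open>\<And>j. x \<in> (if j < n then - A j else A n)\<close>[of n] by simp
        ultimately show "x \<in> A' n"
          by (auto simp: A'_def disjointed_def)
      qed (auto simp: A'_def disjointed_def)
      then show ?thesis using closed_graph_domain_INT[of "\<lambda>j. if j < n then - A j else A n"] Union.IH by auto
    qed
    moreover have "A' n \<in> sets borel" for n
      using Union.IH by (auto simp: A'_def disjointed_def)
    moreover have "disjoint_family A'" by (simp add: A'_def disjoint_family_disjointed)
    ultimately have "closed_graph_domain (\<Union>n. A' n)" by (intro closed_graph_domain_disjoint_UN)
    then have "closed_graph_domain (\<Union>n. A n)" by (simp add: A'_def UN_disjointed_eq)
    then show ?case using int Union.IH by auto
  qed (auto intro: closed_graph_domain_open closed_graph_domain_closed simp: Compl_eq_Diff_UNIV[symmetric])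
  then show ?thesis by blast
qed

section \<open>Separation of disjoint Borel images\<close>

lemma countable_union_Borel_separation:
  fixes P :: "nat \<Rightarrow> 'z::topological_space set" and Q :: "nat \<Rightarrow> 'z set"
  assumes "\<And>i j. \<exists>S\<in>sets borel. P i \<subseteq> S \<and> S \<inter> Q j = {}"
  shows "\<exists>S\<in>sets borel. (\<Union>i. P i) \<subseteq> S \<and> S \<inter> (\<Union>j. Q j) = {}"
proof -
  from assms obtain S where S: "\<And>i j. S i j \<in> sets borel" "\<And>i j. P i \<subseteq> S i j" "\<And>i j. S i j \<inter> Q j = {}"
    by metis
  have "(\<Union>i. \<Inter>j. S i j) \<in> sets borel"
    using S(1) by (intro sets.countable_UN sets.countable_INT) auto
  moreover have "(\<Union>i. P i) \<subseteq> (\<Union>i. \<Inter>j. S i j)" using S(2) by blast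
  moreover have "(\<Union>i. \<Inter>j. S i j) \<inter> (\<Union>j. Q j) = {}" using S(3) by blast
  ultimately show ?thesis by blast
qed

lemma dense_sequence:
  obtains x :: "nat \<Rightarrow> 'a::{metric_space, second_countable_topology}"
  where "\<And>y e. 0 < e \<Longrightarrow> \<exists>n. dist (x n) y \<le> e"
proof -
  obtain D :: "'a set" where D: "countable D" "\<And>U. open U \<Longrightarrow> U \<noteq> {} \<Longrightarrow> \<exists>d\<in>D. d \<in> U"
    using countable_dense_exists by blast
  have ne: "D \<noteq> {}" using D(2)[of UNIV] by auto
  show thesis
  proof
    fix y :: 'a and e :: real assume "0 < e"
    then obtain d where d: "d \<in> D" "d \<in> ball y e" using D(2)[of "ball y e"] by auto
    then obtain n where "from_nat_into D n = d"
      using range_from_nat_into[OF ne D(1)] by (metis rangeE)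
    then show "\<exists>n. dist (from_nat_into D n) y \<le> e"
      using d by (auto simp: dist_commute intro!: exI[of _ n])
  qed
qed

text \<open>Lusin's separation argument. If the images cannot be separated, then neither can the images of
  suitable pieces of arbitrarily small diameter, because countable unions of separable pairs are
  separable. The pieces shrink to points \<open>c\<close> and \<open>d\<close> with different images, and by continuity disjoint
  neighbourhoods of these images already separate small pieces.\<close>

lemma closed_images_separation:
  fixes C :: "'c::polish_space set" and D :: "'d::polish_space set"
    and f :: "'c \<Rightarrow> 'z::t2_space" and g :: "'d \<Rightarrow> 'z"
  assumes C: "closed C" "continuous_on C f" and D: "closed D" "continuous_on D g"
    and disj: "f ` C \<inter> g ` D = {}"
  shows "\<exists>S\<in>sets borel. f ` C \<subseteq> S \<and> S \<inter> g ` D = {}"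
proof (rule ccontr)
  define sep where "sep A B \<longleftrightarrow> (\<exists>S\<in>sets borel. f ` A \<subseteq> S \<and> S \<inter> g ` B = {})" for A B
  assume "\<not> (\<exists>S\<in>sets borel. f ` C \<subseteq> S \<and> S \<inter> g ` D = {})"
  then have "\<not> sep C D" by (simp add: sep_def)
  obtain x :: "nat \<Rightarrow> 'c" where x: "\<And>y e. 0 < e \<Longrightarrow> \<exists>n. dist (x n) y \<le> e"
    using dense_sequence by metis
  obtain y :: "nat \<Rightarrow> 'd" where y: "\<And>z e. 0 < e \<Longrightarrow> \<exists>n. dist (y n) z \<le> e"
    using dense_sequence by metis
  have split: "\<exists>i j. \<not> sep (A \<inter> cball (x i) e) (B \<inter> cball (y j) e)"
    if "\<not> sep A B" "0 < e" for A B e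
  proof (rule ccontr)
    assume "\<not> ?thesis"
    then have "\<exists>S\<in>sets borel. (\<Union>i. f ` (A \<inter> cball (x i) e)) \<subseteq> S \<and> S \<inter> (\<Union>j. g ` (B \<inter> cball (y j) e)) = {}"
      by (intro countable_union_Borel_separation) (simp add: sep_def)
    then obtain S where S: "S \<in> sets borel" "(\<Union>i. f ` (A \<inter> cball (x i) e)) \<subseteq> S"
        "S \<inter> (\<Union>j. g ` (B \<inter> cball (y j) e)) = {}"
      by (elim bexE conjE)
    moreover have "f ` A \<subseteq> (\<Union>i. f ` (A \<inter> cball (x i) e))" 
      using x[OF \<open>0 < e\<close>] by (fastforce simp: subset_eq)
    moreover have "g ` B \<subseteq> (\<Union>j. g ` (B \<inter> cball (y j) e))"
      using y[OF \<open>0 < e\<close>] by (fastforce simp: subset_eq)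
    ultimately have "f ` A \<subseteq> S" "S \<inter> g ` B = {}"
      using S(2,3) by (meson order_trans, meson disjoint_iff subsetD)
    then have "sep A B" unfolding sep_def using S(1) by (intro bexI[of _ S] conjI)
    with that show False by blast
  qed
  define e where "e n = 1 / real (Suc n)" for n
  have e: "0 < e n" for n by (simp add: e_def)
  have "\<exists>s. \<forall>n. (\<not> sep (fst (s n)) (snd (s n)) \<and> closed (fst (s n)) \<and> closed (snd (s n)) \<and>
         fst (s n) \<subseteq> C \<and> snd (s n) \<subseteq> D) \<and>
       (fst (s (Suc n)) \<subseteq> fst (s n) \<and> snd (s (Suc n)) \<subseteq> snd (s n) \<and>
         (\<exists>i. fst (s (Suc n)) \<subseteq> cball (x i) (e n)) \<and> (\<exists>j. snd (s (Suc n)) \<subseteq> cball (y j) (e n)))"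
  proof (rule dependent_nat_choice)
    show "\<exists>s. \<not> sep (fst s) (snd s) \<and> closed (fst s) \<and> closed (snd s) \<and> fst s \<subseteq> C \<and> snd s \<subseteq> D"
      using C(1) D(1) \<open>\<not> sep C D\<close> by (intro exI[of _ "(C, D)"]) simp
  next
    fix s n assume s: "\<not> sep (fst s) (snd s) \<and> closed (fst s) \<and> closed (snd s) \<and> fst s \<subseteq> C \<and> snd s \<subseteq> D"
    obtain i j where "\<not> sep (fst s \<inter> cball (x i) (e n)) (snd s \<inter> cball (y j) (e n))"
      using split[OF _ e] s by blast
    with s show "\<exists>t. (\<not> sep (fst t) (snd t) \<and> closed (fst t) \<and> closed (snd t) \<and> fst t \<subseteq> C \<and> snd t \<subseteq> D) \<and>
       fst t \<subseteq> fst s \<and> snd t \<subseteq> snd s \<and> (\<exists>i. fst t \<subseteq> cball (x i) (e n)) \<and> (\<exists>j. snd t \<subseteq> cball (y j) (e n))"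
      by (intro exI[of _ "(fst s \<inter> cball (x i) (e n), snd s \<inter> cball (y j) (e n))"]) auto
  qed
  then obtain s where s: "\<And>n. \<not> sep (fst (s n)) (snd (s n))" "\<And>n. closed (fst (s n))" "\<And>n. closed (snd (s n))"
     "\<And>n. fst (s n) \<subseteq> C" "\<And>n. snd (s n) \<subseteq> D"
     "\<And>n. fst (s (Suc n)) \<subseteq> fst (s n)" "\<And>n. snd (s (Suc n)) \<subseteq> snd (s n)"
     "\<And>n. \<exists>i. fst (s (Suc n)) \<subseteq> cball (x i) (e n)" "\<And>n. \<exists>j. snd (s (Suc n)) \<subseteq> cball (y j) (e n)"
    by blast
  have "sep {} B" "sep A {}" for A B
    unfolding sep_def by (auto intro: bexI[of _ "{}"] bexI[of _ UNIV])
  with s(1) have ne: "fst (s n) \<noteq> {}" "snd (s n) \<noteq> {}" for n by metis+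
  have small: "\<exists>n. \<forall>p\<in>F n. \<forall>q\<in>F n. dist p q < r"
    if F: "\<And>n. \<exists>i. F (Suc n) \<subseteq> cball (z i) (e n)" and "0 < r" for F and z :: "nat \<Rightarrow> 'm::metric_space" and r :: real
  proof -
    obtain n where "2 / r < real (Suc n)" using reals_Archimedean2 less_trans of_nat_less_iff lessI by metis
    then have n: "2 * e n < r" using \<open>0 < r\<close> by (simp add: e_def field_simps)
    obtain i where i: "F (Suc n) \<subseteq> cball (z i) (e n)" using F by blast
    have "dist p q < r" if "p \<in> F (Suc n)" "q \<in> F (Suc n)" for p q
    proof -
      have "dist (z i) p \<le> e n" "dist (z i) q \<le> e n" using i that by auto
      then show ?thesis using n dist_triangle3[of p q "z i"] by linarith
    qed
    then show ?thesis by blast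
  qed
  obtain c where c: "\<And>n. c \<in> fst (s n)"
    using decreasing_closed_nest[of "\<lambda>n. fst (s n)"] s ne(1) small[of "\<lambda>n. fst (s n)" x]
      lift_Suc_antimono_le[of "\<lambda>n. fst (s n)"] by metis
  obtain d where d: "\<And>n. d \<in> snd (s n)"
    using decreasing_closed_nest[of "\<lambda>n. snd (s n)"] s ne(2) small[of "\<lambda>n. snd (s n)" y]
      lift_Suc_antimono_le[of "\<lambda>n. snd (s n)"] by metis
  have "c \<in> C" "d \<in> D" using c d s(4,5) by blast+
  then have "f c \<noteq> g d" using disj by blast
  then obtain U V where UV: "open U" "open V" "f c \<in> U" "g d \<in> V" "U \<inter> V = {}"
    using hausdorff by metis
  obtain A where A: "open A" "c \<in> A" "\<And>z. z \<in> C \<Longrightarrow> z \<in> A \<Longrightarrow> f z \<in> U"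
    using C(2) UV(1,3) \<open>c \<in> C\<close> unfolding continuous_on_topological by metis
  obtain B where B: "open B" "d \<in> B" "\<And>z. z \<in> D \<Longrightarrow> z \<in> B \<Longrightarrow> g z \<in> V"
    using D(2) UV(2,4) \<open>d \<in> D\<close> unfolding continuous_on_topological by metis
  obtain r where r: "0 < r" "ball c r \<subseteq> A" "ball d r \<subseteq> B"
  proof -
    obtain r1 r2 where "0 < r1" "ball c r1 \<subseteq> A" "0 < r2" "ball d r2 \<subseteq> B"
      using A(1,2) B(1,2) open_contains_ball by metis
    then show ?thesis by (intro that[of "min r1 r2"]) auto
  qed
  obtain m where m: "\<forall>p\<in>fst (s m). \<forall>q\<in>fst (s m). dist p q < r"
    using small[of "\<lambda>n. fst (s n)" x, OF s(8) r(1)] by blast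
  obtain n where n: "\<forall>p\<in>snd (s n). \<forall>q\<in>snd (s n). dist p q < r"
    using small[of "\<lambda>n. snd (s n)" y, OF s(9) r(1)] by blast
  define k where "k = max m n"
  have "fst (s k) \<subseteq> fst (s m)" "snd (s k) \<subseteq> snd (s n)"
    using s(6,7) lift_Suc_antimono_le[of "\<lambda>n. fst (s n)"] lift_Suc_antimono_le[of "\<lambda>n. snd (s n)"]
    by (auto simp: k_def)
  then have "fst (s k) \<subseteq> ball c r" "snd (s k) \<subseteq> ball d r"
    using m n c[of m] d[of n] by (auto simp: subset_eq)
  then have "f ` fst (s k) \<subseteq> U" "U \<inter> g ` snd (s k) = {}"
    using A(3) B(3) r(2,3) s(4,5)[of k] UV(5) by blast+
  then have "sep (fst (s k)) (snd (s k))"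
    unfolding sep_def using UV(1) by (intro bexI[of _ U]) auto
  with s(1) show False by blast
qed

lemma Borel_projection_separation:
  fixes A B :: "('z::polish_space \<times> 'w::polish_space) set"
  assumes AB: "A \<in> sets borel" "B \<in> sets borel" and disj: "fst ` A \<inter> fst ` B = {}"
  shows "\<exists>S\<in>sets borel. fst ` A \<subseteq> S \<and> S \<inter> fst ` B = {}"
proof -
  obtain f g :: "'z \<times> 'w \<Rightarrow> nat \<Rightarrow> real"
    where cl: "closed ((\<lambda>x. (x, f x)) ` A)" "closed ((\<lambda>x. (x, g x)) ` B)"
    using borel_closed_graph_domain[OF AB(1)] borel_closed_graph_domain[OF AB(2)] unfolding closed_graph_domain_def by blast
  have eq: "(\<lambda>w. fst (fst w)) ` (\<lambda>x. (x, h x)) ` S = fst ` S" for h :: "'z \<times> 'w \<Rightarrow> nat \<Rightarrow> real" and S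
    by (simp add: image_image)
  have c: "continuous_on S (\<lambda>w :: ('z \<times> 'w) \<times> (nat \<Rightarrow> real). fst (fst w))" for S
    by (intro continuous_on_fst continuous_on_id)
  show ?thesis
    using closed_images_separation[OF cl(1) c cl(2) c] disj unfolding eq by blast
qed

section \<open>Borel codings and factorization through a Borel map\<close>

text \<open>The map \<open>e\<close> is a Borel isomorphism of \<open>M\<close> onto a Borel subset of a topological space, with inverse
  \<open>d\<close>. Through codings, arguments about abstract standard Borel spaces are carried out in concrete
  Polish spaces.\<close>

definition borel_coding :: "'a measure \<Rightarrow> ('a \<Rightarrow> 'z::topological_space) \<Rightarrow> ('z \<Rightarrow> 'a) \<Rightarrow> bool" where
  "borel_coding M e d \<longleftrightarrow> e \<in> borel_measurable M \<and> e ` space M \<in> sets borel \<and>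
     d \<in> restrict_space borel (e ` space M) \<rightarrow>\<^sub>M M \<and> (\<forall>x\<in>space M. d (e x) = x)"

lemma borel_coding_image:
  assumes "borel_coding M e d" "A \<in> sets M"
  shows "e ` A \<in> sets borel"
proof -
  have "d -` A \<inter> space (restrict_space borel (e ` space M)) \<in> sets (restrict_space borel (e ` space M))"
    using assms measurable_sets unfolding borel_coding_def by blast
  moreover have "d -` A \<inter> space (restrict_space borel (e ` space M)) = e ` A"
    using assms sets.sets_into_space[OF assms(2)] by (fastforce simp: space_restrict_space borel_coding_def)
  ultimately show ?thesis
    using assms(1) by (simp add: sets_restrict_space_iff borel_coding_def)
qed

lemma borel_codingI:
  fixes e :: "'a \<Rightarrow> 'z::topological_space"
  assumes meas: "e \<in> borel_measurable M" and inj: "inj_on e (space M)"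
    and im: "\<And>A. A \<in> sets M \<Longrightarrow> e ` A \<in> sets borel"
  shows "borel_coding M e (the_inv_into (space M) e)"
  unfolding borel_coding_def
proof (intro conjI ballI)
  show e: "e ` space M \<in> sets borel" by (rule im) simp
  show "the_inv_into (space M) e \<in> restrict_space borel (e ` space M) \<rightarrow>\<^sub>M M"
  proof (rule measurableI)
    fix A assume A: "A \<in> sets M"
    have "the_inv_into (space M) e -` A \<inter> space (restrict_space borel (e ` space M)) = e ` A"
      using sets.sets_into_space[OF A] by (auto simp: space_restrict_space the_inv_into_f_f[OF inj])
    then show "the_inv_into (space M) e -` A \<inter> space (restrict_space borel (e ` space M))
        \<in> sets (restrict_space borel (e ` space M))"
      using im[OF A] e sets.sets_into_space[OF A] by (auto simp: sets_restrict_space_iff)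
  qed (auto simp: space_restrict_space the_inv_into_f_f[OF inj])
qed (use meas in \<open>auto simp: the_inv_into_f_f[OF inj]\<close>)

lemma measurable_Collect_eq:
  fixes f g :: "'a \<Rightarrow> 'z::{second_countable_topology, t2_space}"
  assumes "f \<in> borel_measurable M" "g \<in> borel_measurable M"
  shows "{x \<in> space M. f x = g x} \<in> sets M"
proof -
  have "(\<lambda>x. (f x, g x)) \<in> borel_measurable M"
    using assms by (simp add: borel_prod[symmetric])
  moreover have "closed {z :: 'z \<times> 'z. fst z = snd z}"
    by (intro closed_Collect_eq continuous_on_fst continuous_on_snd continuous_on_id)
  ultimately have "(\<lambda>x. (f x, g x)) -` {z. fst z = snd z} \<inter> space M \<in> sets M"
    by (intro measurable_sets) auto
  then show ?thesis by (simp add: vimage_def Int_def conj_commute)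
qed

lemma borel_coding_graph:
  fixes e :: "'a \<Rightarrow> 'w::second_countable_topology" and p :: "'a \<Rightarrow> 'z::{second_countable_topology, t2_space}"
  assumes c: "borel_coding M e d" and p: "p \<in> borel_measurable M" and A: "A \<in> sets M"
  shows "(\<lambda>x. (p x, e x)) ` A \<in> sets borel"
proof -
  have eA: "e ` A \<in> sets borel" and AM: "A \<subseteq> space M"
    using borel_coding_image[OF c A] sets.sets_into_space[OF A] by auto
  let ?N = "restrict_space (borel :: ('z \<times> 'w) measure) (UNIV \<times> e ` A)"
  have N: "UNIV \<times> e ` A \<in> sets (borel :: ('z \<times> 'w) measure)"
    unfolding borel_prod[symmetric] using eA by auto
  have fst: "fst \<in> borel_measurable (borel :: ('z \<times> 'w) measure)"
    and snd: "snd \<in> borel_measurable (borel :: ('z \<times> 'w) measure)"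
    unfolding borel_prod[symmetric] by auto
  have "snd \<in> ?N \<rightarrow>\<^sub>M restrict_space borel (e ` space M)"
    using AM by (intro measurable_restrict_space3 snd) auto
  then have "(\<lambda>z. p (d (snd z))) \<in> borel_measurable ?N"
    using c unfolding borel_coding_def by (intro measurable_compose[OF measurable_compose p]) auto
  moreover have "fst \<in> borel_measurable ?N" by (intro measurable_restrict_space1 fst)
  ultimately have "{z \<in> space ?N. fst z = p (d (snd z))} \<in> sets ?N"
    by (intro measurable_Collect_eq)
  also have "{z \<in> space ?N. fst z = p (d (snd z))} = (\<lambda>x. (p x, e x)) ` A"
    using c AM by (fastforce simp: space_restrict_space borel_coding_def)
  finally show ?thesis using N by (simp add: sets_restrict_space_iff)
qed

text \<open>A Borel image is the projection of the Borel set \<open>{(p x, e x)}\<close>, to which the separation of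
  projections applies.\<close>

lemma borel_image_separation:
  fixes e :: "'a \<Rightarrow> 'w::polish_space" and p :: "'a \<Rightarrow> 'z::polish_space"
  assumes c: "borel_coding M e d" and p: "p \<in> borel_measurable M"
    and AB: "A \<in> sets M" "B \<in> sets M" and disj: "p ` A \<inter> p ` B = {}"
  shows "\<exists>S\<in>sets borel. p ` A \<subseteq> S \<and> S \<inter> p ` B = {}"
proof -
  have "fst ` (\<lambda>x. (p x, e x)) ` A = p ` A" for A by (simp add: image_image)
  then show ?thesis
    using Borel_projection_separation[OF borel_coding_graph[OF c p AB(1)] borel_coding_graph[OF c p AB(2)]] disj
    by simp
qed

text \<open>The separating sets serve as sublevel sets of the coordinates of \<open>t\<close>. Off
  the image of \<open>p\<close> they need not increase with the level; the infimum over rational levels defines a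
  Borel function there as well.\<close>

lemma borel_factorization:
  fixes e :: "'a \<Rightarrow> 'w::polish_space" and p :: "'a \<Rightarrow> 'z::polish_space" and s :: "'a \<Rightarrow> nat \<Rightarrow> real"
  assumes c: "borel_coding M e d" and p: "p \<in> borel_measurable M" and s: "s \<in> borel_measurable M"
    and const: "\<And>x y. x \<in> space M \<Longrightarrow> y \<in> space M \<Longrightarrow> p x = p y \<Longrightarrow> s x = s y"
  obtains t :: "'z \<Rightarrow> nat \<Rightarrow> real" where "t \<in> borel_measurable borel" "\<And>x. x \<in> space M \<Longrightarrow> t (p x) = s x"
proof -
  have "\<exists>S\<in>sets borel. \<forall>x\<in>space M. p x \<in> S \<longleftrightarrow> s x n < q" for n q
  proof -
    have sn: "(\<lambda>x. s x n) \<in> borel_measurable M"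
      by (rule measurable_product_then_coordinatewise[OF s])
    have "{x\<in>space M. s x n < q} \<in> sets M" "{x\<in>space M. q \<le> s x n} \<in> sets M"
      using sn by measurable
    moreover have "p ` {x\<in>space M. s x n < q} \<inter> p ` {x\<in>space M. q \<le> s x n} = {}"
    proof (rule equals0I, elim IntE imageE)
      fix z x y assume "z = p x" "x \<in> {x\<in>space M. s x n < q}" "z = p y" "y \<in> {x\<in>space M. q \<le> s x n}"
      then show False using const[of x y] by simp
    qed
    ultimately have "\<exists>S\<in>sets borel. p ` {x\<in>space M. s x n < q} \<subseteq> S \<and> S \<inter> p ` {x\<in>space M. q \<le> s x n} = {}"
      by (rule borel_image_separation[OF c p])
    then obtain S where S: "S \<in> sets borel" "p ` {x\<in>space M. s x n < q} \<subseteq> S"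
        "S \<inter> p ` {x\<in>space M. q \<le> s x n} = {}"
      by (elim bexE conjE)
    have "p x \<in> S \<longleftrightarrow> s x n < q" if "x \<in> space M" for x
    proof (cases "s x n < q")
      case True
      then show ?thesis using S(2) that by auto
    next
      case False
      then have "p x \<in> p ` {x\<in>space M. q \<le> s x n}" using that by auto
      then show ?thesis using S(3) False by blast
    qed
    then show ?thesis using S(1) by blast
  qed
  then obtain S where S: "\<And>n q. S n q \<in> sets borel" "\<And>n q x. x \<in> space M \<Longrightarrow> p x \<in> S n q \<longleftrightarrow> s x n < q"
    by metis
  \<comment> \<open>Extended reals make the infimum over an empty set of levels harmless.\<close>
  define t where "t z n = real_of_ereal (INF q\<in>\<rat>. if z \<in> S n q then ereal q else \<infinity>)" for z n
  have "(\<lambda>z. t z n) \<in> borel_measurable borel" for n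
    unfolding t_def using S(1)
    by (intro borel_measurable_real_of_ereal borel_measurable_INF countable_rat measurable_If_set) auto
  then have "t \<in> borel_measurable borel" by (rule measurable_coordinatewise_then_product)
  moreover have "t (p x) = s x" if x: "x \<in> space M" for x
  proof
    fix n
    have "(INF q\<in>\<rat>. if p x \<in> S n q then ereal q else \<infinity>) = ereal (s x n)"
    proof (rule antisym)
      show "(INF q\<in>\<rat>. if p x \<in> S n q then ereal q else \<infinity>) \<le> ereal (s x n)"
      proof (rule dense_ge)
        fix r assume "ereal (s x n) < r"
        then obtain q :: real where q: "q \<in> \<rat>" "s x n < q" "ereal q < r"
        proof (cases r)
          case (real r')
          with \<open>ereal (s x n) < r\<close> have "s x n < r'" by simp
          then obtain q where "q \<in> \<rat>" "s x n < q" "q < r'" using Rats_dense_in_real by blast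
          then show ?thesis using real that by auto
        next
          case PInf
          obtain q where "q \<in> \<rat>" "s x n < q" using Rats_dense_in_real[of "s x n" "s x n + 1"] by auto
          then show ?thesis using PInf that by auto
        qed auto
        have "(INF q\<in>\<rat>. if p x \<in> S n q then ereal q else \<infinity>) \<le> (if p x \<in> S n q then ereal q else \<infinity>)"
          by (rule INF_lower[OF q(1)])
        also have "\<dots> \<le> r" using q S(2)[OF x] by simp
        finally show "(INF q\<in>\<rat>. if p x \<in> S n q then ereal q else \<infinity>) \<le> r" .
      qed
    next
      show "ereal (s x n) \<le> (INF q\<in>\<rat>. if p x \<in> S n q then ereal q else \<infinity>)"
        by (rule INF_greatest) (simp add: S(2)[OF x])
    qed
    then show "t (p x) n = s x n" by (simp add: t_def)
  qed
  ultimately show thesis by (rule that)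
qed

section \<open>Standard Borel spaces\<close>

lemma sets_borel_of: "sets (borel_of X) = sigma_sets (topspace X) {U. openin X U}"
  and space_borel_of: "space (borel_of X) = topspace X"
proof -
  have "{U. openin X U} \<subseteq> Pow (topspace X)" using openin_subset by blast
  then show "sets (borel_of X) = sigma_sets (topspace X) {U. openin X U}" "space (borel_of X) = topspace X"
    unfolding borel_of_def by (rule sets_measure_of, rule space_measure_of)
qed

lemma openin_sets_borel_of: "openin X U \<Longrightarrow> U \<in> sets (borel_of X)"
  unfolding sets_borel_of by (intro sigma_sets.Basic) simp

lemma second_countable_euclidean: "second_countable (euclidean :: 'a::second_countable_topology topology)"
proof -
  obtain B :: "'a set set" where "countable B" "\<And>c. c \<in> B \<Longrightarrow> open c"
      "\<And>S. open S \<Longrightarrow> \<exists>U. U \<subseteq> B \<and> S = \<Union>U"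
    using univ_second_countable by metis
  then show ?thesis unfolding second_countable_def
    by (intro exI[of _ B]) (simp, blast)
qed

text \<open>Standard Borel structures are built from this: the topology is transported along an injection to
  the underlying type, where it must live.\<close>

lemma homeomorphic_pullback_topology:
  assumes "inj_on f S" "f ` S \<subseteq> topspace T"
  shows "pullback_topology S f T homeomorphic_space subtopology T (f ` S)"
proof -
  have top: "topspace (pullback_topology S f T) = S"
    using assms(2) by (auto simp: topspace_pullback_topology)
  have 1: "continuous_map (pullback_topology S f T) (subtopology T (f ` S)) f"
    unfolding continuous_map_def top
  proof (intro conjI allI impI)
    fix U assume "openin (subtopology T (f ` S)) U"
    then obtain V where V: "openin T V" "U = V \<inter> f ` S" by (auto simp: openin_subtopology)
    then have "{x \<in> S. f x \<in> U} = f -` V \<inter> S" by auto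
    then show "openin (pullback_topology S f T) {x \<in> S. f x \<in> U}"
      using V(1) by (auto simp: openin_pullback_topology)
  qed (use assms(2) in auto)
  have 2: "open_map (pullback_topology S f T) (subtopology T (f ` S)) f"
    unfolding open_map_def
  proof (intro allI impI)
    fix U assume "openin (pullback_topology S f T) U"
    then obtain V where V: "openin T V" "U = f -` V \<inter> S" by (auto simp: openin_pullback_topology)
    then have "f ` U = V \<inter> f ` S" by auto
    then show "openin (subtopology T (f ` S)) (f ` U)" using V(1) by (auto simp: openin_subtopology)
  qed
  have "homeomorphic_map (pullback_topology S f T) (subtopology T (f ` S)) f"
    by (rule bijective_open_imp_homeomorphic_map[OF 1 2]) (use assms top in auto)
  then show ?thesis by (rule homeomorphic_map_imp_homeomorphic_space)
qed

lemma sets_borel_of_pullback: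
  fixes f :: "'a \<Rightarrow> 'z::topological_space"
  shows "sets (borel_of (pullback_topology S f euclidean)) = {f -` B \<inter> S | B. B \<in> sets borel}"
proof -
  have "sets (borel_of (pullback_topology S f euclidean)) = sigma_sets S {f -` U \<inter> S | U. open U}"
    by (simp add: sets_borel_of openin_pullback_topology topspace_pullback_topology)
      (metis (mono_tags, lifting))
  also have "\<dots> = {f -` B \<inter> S | B. B \<in> sigma_sets UNIV {U. open U}}"
    using sigma_sets_vimage_commute[of f S UNIV "{U. open U}"] by simp
  finally show ?thesis by (simp add: sets_borel)
qed

lemma borel_coding_pullback:
  fixes e :: "'a \<Rightarrow> 'z::topological_space"
  assumes "inj_on e (space M)" "e ` space M \<in> sets borel"
    and "sets M = {e -` B \<inter> space M | B. B \<in> sets borel}"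
  shows "borel_coding M e (the_inv_into (space M) e)"
proof (rule borel_codingI)
  show "e \<in> borel_measurable M"
  proof (rule measurableI)
    show "e -` B \<inter> space M \<in> sets M" if "B \<in> sets borel" for B unfolding assms(3) using that by blast
  qed simp
next
  fix A assume "A \<in> sets M"
  then obtain B where "B \<in> sets borel" "A = e -` B \<inter> space M" unfolding assms(3) by blast
  then have "e ` A = B \<inter> e ` space M" by auto
  then show "e ` A \<in> sets borel" using \<open>B \<in> sets borel\<close> assms(2) by auto
qed (rule assms(1))

text \<open>The distances to the points of a dense sequence embed a separable metric space into the real
  sequences. Since completely metrizable subspaces are \<open>G\<^sub>\<delta>\<close> sets, the image is Borel.\<close>

lemma standard_borel_imp_coding:
  fixes M :: "'a measure"
  assumes "standard_borel M"
  obtains e :: "'a \<Rightarrow> nat \<Rightarrow> real" and d where "borel_coding M e d"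
proof -
  obtain X where X: "completely_metrizable_space X" "second_countable X"
    "space M = topspace X" "sets M = sets (borel_of X)"
    using assms unfolding standard_borel_def by blast
  obtain m where m: "Metric_space (topspace X) m" "X = Metric_space.mtopology (topspace X) m"
    using X(1) unfolding completely_metrizable_space_def
    by (metis Metric_space.topspace_mtopology)
  interpret m: Metric_space "topspace X" m by (rule m(1))
  obtain D where D: "countable D" "D \<subseteq> topspace X" "X closure_of D = topspace X"
    using second_countable_imp_separable_space[OF X(2)] unfolding separable_space_def by blast
  define a where "a = from_nat_into D"
  define e where "e x n = m x (a n)" for x n
  have near: "\<exists>n. a n \<in> topspace X \<and> m x (a n) < r" if "x \<in> topspace X" "0 < r" for x r
  proof -
    have "x \<in> X closure_of D" using that D(3) by simp
    moreover have "openin X (m.mball x r)" using m(2) m.openin_mball by metis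
    moreover have "x \<in> m.mball x r" using that by simp
    ultimately obtain y where y: "y \<in> D" "y \<in> m.mball x r"
      unfolding in_closure_of by blast
    then obtain n where "a n = y"
      unfolding a_def using range_from_nat_into[of D] D(1) by (metis emptyE rangeE)
    with y show ?thesis by auto
  qed
  have a: "a n \<in> topspace X" if "topspace X \<noteq> {}" for n
    unfolding a_def using D(2,3) that from_nat_into[of D] by (metis closure_of_empty subsetD)
  have cont: "continuous_map X euclidean e"
  proof -
    have "continuous_map X euclidean (\<lambda>x. e x n)" for n
    proof (cases "topspace X = {}")
      case False
      have "openin X {x \<in> topspace X. m x (a n) \<in> U}" if "open U" for U
      proof -
        have "\<exists>r>0. m.mball x r \<subseteq> {x \<in> topspace X. m x (a n) \<in> U}"
          if x: "x \<in> topspace X" "m x (a n) \<in> U" for x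
        proof -
          obtain r where r: "0 < r" "ball (m x (a n)) r \<subseteq> U"
            using x(2) \<open>open U\<close> open_contains_ball by blast
          have "m y (a n) \<in> U" if "y \<in> m.mball x r" for y
          proof -
            have y: "y \<in> topspace X" "m x y < r" using that by auto
            have "dist (m x (a n)) (m y (a n)) < r"
              using m.triangle[OF x(1) y(1) a[OF False, of n]] m.triangle[OF y(1) x(1) a[OF False, of n]]
                m.commute[of x y] y(2) unfolding dist_real_def by linarith
            then show ?thesis using r(2) by auto
          qed
          then show ?thesis using r(1) by auto
        qed
        then have "openin m.mtopology {x \<in> topspace X. m x (a n) \<in> U}"
          unfolding m.openin_mtopology by auto
        then show ?thesis using m(2) by simp
      qed
      then show ?thesis by (simp add: continuous_map_def e_def)
    next
      case True
      then have "openin X {x \<in> topspace X. P x}" for P by simp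
      then show ?thesis by (simp only: continuous_map_def) simp
    qed
    then show ?thesis by (metis continuous_map_componentwise_UNIV euclidean_product_topology)
  qed
  have local: "\<exists>V. open V \<and> e x \<in> V \<and> e -` V \<inter> topspace X \<subseteq> U" if U: "openin X U" "x \<in> U" for U x
  proof -
    have x: "x \<in> topspace X" using U openin_subset by blast
    obtain r where r: "0 < r" "m.mball x r \<subseteq> U"
      using U m(2) m.openin_mtopology by metis
    obtain n where n: "a n \<in> topspace X" "m x (a n) < r / 2" using near[OF x, of "r/2"] r(1) by auto
    let ?V = "(\<lambda>z :: nat \<Rightarrow> real. z n) -` {..< r / 2}"
    have "open ?V"
      by (intro open_vimage continuous_on_product_coordinates) auto
    moreover have "e -` ?V \<inter> topspace X \<subseteq> m.mball x r"
    proof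
      fix y assume "y \<in> e -` ?V \<inter> topspace X"
      then have "m y (a n) < r / 2" "y \<in> topspace X" by (auto simp: e_def)
      then show "y \<in> m.mball x r"
        using m.triangle[OF x n(1) \<open>y \<in> topspace X\<close>] m.commute[of y "a n"] x n(2) by auto
    qed
    ultimately show ?thesis using r(2) n(2) by (intro exI[of _ ?V]) (auto simp: e_def)
  qed
  have inj: "inj_on e (topspace X)"
  proof (rule inj_onI, rule ccontr)
    fix x y assume xy: "x \<in> topspace X" "y \<in> topspace X" "e x = e y" "x \<noteq> y"
    then have "0 < m x y" by auto
    have "openin X (m.mball x (m x y))" using m(2) m.openin_mball by metis
    then obtain V where V: "e x \<in> V" "e -` V \<inter> topspace X \<subseteq> m.mball x (m x y)"
      using local[of "m.mball x (m x y)" x] xy(1) \<open>0 < m x y\<close> by auto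
    then have "y \<in> m.mball x (m x y)" using xy by auto
    then show False by simp
  qed
  \<comment> \<open>The metric topology is the initial topology of the distance functions.\<close>
  have pull: "X = pullback_topology (topspace X) e euclidean"
  proof (rule topology_eq[THEN iffD2], intro allI iffI)
    fix U assume U: "openin X U"
    define V where "V = \<Union>{V. open V \<and> e -` V \<inter> topspace X \<subseteq> U}"
    have "U = e -` V \<inter> topspace X"
      using local[OF U] openin_subset[OF U] unfolding V_def by fastforce
    moreover have "open V" unfolding V_def by auto
    ultimately show "openin (pullback_topology (topspace X) e euclidean) U"
      by (auto simp: openin_pullback_topology)
  next
    fix U assume "openin (pullback_topology (topspace X) e euclidean) U"
    then obtain V where "open V" "U = {x \<in> topspace X. e x \<in> V}" by (auto simp: openin_pullback_topology)
    then show "openin X U" using openin_continuous_map_preimage[OF cont, of V] by simp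
  qed
  have "X homeomorphic_space top_of_set (e ` topspace X)"
    using homeomorphic_pullback_topology[OF inj, of euclidean, folded pull] by simp
  then have "completely_metrizable_space (top_of_set (e ` topspace X))"
    using X(1) homeomorphic_completely_metrizable_space by blast
  then have "gdelta_in euclidean (e ` topspace X)"
    by (subst completely_metrizable_space_eq_gdelta_in[OF completely_metrizable_space_euclidean, symmetric]) auto
  then have "\<exists>K. countable K \<and> K \<subseteq> {U. open U} \<and> \<Inter>K = e ` topspace X"
    by (simp add: gdelta_in_alt intersection_of_def)
  then obtain K where K: "countable K" "K \<subseteq> {U. open U}" "e ` topspace X = \<Inter>K"
    by (elim exE conjE) simp
  then have "e ` topspace X \<in> sets borel" 
  proof (cases "K = {}")
    case False
    have "(\<Inter>U\<in>K. U) \<in> sets borel"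
      by (rule sets.countable_INT'[OF K(1) False]) (use K(2) in auto)
    then show ?thesis using K(3) by simp
  qed (use K(3) in simp)
  moreover have "sets M = {e -` B \<inter> space M | B. B \<in> sets borel}"
    using sets_borel_of_pullback[of "topspace X" e, folded pull] X(3,4) by simp
  ultimately show thesis
    using borel_coding_pullback[of e M] inj that X(3) by simp
qed

text \<open>A Borel subset of a Polish space is in Borel bijection with a closed graph over it. The topology of
  that graph is completely metrizable, and it is pulled back to \<open>M\<close>.\<close>

lemma coding_imp_standard_borel:
  fixes e :: "'a \<Rightarrow> 'z::polish_space"
  assumes c: "borel_coding M e d"
  shows "standard_borel M"
proof -
  have e: "e \<in> borel_measurable M" and inj: "inj_on e (space M)" and eM: "e ` space M \<in> sets borel"
    using c unfolding borel_coding_def by (auto intro: inj_on_inverseI)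
  obtain f :: "'z \<Rightarrow> nat \<Rightarrow> real" where f: "f \<in> borel_measurable borel"
      "closed ((\<lambda>x. (x, f x)) ` e ` space M)"
    using borel_closed_graph_domain[OF eM] unfolding closed_graph_domain_def by blast
  define j where "j x = (e x, f (e x))" for x
  define X where "X = pullback_topology (space M) j euclidean"
  have top: "topspace X = space M" by (simp add: X_def topspace_pullback_topology)
  have hom: "X homeomorphic_space top_of_set (j ` space M)"
    unfolding X_def using inj by (intro homeomorphic_pullback_topology) (auto simp: inj_on_def j_def)
  have "closed (j ` space M)" using f(2) by (simp add: image_image j_def)
  then have "completely_metrizable_space (top_of_set (j ` space M))"
    by (intro completely_metrizable_space_closedin completely_metrizable_space_euclidean) simp
  then have "completely_metrizable_space X"
    using hom homeomorphic_completely_metrizable_space by blast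
  moreover have "second_countable X"
    using hom homeomorphic_space_second_countability second_countable_subtopology second_countable_euclidean by blast
  moreover have "sets M = sets (borel_of X)"
    unfolding X_def sets_borel_of_pullback
  proof (intro equalityI subsetI)
    fix A assume A: "A \<in> sets M"
    then have "A = j -` (e ` A \<times> UNIV) \<inter> space M"
      using inj_on_image_mem_iff[OF inj _ sets.sets_into_space[OF A]] sets.sets_into_space[OF A]
      by (auto simp: j_def) (metis imageI)
    moreover have "e ` A \<times> UNIV \<in> sets (borel :: ('z \<times> (nat \<Rightarrow> real)) measure)"
      unfolding borel_prod[symmetric] using borel_coding_image[OF c A] by auto
    ultimately show "A \<in> {j -` B \<inter> space M | B. B \<in> sets borel}" by blast
  next
    have "j \<in> borel_measurable M"
      unfolding j_def borel_prod[symmetric] by (intro measurable_Pair e measurable_compose[OF e f(1)])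
    then show "A \<in> sets M" if "A \<in> {j -` B \<inter> space M | B. B \<in> sets borel}" for A
      using that by (auto intro: measurable_sets)
  qed
  ultimately show ?thesis unfolding standard_borel_def using top by blast
qed

lemma standard_borel_restrict_space:
  assumes "standard_borel M" "A \<in> sets M"
  shows "standard_borel (restrict_space M A)"
proof -
  obtain e :: "'a \<Rightarrow> nat \<Rightarrow> real" and d where c: "borel_coding M e d"
    using standard_borel_imp_coding[OF assms(1)] by blast
  have "A \<subseteq> space M" using assms(2) by (rule sets.sets_into_space)
  then have sp: "space (restrict_space M A) = A" by (auto simp: space_restrict_space)
  have "borel_coding (restrict_space M A) e (the_inv_into (space (restrict_space M A)) e)"
  proof (rule borel_codingI)
    show "inj_on e (space (restrict_space M A))"
      using c \<open>A \<subseteq> space M\<close> unfolding sp borel_coding_def by (intro inj_on_inverseI[where g=d]) auto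
    show "e ` B \<in> sets borel" if "B \<in> sets (restrict_space M A)" for B
      using that borel_coding_image[OF c] assms(2) by (auto simp: sets_restrict_space_iff)
  qed (use c in \<open>auto simp: borel_coding_def intro: measurable_restrict_space1\<close>)
  then show ?thesis by (rule coding_imp_standard_borel)
qed

lemma standard_borel_pair:
  assumes "standard_borel M" "standard_borel N"
  shows "standard_borel (M \<Otimes>\<^sub>M N)"
proof -
  obtain e :: "'a \<Rightarrow> nat \<Rightarrow> real" and d where c: "borel_coding M e d"
    using standard_borel_imp_coding[OF assms(1)] by blast
  obtain e' :: "'b \<Rightarrow> nat \<Rightarrow> real" and d' where c': "borel_coding N e' d'"
    using standard_borel_imp_coding[OF assms(2)] by blast
  have m: "e \<in> borel_measurable M" "e' \<in> borel_measurable N" using c c' by (auto simp: borel_coding_def)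
  have inj: "inj_on e (space M)" "inj_on e' (space N)"
    using c c' unfolding borel_coding_def by (auto intro: inj_on_inverseI)
  have inj': "inj_on (map_prod e e') (space M \<times> space N)" using inj by (rule map_prod_inj_on)
  have im: "map_prod e e' ` A \<in> sets borel" if "A \<in> sets (M \<Otimes>\<^sub>M N)" for A
  proof -
    have full: "map_prod e e' ` (space M \<times> space N) \<in> sets borel"
    proof -
      have "map_prod e e' ` (space M \<times> space N) = e ` space M \<times> e' ` space N" by (rule map_prod_surj_on) simp_all
      then show ?thesis using c c' unfolding borel_coding_def by (auto simp: borel_prod[symmetric])
    qed
    show ?thesis using that unfolding sets_pair_measure
    proof (induction rule: sigma_sets.induct)
      case (Basic A)
      then obtain a b where "a \<in> sets M" "b \<in> sets N" "A = a \<times> b" by auto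
      moreover have "map_prod e e' ` (a \<times> b) = e ` a \<times> e' ` b" by auto
      ultimately show ?case
        using borel_coding_image[OF c] borel_coding_image[OF c'] by (auto simp: borel_prod[symmetric])
    next
      case (Compl A)
      have "A \<subseteq> space M \<times> space N"
        by (rule sigma_sets_into_sp[OF pair_measure_closed Compl.hyps])
      then have "map_prod e e' ` (space M \<times> space N - A) = map_prod e e' ` (space M \<times> space N) - map_prod e e' ` A"
        by (intro inj_on_image_set_diff[OF inj']) auto
      then show ?case using full Compl.IH by auto
    qed (auto simp: image_UN)
  qed
  have "borel_coding (M \<Otimes>\<^sub>M N) (map_prod e e') (the_inv_into (space (M \<Otimes>\<^sub>M N)) (map_prod e e'))"
    by (rule borel_codingI)
      (use m inj' im in \<open>auto simp: space_pair_measure map_prod_def borel_prod[symmetric] split_beta\<close>)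
  then show ?thesis by (rule coding_imp_standard_borel)
qed

section \<open>Quasi-Polish spaces\<close>

text \<open>If a point is identified with the set of coordinates where it is true, these are the supersets of \<open>K\<close>.
  For finite \<open>K\<close> they form a base of the Sierpinski power, the Scott topology.\<close>

definition upper :: "nat set \<Rightarrow> (nat \<Rightarrow> bool) set" where
  "upper K = {u. \<forall>n\<in>K. u n}"

abbreviation sierpinski_power :: "(nat \<Rightarrow> bool) topology" where
  "sierpinski_power \<equiv> product_topology (\<lambda>_. sierpinski) UNIV"

text \<open>A basic open box restricts only finitely many coordinates, and the only proper nonempty open set
  of the Sierpinski space is \<open>{True}\<close>.\<close>

lemma openin_sierpinski_power_upper:
  assumes U: "openin sierpinski_power U" "u \<in> U"
  obtains K where "finite K" "u \<in> upper K" "upper K \<subseteq> U"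
proof -
  obtain V where V: "finite {i. V i \<noteq> UNIV}" "\<And>i. openin sierpinski (V i)"
      "u \<in> Pi\<^sub>E UNIV V" "Pi\<^sub>E UNIV V \<subseteq> U"
    using U(1)[unfolded openin_product_topology_alt, rule_format, OF U(2)]
    by (auto simp: topspace_sierpinski)
  have V': "V i = {True} \<or> V i = UNIV" for i
  proof -
    have "V i \<in> {{}, {True}, {False, True}}" using V(2) by (simp only: openin_sierpinski)
    moreover have "u i \<in> V i" using V(3) by auto
    ultimately show ?thesis by auto
  qed
  have in_V: "w \<in> Pi\<^sub>E UNIV V" if "\<And>i. V i = {True} \<Longrightarrow> w i" for w
  proof -
    have "w i \<in> V i" for i using V'[of i] that[of i] by auto
    then show ?thesis by auto
  qed
  show thesis
  proof
    show "finite {i. V i \<noteq> UNIV}" by (rule V(1))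
    show "u \<in> upper {i. V i \<noteq> UNIV}"
    proof -
      have "u i" if "V i \<noteq> UNIV" for i
      proof -
        have "u i \<in> V i" using V(3) by auto
        then show ?thesis using V'[of i] that by auto
      qed
      then show ?thesis by (simp add: upper_def)
    qed
    have "{True} \<noteq> (UNIV :: bool set)" by auto
    then show "upper {i. V i \<noteq> UNIV} \<subseteq> U"
    proof (intro subsetI)
      fix w assume w: "w \<in> upper {i. V i \<noteq> UNIV}"
      have "w \<in> Pi\<^sub>E UNIV V"
      proof (rule in_V)
        fix i assume "V i = {True}"
        then show "w i" using w \<open>{True} \<noteq> UNIV\<close> by (simp add: upper_def)
      qed
      with V(4) show "w \<in> U" ..
    qed
  qed
qed

lemma openin_upper:
  assumes "finite K" shows "openin sierpinski_power (upper K)"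
  unfolding openin_product_topology_alt
proof (intro ballI)
  fix u assume u: "u \<in> upper K"
  let ?V = "\<lambda>i. if i \<in> K then {True} else UNIV"
  have "{i \<in> UNIV. ?V i \<noteq> topspace sierpinski} \<subseteq> K"
    by (auto simp: topspace_sierpinski)
  then have fin: "finite {i \<in> UNIV. ?V i \<noteq> topspace sierpinski}"
    using assms by (rule finite_subset)
  have op: "openin sierpinski (?V i)" for i
    unfolding openin_sierpinski by auto
  show "\<exists>V. finite {i \<in> UNIV. V i \<noteq> topspace sierpinski} \<and> (\<forall>i\<in>UNIV. openin sierpinski (V i)) \<and>
      u \<in> Pi\<^sub>E UNIV V \<and> Pi\<^sub>E UNIV V \<subseteq> upper K"
  proof (intro exI[of _ ?V] conjI ballI)
    show "u \<in> Pi\<^sub>E UNIV ?V" using u by (auto simp: upper_def)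
    show "Pi\<^sub>E UNIV ?V \<subseteq> upper K"
    proof
      fix w assume "w \<in> Pi\<^sub>E UNIV ?V"
      then have "w i \<in> ?V i" for i by (rule PiE_mem) simp
      from this[of i for i] have "w i" if "i \<in> K" for i
        using that by (metis singletonD)
      then show "w \<in> upper K" by (simp add: upper_def)
    qed
  qed (rule fin op)+
qed

lemma openin_sierpinski_power_Union:
  assumes "openin sierpinski_power U"
  shows "U = (\<Union>K\<in>{K. finite K \<and> upper K \<subseteq> U}. upper K)"
proof
  show "(\<Union>K\<in>{K. finite K \<and> upper K \<subseteq> U}. upper K) \<subseteq> U" by auto
  show "U \<subseteq> (\<Union>K\<in>{K. finite K \<and> upper K \<subseteq> U}. upper K)"
  proof
  fix u assume "u \<in> U"
  then obtain K where "finite K" "u \<in> upper K" "upper K \<subseteq> U"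
    by (rule openin_sierpinski_power_upper[OF assms])
  then show "u \<in> (\<Union>K\<in>{K. finite K \<and> upper K \<subseteq> U}. upper K)" by (intro UN_I[of K]) simp_all
  qed
qed

lemma countable_finite_nat_sets: "countable {K :: nat set. finite K \<and> P K}"
  by (rule countable_subset[OF _ countable_Collect_finite]) auto

lemma second_countable_sierpinski_power: "second_countable sierpinski_power"
  unfolding second_countable_def
proof (intro exI conjI allI impI ballI)
  show "countable (upper ` {K. finite K})" by (intro countable_image countable_Collect_finite)
  show "\<exists>V\<in>upper ` {K. finite K}. u \<in> V \<and> V \<subseteq> U" if "openin sierpinski_power U \<and> u \<in> U" for U u
  proof -
    from that obtain K where "finite K" "u \<in> upper K" "upper K \<subseteq> U"
      using openin_sierpinski_power_upper by (metis (no_types))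
    then show ?thesis by (intro bexI[of _ "upper K"]) simp_all
  qed
qed (auto simp: openin_upper)

lemma pi02_inE:
  assumes "pi02_in X A"
  obtains C U where "\<And>i::nat. closedin X (C i)" "\<And>i::nat. openin X (U i)" "A = (\<Inter>i. C i \<union> U i)"
proof -
  obtain C U where "\<forall>i::nat. closedin X (C i) \<and> openin X (U i)" "A = (\<Inter>i. C i \<union> U i)"
    using assms unfolding pi02_in_def by (elim exE conjE)
  then show thesis by (intro that[of C U]) simp_all
qed

lemma quasi_polish_embedding:
  assumes "quasi_polish X"
  obtains \<phi> A where "pi02_in sierpinski_power A" "homeomorphic_map X (subtopology sierpinski_power A) \<phi>"
proof -
  obtain A where A: "pi02_in sierpinski_power A" "X homeomorphic_space subtopology sierpinski_power A"
    using assms unfolding quasi_polish_def Let_def by (elim exE conjE)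
  from A(2) obtain \<phi> where "homeomorphic_map X (subtopology sierpinski_power A) \<phi>"
    unfolding homeomorphic_space by (elim exE)
  with A(1) show thesis by (rule that)
qed

lemma quasi_polish_second_countable:
  assumes "quasi_polish X" shows "second_countable X"
proof -
  obtain A where "X homeomorphic_space subtopology sierpinski_power A"
    using assms unfolding quasi_polish_def Let_def by (elim exE conjE)
  from homeomorphic_space_second_countability[OF this]
  show ?thesis by (simp add: second_countable_subtopology second_countable_sierpinski_power)
qed

text \<open>Sequences of reals with values 0 and 1 represent points of the Sierpinski power; the finer
  topology has the same Borel sets, since every open set is a countable union of basic ones.\<close>

lemma vimage_sierpinski_open_borel:
  assumes "openin sierpinski_power U"
  shows "{z :: nat \<Rightarrow> real. (\<lambda>n. z n = 1) \<in> U} \<in> sets borel"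
proof -
  have "{z :: nat \<Rightarrow> real. (\<lambda>n. z n = 1) \<in> upper K} \<in> sets borel" if "finite K" for K
  proof -
    have "{z \<in> space (borel :: (nat \<Rightarrow> real) measure). \<forall>n\<in>K. z n = 1} \<in> sets borel"
      using that by (intro sets.sets_Collect_finite_All measurable_Collect_eq measurable_product_coordinates) auto
    then show ?thesis by (simp add: upper_def)
  qed
  then have "(\<Union>K\<in>{K. finite K \<and> upper K \<subseteq> U}. {z :: nat \<Rightarrow> real. (\<lambda>n. z n = 1) \<in> upper K}) \<in> sets borel"
    by (intro sets.countable_UN' countable_finite_nat_sets) auto
  also have "(\<Union>K\<in>{K. finite K \<and> upper K \<subseteq> U}. {z :: nat \<Rightarrow> real. (\<lambda>n. z n = 1) \<in> upper K})
     = {z. (\<lambda>n. z n = 1) \<in> (\<Union>K\<in>{K. finite K \<and> upper K \<subseteq> U}. upper K)}" by auto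
  finally show ?thesis using openin_sierpinski_power_Union[OF assms] by simp
qed

lemma quasi_polish_standard_borel:
  assumes "quasi_polish X" shows "standard_borel (borel_of X)"
proof -
  obtain \<phi> A where A: "pi02_in sierpinski_power A" and \<phi>: "homeomorphic_map X (subtopology sierpinski_power A) \<phi>"
    by (rule quasi_polish_embedding[OF assms])
  have inj: "inj_on \<phi> (topspace X)" and im: "\<phi> ` topspace X = A"
    and cont: "continuous_map X (subtopology sierpinski_power A) \<phi>"
    and op: "open_map X (subtopology sierpinski_power A) \<phi>"
    using \<phi> by (auto simp: homeomorphic_eq_everything_map topspace_sierpinski)
  define e :: "'a \<Rightarrow> nat \<Rightarrow> real" where "e x n = (if \<phi> x n then 1 else 0)" for x n
  have \<phi>_e: "(\<lambda>n. e x n = 1) = \<phi> x" for x by (auto simp: e_def)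
  have "inj_on e (topspace X)" using inj unfolding inj_on_def by (metis \<phi>_e)
  moreover have "e ` topspace X \<in> sets borel"
  proof -
    obtain C U where CU: "\<And>i::nat. closedin sierpinski_power (C i)" "\<And>i. openin sierpinski_power (U i)"
      "A = (\<Inter>i. C i \<union> U i)" using A by (rule pi02_inE) (rule that)
    have C: "{z :: nat \<Rightarrow> real. (\<lambda>n. z n = 1) \<in> C i} \<in> sets borel" for i
    proof -
      have "openin sierpinski_power (UNIV - C i)"
        using CU(1)[of i] by (simp add: closedin_def topspace_sierpinski)
      from vimage_sierpinski_open_borel[OF this]
      have "- {z :: nat \<Rightarrow> real. (\<lambda>n. z n = 1) \<in> UNIV - C i} \<in> sets borel" by (rule borel_comp)
      then show ?thesis by (simp add: Collect_neg_eq[symmetric])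
    qed
    have 1: "(\<Inter>i. {z :: nat \<Rightarrow> real. (\<lambda>n. z n = 1) \<in> C i} \<union> {z. (\<lambda>n. z n = 1) \<in> U i}) \<in> sets borel"
      using C vimage_sierpinski_open_borel[OF CU(2)] by (intro sets.countable_INT) auto
    have 2: "(\<Inter>n. {z :: nat \<Rightarrow> real. z n = 0 \<or> z n = 1}) \<in> sets borel"
    proof (intro sets.countable_INT image_subsetI)
      fix n :: nat
      have "(\<lambda>z :: nat \<Rightarrow> real. z n) -` {0, 1} \<inter> space borel \<in> sets borel"
        by (intro measurable_sets[OF measurable_product_coordinates]) auto
      then show "{z :: nat \<Rightarrow> real. z n = 0 \<or> z n = 1} \<in> sets borel" by (simp add: vimage_def)
    qed auto
    have "e ` topspace X = (\<Inter>i. {z. (\<lambda>n. z n = 1) \<in> C i} \<union> {z. (\<lambda>n. z n = 1) \<in> U i}) \<inter> (\<Inter>n. {z. z n = 0 \<or> z n = 1})"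
    proof (intro equalityI subsetI)
      fix z assume "z \<in> e ` topspace X"
      then obtain x where x: "x \<in> topspace X" "z = e x" by blast
      then have "\<phi> x \<in> A" using im by blast
      then show "z \<in> (\<Inter>i. {z. (\<lambda>n. z n = 1) \<in> C i} \<union> {z. (\<lambda>n. z n = 1) \<in> U i}) \<inter> (\<Inter>n. {z. z n = 0 \<or> z n = 1})"
        using x(2) CU(3) by (auto simp: \<phi>_e e_def)
    next
      fix z :: "nat \<Rightarrow> real"
      assume z: "z \<in> (\<Inter>i. {z. (\<lambda>n. z n = 1) \<in> C i} \<union> {z. (\<lambda>n. z n = 1) \<in> U i}) \<inter> (\<Inter>n. {z. z n = 0 \<or> z n = 1})"
      then have "(\<lambda>n. z n = 1) \<in> A" using CU(3) by auto
      then obtain x where x: "x \<in> topspace X" "\<phi> x = (\<lambda>n. z n = 1)" using im by (metis (mono_tags) imageE)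
      have "z n = 0 \<or> z n = 1" for n using z by simp
      then have "z = e x" unfolding fun_eq_iff e_def x(2) by auto
      then show "z \<in> e ` topspace X" using x(1) by blast
    qed
    then show ?thesis using 1 2 by (simp only:) (rule sets.Int)
  qed
  moreover have "sets (borel_of X) = {e -` B \<inter> topspace X | B. B \<in> sets borel}"
  proof
    have "{e -` B \<inter> topspace X | B. B \<in> sets borel} = sets (vimage_algebra (topspace X) e borel)"
      by (simp add: sets_vimage_algebra2)
    moreover have "U \<in> {e -` B \<inter> topspace X | B. B \<in> sets borel}" if U: "openin X U" for U
    proof -
      have "openin (subtopology sierpinski_power A) (\<phi> ` U)" using op U by (simp add: open_map_def)
      then obtain V where V: "openin sierpinski_power V" "\<phi> ` U = V \<inter> A" by (auto simp: openin_subtopology)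
      have "x \<in> U \<longleftrightarrow> \<phi> x \<in> V" if "x \<in> topspace X" for x
        using inj_on_image_mem_iff[OF inj that openin_subset[OF U]] V(2) im that by blast
      then have "U = e -` {z. (\<lambda>n. z n = 1) \<in> V} \<inter> topspace X"
        using openin_subset[OF U] by (auto simp: \<phi>_e)
      then show ?thesis using vimage_sierpinski_open_borel[OF V(1)] by blast
    qed
    ultimately show "sets (borel_of X) \<subseteq> {e -` B \<inter> topspace X | B. B \<in> sets borel}"
      unfolding sets_borel_of
      by (metis (mono_tags, lifting) mem_Collect_eq sets.sigma_sets_subset space_vimage_algebra subsetI)
  next
    have "{x \<in> topspace X. \<phi> x n} \<in> sets (borel_of X)" for n
    proof -
      have "openin (subtopology sierpinski_power A) (A \<inter> upper {n})"
        using openin_upper[of "{n}"] by (auto simp: openin_subtopology)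
      from openin_continuous_map_preimage[OF cont this]
      have "openin X {x \<in> topspace X. \<phi> x \<in> A \<inter> upper {n}}" .
      moreover have "{x \<in> topspace X. \<phi> x \<in> A \<inter> upper {n}} = {x \<in> topspace X. \<phi> x n}"
        using im by (auto simp: upper_def)
      ultimately show ?thesis by (simp add: openin_sets_borel_of)
    qed
    then have "(\<lambda>x. e x n) \<in> borel_measurable (borel_of X)" for n
      unfolding e_def by (intro measurable_If) (auto simp: space_borel_of)
    then have "e \<in> borel_measurable (borel_of X)" by (rule measurable_coordinatewise_then_product)
    then show "{e -` B \<inter> topspace X | B. B \<in> sets borel} \<subseteq> sets (borel_of X)"
      by (auto simp: space_borel_of[symmetric] intro: measurable_sets)
  qed
  ultimately have "borel_coding (borel_of X) e (the_inv_into (space (borel_of X)) e)"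
    by (intro borel_coding_pullback) (simp_all add: space_borel_of)
  then show ?thesis by (rule coding_imp_standard_borel)
qed

lemma pi02_in_Int:
  assumes "pi02_in X A" "pi02_in X B" shows "pi02_in X (A \<inter> B)"
proof -
  obtain C U where A: "\<And>i::nat. closedin X (C i)" "\<And>i. openin X (U i)" "A = (\<Inter>i. C i \<union> U i)"
    using assms(1) by (rule pi02_inE) (rule that)
  obtain C' U' where B: "\<And>i::nat. closedin X (C' i)" "\<And>i. openin X (U' i)" "B = (\<Inter>i. C' i \<union> U' i)"
    using assms(2) by (rule pi02_inE) (rule that)
  define D where "D i = (if even i then C (i div 2) else C' (i div 2))" for i
  define V where "V i = (if even i then U (i div 2) else U' (i div 2))" for i
  have "A \<inter> B = (\<Inter>i. D i \<union> V i)"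
  proof (intro equalityI subsetI)
    fix x assume x: "x \<in> (\<Inter>i. D i \<union> V i)"
    have "x \<in> C i \<union> U i" "x \<in> C' i \<union> U' i" for i
      using INT_D[OF x, of "2 * i"] INT_D[OF x, of "Suc (2 * i)"] by (auto simp: D_def V_def)
    then show "x \<in> A \<inter> B" unfolding A(3) B(3) by blast
  qed (auto simp: A(3) B(3) D_def V_def)
  then show ?thesis unfolding pi02_in_def using A(1,2) B(1,2)
    by (intro exI[of _ D] exI[of _ V]) (simp add: D_def V_def)
qed

lemma quasi_polish_subtopology:
  assumes X: "quasi_polish X" and S: "pi02_in X S"
  shows "quasi_polish (subtopology X S)"
proof -
  obtain \<phi> A where A: "pi02_in sierpinski_power A" and \<phi>: "homeomorphic_map X (subtopology sierpinski_power A) \<phi>"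
    by (rule quasi_polish_embedding[OF X])
  have inj: "inj_on \<phi> (topspace X)" and im: "\<phi> ` topspace X = A"
    using \<phi> by (auto simp: homeomorphic_eq_everything_map topspace_sierpinski)
  obtain C U where CU: "\<And>i::nat. closedin X (C i)" "\<And>i. openin X (U i)" "S = (\<Inter>i. C i \<union> U i)"
    using S by (rule pi02_inE) (rule that)
  have "\<exists>D. closedin sierpinski_power D \<and> \<phi> ` C i = D \<inter> A" for i
    using homeomorphic_map_closedness[OF \<phi> closedin_subset[OF CU(1)]] CU(1) by (auto simp: closedin_subtopology)
  then obtain D where D: "\<And>i. closedin sierpinski_power (D i)" "\<And>i. \<phi> ` C i = D i \<inter> A" by metis
  have "\<exists>V. openin sierpinski_power V \<and> \<phi> ` U i = V \<inter> A" for i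
    using homeomorphic_map_openness[OF \<phi> openin_subset[OF CU(2)]] CU(2) by (auto simp: openin_subtopology)
  then obtain V where V: "\<And>i. openin sierpinski_power (V i)" "\<And>i. \<phi> ` U i = V i \<inter> A" by metis
  define T where "T = (\<Inter>i. D i \<union> V i)"
  have "\<phi> ` S = A \<inter> T"
  proof -
    have "\<phi> ` S = (\<Inter>i. \<phi> ` (C i \<union> U i))"
      unfolding CU(3) using closedin_subset[OF CU(1)] openin_subset[OF CU(2)]
      by (intro image_INT[OF inj]) auto
    also have "\<dots> = A \<inter> T" by (auto simp: image_Un D(2) V(2) T_def)
    finally show ?thesis .
  qed
  have "S \<subseteq> topspace X"
    unfolding CU(3) using closedin_subset[OF CU(1)] openin_subset[OF CU(2)] by blast
  then have "homeomorphic_map (subtopology X S) (subtopology (subtopology sierpinski_power A) T) \<phi>"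
  proof (intro homeomorphic_map_subtopologies[OF \<phi>])
    have "topspace X \<inter> S = S" using \<open>S \<subseteq> topspace X\<close> by blast
    then show "\<phi> ` (topspace X \<inter> S) = topspace (subtopology sierpinski_power A) \<inter> T"
      using \<open>\<phi> ` S = A \<inter> T\<close> by (simp add: topspace_sierpinski)
  qed
  then have "subtopology X S homeomorphic_space subtopology sierpinski_power (A \<inter> T)"
    using homeomorphic_map_imp_homeomorphic_space by (fastforce simp: subtopology_subtopology)
  moreover have "pi02_in sierpinski_power (A \<inter> T)"
  proof (rule pi02_in_Int[OF A])
    show "pi02_in sierpinski_power T"
      unfolding pi02_in_def T_def using D(1) V(1) by (intro exI[of _ D] exI[of _ V]) simp
  qed
  ultimately show ?thesis unfolding quasi_polish_def Let_def by blast
qed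

text \<open>Points of a quasi-Polish space need not be closed, but they are \<open>\<Pi>\<^sup>0\<^sub>2\<close>: the condition \<open>f x = y\<close> is
  the conjunction over \<open>n\<close> of conditions on the \<open>n\<close>-th coordinate, each open or closed.\<close>

lemma quasi_polish_fibre:
  assumes X: "quasi_polish X" and Y: "quasi_polish Y" and f: "continuous_map X Y f" and y: "y \<in> topspace Y"
  shows "quasi_polish (subtopology X {x \<in> topspace X. f x = y})"
proof (rule quasi_polish_subtopology[OF X])
  obtain \<phi> A where \<phi>: "homeomorphic_map Y (subtopology sierpinski_power A) \<phi>"
    by (rule quasi_polish_embedding[OF Y])
  have inj: "inj_on \<phi> (topspace Y)" and im: "\<phi> ` topspace Y = A"
    and cont: "continuous_map Y (subtopology sierpinski_power A) \<phi>"
    using \<phi> by (auto simp: homeomorphic_eq_everything_map topspace_sierpinski)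
  define V where "V n = {x \<in> topspace X. \<phi> (f x) n}" for n
  have V: "openin X (V n)" for n
  proof -
    have "openin (subtopology sierpinski_power A) (A \<inter> upper {n})"
      using openin_upper[of "{n}"] by (auto simp: openin_subtopology)
    from openin_continuous_map_preimage[OF continuous_map_compose[OF f cont] this]
    have "openin X {x \<in> topspace X. \<phi> (f x) \<in> A \<inter> upper {n}}" by simp
    moreover have "{x \<in> topspace X. \<phi> (f x) \<in> A \<inter> upper {n}} = V n"
      using im f by (auto simp: upper_def V_def continuous_map_def)
    ultimately show ?thesis by simp
  qed
  have "f x = y \<longleftrightarrow> (\<forall>n. \<phi> (f x) n = \<phi> y n)" if "x \<in> topspace X" for x
    using inj y f that by (auto simp: inj_on_def continuous_map_def fun_eq_iff[symmetric])
  then have "x \<in> {x \<in> topspace X. f x = y} \<longleftrightarrow> x \<in> topspace X \<and> (\<forall>n. \<phi> (f x) n = \<phi> y n)" for x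
    by auto
  also have "(x \<in> topspace X \<and> (\<forall>n. \<phi> (f x) n = \<phi> y n)) \<longleftrightarrow> x \<in> (\<Inter>n. (if \<phi> y n then {} else topspace X - V n) \<union> (if \<phi> y n then V n else {}))" for x
    by (auto simp: V_def)
  finally have "{x \<in> topspace X. f x = y} =
      (\<Inter>n. (if \<phi> y n then {} else topspace X - V n) \<union> (if \<phi> y n then V n else {}))"
    by (rule set_eqI)
  then show "pi02_in X {x \<in> topspace X. f x = y}"
    unfolding pi02_in_def using V
    by (intro exI[of _ "\<lambda>n. if \<phi> y n then {} else topspace X - V n"] exI[of _ "\<lambda>n. if \<phi> y n then V n else {}"]) auto
qed

section \<open>Baire category\<close>

text \<open>The usual shrinking neighbourhoods are replaced by increasing finite sets \<open>s 0 \<subseteq> s 1 \<subseteq> \<dots>\<close> of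
  coordinates required to be true, each compatible with some point of \<open>A\<close>. Their union \<open>u\<close> lies in \<open>A\<close>
  because for each clause \<open>C i \<union> V i\<close>: if \<open>u\<close> is outside \<open>C i\<close>, then some \<open>s n\<close> already forces this, and
  from then on the construction also forces membership in \<open>V i\<close>.\<close>

lemma quasi_polish_Baire:
  assumes X: "quasi_polish X"
    and U: "\<And>n::nat. openin X (U n)" "\<And>n W. openin X W \<Longrightarrow> W \<noteq> {} \<Longrightarrow> W \<inter> U n \<noteq> {}"
    and W: "openin X W" "W \<noteq> {}"
  shows "W \<inter> (\<Inter>n. U n) \<noteq> {}"
proof -
  obtain \<phi> A where A: "pi02_in sierpinski_power A" and \<phi>: "homeomorphic_map X (subtopology sierpinski_power A) \<phi>"
    by (rule quasi_polish_embedding[OF X])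
  have inj: "inj_on \<phi> (topspace X)" and im: "\<phi> ` topspace X = A"
    and cont: "continuous_map X (subtopology sierpinski_power A) \<phi>"
    using \<phi> by (auto simp: homeomorphic_eq_everything_map topspace_sierpinski)
  obtain C V where CV: "\<And>i::nat. closedin sierpinski_power (C i)" "\<And>i. openin sierpinski_power (V i)"
      "A = (\<Inter>i. C i \<union> V i)" using A by (rule pi02_inE) (rule that)
  have C: "openin sierpinski_power (- C i)" for i
    using CV(1)[of i] by (simp add: closedin_def topspace_sierpinski Compl_eq_Diff_UNIV)
  have "\<exists>O'. openin sierpinski_power O' \<and> \<phi> ` Q = O' \<inter> A" if "openin X Q" for Q
    using homeomorphic_map_openness[OF \<phi> openin_subset[OF that]] that by (auto simp: openin_subtopology)
  then obtain E where E: "\<And>Q. openin X Q \<Longrightarrow> openin sierpinski_power (E Q)" "\<And>Q. openin X Q \<Longrightarrow> \<phi> ` Q = E Q \<inter> A"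
    by metis
  have dense: "upper K \<inter> A \<inter> E (U n) \<noteq> {}" if "finite K" "upper K \<inter> A \<noteq> {}" for K n
  proof -
    have "openin (subtopology sierpinski_power A) (A \<inter> upper K)"
      using openin_upper[OF that(1)] by (auto simp: openin_subtopology)
    from openin_continuous_map_preimage[OF cont this]
    have "openin X {x \<in> topspace X. \<phi> x \<in> A \<inter> upper K}" .
    moreover have "{x \<in> topspace X. \<phi> x \<in> A \<inter> upper K} \<noteq> {}" using that(2) im by auto
    ultimately obtain x where "x \<in> topspace X" "\<phi> x \<in> A \<inter> upper K" "x \<in> U n"
      using U(2)[of "{x \<in> topspace X. \<phi> x \<in> A \<inter> upper K}" n] by auto
    then show ?thesis using E(2)[OF U(1)[of n]] by blast
  qed
  define ok where "ok K \<longleftrightarrow> finite K \<and> upper K \<inter> A \<noteq> {}" for K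
  have upper_Un: "upper (K \<union> L) = upper K \<inter> upper L" for K L by (auto simp: upper_def)
  have step: "\<exists>L. ok L \<and> K \<subseteq> L \<and> upper L \<subseteq> E (U n) \<and> (\<forall>i\<le>n. upper K \<subseteq> - C i \<longrightarrow> upper L \<subseteq> V i)"
    if K: "ok K" for K n
  proof -
    obtain a where a: "a \<in> upper K" "a \<in> A" "a \<in> E (U n)" using dense K unfolding ok_def by blast
    obtain L where L: "finite L" "a \<in> upper L" "upper L \<subseteq> E (U n)"
      using openin_sierpinski_power_upper[OF E(1)[OF U(1)] a(3)] by metis
    have "\<exists>M. finite M \<and> a \<in> upper M \<and> (upper K \<subseteq> - C i \<longrightarrow> upper M \<subseteq> V i)" for i
    proof (cases "upper K \<subseteq> - C i")
      case True
      then have "a \<in> V i" using a(1,2) CV(3) by blast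
      then show ?thesis using openin_sierpinski_power_upper[OF CV(2)] by metis
    next
      case False
      then show ?thesis by (intro exI[of _ "{}"]) (auto simp: upper_def)
    qed
    then obtain M where M: "\<And>i. finite (M i)" "\<And>i. a \<in> upper (M i)" "\<And>i. upper K \<subseteq> - C i \<Longrightarrow> upper (M i) \<subseteq> V i"
      by metis
    \<comment> \<open>The next condition enters \<open>E (U n)\<close>, and enters \<open>V i\<close> for every \<open>i \<le> n\<close> whose \<open>C i\<close> is already excluded.\<close>
    define N where "N = K \<union> L \<union> (\<Union>i\<in>{..n}. M i)"
    have "finite N" using K L(1) M(1) by (auto simp: N_def ok_def)
    moreover have "a \<in> upper N" using a(1) L(2) M(2) by (auto simp: N_def upper_def)
    moreover have "upper N \<subseteq> upper L" "\<And>i. i \<le> n \<Longrightarrow> upper N \<subseteq> upper (M i)" by (auto simp: N_def upper_def)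
    moreover have "K \<subseteq> N" by (simp add: N_def le_supI1)
    moreover have "\<forall>i\<le>n. upper K \<subseteq> - C i \<longrightarrow> upper N \<subseteq> V i"
      using M(3) \<open>\<And>i. i \<le> n \<Longrightarrow> upper N \<subseteq> upper (M i)\<close> by (meson order_trans)
    ultimately show ?thesis
      using a(2) L(3) unfolding ok_def by (intro exI[of _ N] conjI) (auto simp: disjoint_iff)
  qed
  obtain w where "w \<in> W" using W(2) by blast
  then have "\<phi> w \<in> E W" "\<phi> w \<in> A" using E(2)[OF W(1)] by blast+
  then obtain K0 where K0: "finite K0" "\<phi> w \<in> upper K0" "upper K0 \<subseteq> E W"
    using openin_sierpinski_power_upper[OF E(1)[OF W(1)]] by metis
  have "\<exists>s. \<forall>n. (ok (s n) \<and> upper (s n) \<subseteq> E W) \<and> (s n \<subseteq> s (Suc n) \<and> upper (s (Suc n)) \<subseteq> E (U n) \<and>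
      (\<forall>i\<le>n. upper (s n) \<subseteq> - C i \<longrightarrow> upper (s (Suc n)) \<subseteq> V i))"
  proof (rule dependent_nat_choice)
    show "\<exists>K. ok K \<and> upper K \<subseteq> E W" using K0 \<open>\<phi> w \<in> A\<close> unfolding ok_def by blast
  next
    fix K n assume K: "ok K \<and> upper K \<subseteq> E W"
    then obtain L where L: "ok L" "K \<subseteq> L" "upper L \<subseteq> E (U n)" "\<forall>i\<le>n. upper K \<subseteq> - C i \<longrightarrow> upper L \<subseteq> V i"
      using step by metis
    have "upper L \<subseteq> upper K" using L(2) by (auto simp: upper_def)
    then show "\<exists>L. (ok L \<and> upper L \<subseteq> E W) \<and> K \<subseteq> L \<and> upper L \<subseteq> E (U n) \<and>
      (\<forall>i\<le>n. upper K \<subseteq> - C i \<longrightarrow> upper L \<subseteq> V i)"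
      using L K by (intro exI[of _ L]) (simp add: order_trans[of _ "upper K"])
  qed
  then obtain s where s': "\<forall>n. (ok (s n) \<and> upper (s n) \<subseteq> E W) \<and> (s n \<subseteq> s (Suc n) \<and> upper (s (Suc n)) \<subseteq> E (U n) \<and>
      (\<forall>i\<le>n. upper (s n) \<subseteq> - C i \<longrightarrow> upper (s (Suc n)) \<subseteq> V i))"
    by (elim exE)
  have s: "\<And>n. ok (s n)" "\<And>n. upper (s n) \<subseteq> E W" "\<And>n. s n \<subseteq> s (Suc n)"
      "\<And>n. upper (s (Suc n)) \<subseteq> E (U n)" "\<And>n i. i \<le> n \<Longrightarrow> upper (s n) \<subseteq> - C i \<Longrightarrow> upper (s (Suc n)) \<subseteq> V i"
    using s' by simp_all
  have mono: "s m \<subseteq> s n" if "m \<le> n" for m n using s(3) that by (rule lift_Suc_mono_le)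
  define u where "u n \<longleftrightarrow> (\<exists>k. n \<in> s k)" for n
  have u: "u \<in> upper (s k)" for k by (auto simp: upper_def u_def)
  have "u \<in> C i \<union> V i" for i
  proof (cases "u \<in> C i")
    case False
    then have "u \<in> - C i" by simp
    then obtain L where L: "finite L" "u \<in> upper L" "upper L \<subseteq> - C i"
      using openin_sierpinski_power_upper[OF C] by metis
    have "\<exists>k. L \<subseteq> s k"
      using L(1,2)
    proof (induction L rule: finite_induct)
      case (insert n L)
      then obtain k l where "n \<in> s k" "L \<subseteq> s l" by (auto simp: upper_def u_def)
      then show ?case using mono[of k "max k l"] mono[of l "max k l"] by (intro exI[of _ "max k l"]) auto
    qed simp
    then obtain k where "L \<subseteq> s k" by blast
    then have "L \<subseteq> s (max k i)" using mono[of k "max k i"] by auto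
    then have "upper (s (max k i)) \<subseteq> upper L" by (auto simp: upper_def)
    then have "upper (s (max k i)) \<subseteq> - C i" using L(3) by (rule order_trans)
    then have "upper (s (Suc (max k i))) \<subseteq> V i" by (intro s(5)) simp_all
    then show ?thesis using u by blast
  qed simp
  then have "u \<in> A" using CV(3) by blast
  then obtain x where x: "x \<in> topspace X" "u = \<phi> x" using im by blast
  have mem: "x \<in> Q" if "openin X Q" "u \<in> E Q" for Q
    using E(2)[OF that(1)] that(2) \<open>u \<in> A\<close> x inj_on_image_mem_iff[OF inj x(1) openin_subset[OF that(1)]] by blast
  have "x \<in> W" using mem[OF W(1)] s(2) u by blast
  moreover have "x \<in> U n" for n using mem[OF U(1)] s(4) u by blast
  ultimately show ?thesis by blast
qed

text \<open>Countable unions of nowhere dense sets, described by complements: a meager set misses a countable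
  intersection of dense open sets, which is the form in which the Baire property is used.\<close>

definition meager_in :: "'a topology \<Rightarrow> 'a set \<Rightarrow> bool" where
  "meager_in X S \<longleftrightarrow> (\<exists>U. (\<forall>n::nat. openin X (U n) \<and> (\<forall>W. openin X W \<and> W \<noteq> {} \<longrightarrow> W \<inter> U n \<noteq> {})) \<and>
     S \<inter> (\<Inter>n. U n) = {})"

lemma meager_in_mono: "meager_in X T \<Longrightarrow> S \<inter> topspace X \<subseteq> T \<Longrightarrow> meager_in X S"
  unfolding meager_in_def
proof (elim exE conjE)
  fix U assume U: "\<forall>n::nat. openin X (U n) \<and> (\<forall>W. openin X W \<and> W \<noteq> {} \<longrightarrow> W \<inter> U n \<noteq> {})"
    "T \<inter> (\<Inter>n. U n) = {}" and S: "S \<inter> topspace X \<subseteq> T"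
  have "U 0 \<subseteq> topspace X" using U(1) openin_subset by blast
  then have "S \<inter> (\<Inter>n. U n) = {}" using U(2) S by blast
  then show "\<exists>U. (\<forall>n::nat. openin X (U n) \<and> (\<forall>W. openin X W \<and> W \<noteq> {} \<longrightarrow> W \<inter> U n \<noteq> {})) \<and>
     S \<inter> (\<Inter>n. U n) = {}" using U(1) by (intro exI[of _ U]) simp
qed

lemma meager_in_complement:
  assumes "openin X D" "\<And>W. openin X W \<Longrightarrow> W \<noteq> {} \<Longrightarrow> W \<inter> D \<noteq> {}" "S \<inter> D = {}"
  shows "meager_in X S"
  unfolding meager_in_def using assms by (intro exI[of _ "\<lambda>_. D"]) simp

lemma meager_in_disjoint: "S \<inter> topspace X = {} \<Longrightarrow> meager_in X S"
proof (rule meager_in_complement[of X "topspace X"])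
  show "W \<inter> topspace X \<noteq> {}" if "openin X W" "W \<noteq> {}" for W
    using that by (simp add: Int_absorb2[OF openin_subset])
qed simp_all

lemma meager_in_UN:
  assumes "\<And>i::nat. meager_in X (S i)" shows "meager_in X (\<Union>i. S i)"
proof -
  have "\<forall>i. \<exists>U. (\<forall>n::nat. openin X (U n) \<and> (\<forall>W. openin X W \<and> W \<noteq> {} \<longrightarrow> W \<inter> U n \<noteq> {})) \<and>
     S i \<inter> (\<Inter>n. U n) = {}" using assms unfolding meager_in_def by simp
  then obtain U where U: "\<And>i. (\<forall>n::nat. openin X (U i n) \<and> (\<forall>W. openin X W \<and> W \<noteq> {} \<longrightarrow> W \<inter> U i n \<noteq> {})) \<and>
     S i \<inter> (\<Inter>n. U i n) = {}" by (metis (no_types))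
  define V where "V n = U (fst (prod_decode n)) (snd (prod_decode n))" for n
  have V: "V (prod_encode (i, n)) = U i n" for i n by (simp add: V_def)
  have "S i \<inter> (\<Inter>n. V n) = {}" for i
  proof -
    have "(\<Inter>n. V n) \<subseteq> (\<Inter>n. U i n)" using V by blast
    then show ?thesis using U[of i] by blast
  qed
  then have "(\<Union>i. S i) \<inter> (\<Inter>n. V n) = {}" by blast
  then show ?thesis unfolding meager_in_def using U by (intro exI[of _ V]) (simp add: V_def)
qed

lemma meager_in_Un:
  assumes "meager_in X S" "meager_in X T" shows "meager_in X (S \<union> T)"
proof -
  have "meager_in X (\<Union>i::nat. if i = 0 then S else T)"
    by (rule meager_in_UN) (simp add: assms)
  then show ?thesis by (rule meager_in_mono) (auto split: if_splits)
qed

lemma quasi_polish_open_nonmeager: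
  assumes "quasi_polish X" "openin X W" "W \<noteq> {}" shows "\<not> meager_in X W"
proof
  assume "meager_in X W"
  then obtain U where U: "\<forall>n::nat. openin X (U n) \<and> (\<forall>W. openin X W \<and> W \<noteq> {} \<longrightarrow> W \<inter> U n \<noteq> {})"
    "W \<inter> (\<Inter>n. U n) = {}" unfolding meager_in_def by (elim exE conjE)
  have "W \<inter> (\<Inter>n. U n) \<noteq> {}"
    by (rule quasi_polish_Baire[OF assms(1) _ _ assms(2,3)]) (use U(1) in simp_all)
  with U(2) show False by simp
qed

lemma meager_in_homeomorphic_vimage:
  assumes f: "homeomorphic_map X Y f" and S: "meager_in Y S"
  shows "meager_in X {x \<in> topspace X. f x \<in> S}"
proof -
  obtain U where U: "\<forall>n::nat. openin Y (U n) \<and> (\<forall>W. openin Y W \<and> W \<noteq> {} \<longrightarrow> W \<inter> U n \<noteq> {})"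
    "S \<inter> (\<Inter>n. U n) = {}" using S unfolding meager_in_def by (elim exE conjE)
  define V where "V n = {x \<in> topspace X. f x \<in> U n}" for n
  have "openin X (V n)" for n
    unfolding V_def using U(1) homeomorphic_imp_continuous_map[OF f] by (intro openin_continuous_map_preimage) auto
  moreover have "W \<inter> V n \<noteq> {}" if W: "openin X W" "W \<noteq> {}" for W n
  proof -
    have "openin Y (f ` W)" using homeomorphic_imp_open_map[OF f] W(1) by (simp add: open_map_def)
    then have "f ` W \<inter> U n \<noteq> {}" using U(1) W(2) by simp
    then show ?thesis using openin_subset[OF W(1)] by (auto simp: V_def)
  qed
  moreover have "{x \<in> topspace X. f x \<in> S} \<inter> (\<Inter>n. V n) = {}"
    using U(2) by (auto simp: V_def)
  ultimately show ?thesis unfolding meager_in_def by (intro exI[of _ V]) simp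
qed

section \<open>The category quantifier\<close>

lemma second_countable_sequence:
  assumes "second_countable X"
  obtains b :: "nat \<Rightarrow> 'a set" where "\<And>n. openin X (b n)" "\<And>U x. openin X U \<Longrightarrow> x \<in> U \<Longrightarrow> \<exists>n. x \<in> b n \<and> b n \<subseteq> U"
proof -
  obtain B where B: "countable B" "\<forall>V\<in>B. openin X V" "\<forall>U x. openin X U \<and> x \<in> U \<longrightarrow> (\<exists>V\<in>B. x \<in> V \<and> V \<subseteq> U)"
    using assms unfolding second_countable_def by (elim exE conjE)
  have r: "range (from_nat_into (insert {} B)) = insert {} B" using B(1) by (intro range_from_nat_into) auto
  show thesis
  proof (rule that[of "from_nat_into (insert {} B)"])
    fix n
    have "from_nat_into (insert {} B) n \<in> insert {} B" by (rule from_nat_into) simp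
    then show "openin X (from_nat_into (insert {} B) n)" using B(2) by auto
  next
    fix U x assume "openin X U" "x \<in> U"
    then obtain V where V: "V \<in> B" "x \<in> V" "V \<subseteq> U" using B(3) by blast
    then have "V \<in> range (from_nat_into (insert {} B))" using r by simp
    then show "\<exists>n. x \<in> from_nat_into (insert {} B) n \<and> from_nat_into (insert {} B) n \<subseteq> U"
      using V(2,3) by (metis rangeE)
  qed
qed

lemma sets_pair_borel_of:
  "sets (M \<Otimes>\<^sub>M borel_of X) = sigma_sets (space M \<times> topspace X) {a \<times> U | a U. a \<in> sets M \<and> openin X U}"
proof -
  have "sets (M \<Otimes>\<^sub>M borel_of X) =
      sets (sigma (space M \<times> space (borel_of X)) {a \<times> U | a U. a \<in> sets M \<and> U \<in> {U. openin X U}})"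
  proof (rule sets_pair_eq)
    show "sets M \<subseteq> Pow (space M)" by (rule sets.space_closed)
    show "sets M = sigma_sets (space M) (sets M)" by (simp add: sets.sigma_sets_eq)
    show "countable {space M}" "{space M} \<subseteq> sets M" "\<Union>{space M} = space M" by auto
    show "{U. openin X U} \<subseteq> Pow (space (borel_of X))"
      unfolding space_borel_of using openin_subset by blast
    show "sets (borel_of X) = sigma_sets (space (borel_of X)) {U. openin X U}"
      by (simp add: sets_borel_of space_borel_of)
    show "countable {topspace X}" "{topspace X} \<subseteq> {U. openin X U}" "\<Union>{topspace X} = space (borel_of X)"
      by (auto simp: space_borel_of)
  qed
  also have "\<dots> = sigma_sets (space M \<times> topspace X) {a \<times> U | a U. a \<in> sets M \<and> openin X U}"
  proof -
    have "{a \<times> U | a U. a \<in> sets M \<and> openin X U} \<subseteq> Pow (space M \<times> topspace X)"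
    proof (intro subsetI, elim CollectE exE conjE)
      fix z a U assume "z = a \<times> U" "a \<in> sets M" "openin X U"
      then show "z \<in> Pow (space M \<times> topspace X)"
        using sets.sets_into_space[of a M] openin_subset[of X U] by (intro PowI) (simp add: Sigma_mono)
    qed
    then show ?thesis by (simp add: space_borel_of sets_measure_of)
  qed
  finally show ?thesis .
qed

text \<open>The Vaught transform of a Borel set is Borel. The induction over Borel sets \<open>A\<close> carries along the
  localized statement for every basic open \<open>b n\<close> together with a form of the Baire property of the
  sections: if a section is nonmeager in \<open>b n\<close>, it is comeager in some smaller basic set that meets the
  fibre. For complements, being meager in \<open>b n\<close> then means not being comeager in any smaller such set.
  Openness of \<open>f\<close> enters because a basic set meets the fibre over \<open>x\<close> iff \<open>x\<close> lies in its image,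
  which is open.\<close>

lemma category_quantifier_measurable:
  fixes f :: "'g \<Rightarrow> 'x" and \<Gamma> :: "'g topology" and X :: "'x topology" and r :: "'m \<Rightarrow> 'x"
  defines "fib \<equiv> \<lambda>x. subtopology \<Gamma> {g \<in> topspace \<Gamma>. f g = x}"
  assumes sc: "second_countable \<Gamma>" and op: "open_map \<Gamma> X f"
    and qp: "\<And>x. x \<in> topspace X \<Longrightarrow> quasi_polish (fib x)"
    and r: "r \<in> M \<rightarrow>\<^sub>M borel_of X" and A: "A \<in> sets (M \<Otimes>\<^sub>M borel_of \<Gamma>)"
  shows "{m \<in> space M. meager_in (fib (r m)) {g. (m, g) \<in> A}} \<in> sets M"
proof -
  obtain b where b: "\<And>n::nat. openin \<Gamma> (b n)" "\<And>U g. openin \<Gamma> U \<Longrightarrow> g \<in> U \<Longrightarrow> \<exists>n. g \<in> b n \<and> b n \<subseteq> U"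
    using sc by (rule second_countable_sequence) (rule that)
  have rm: "r m \<in> topspace X" if "m \<in> space M" for m
    using measurable_space[OF r that] by (simp add: space_borel_of)
  define small where "small m S \<longleftrightarrow> meager_in (fib (r m)) S" for m S
  have small_mono: "small m S" if "small m T" "S \<subseteq> T" for m S T
    using that unfolding small_def by (auto intro: meager_in_mono)
  have top_fib: "topspace (fib x) = {g \<in> topspace \<Gamma>. f g = x}" for x
    by (auto simp: fib_def)
  define hit where "hit m k \<longleftrightarrow> (\<exists>g\<in>b k. f g = r m)" for m k
  have not_small: "\<not> small m (b k)" if m: "m \<in> space M" and "hit m k" for m k
  proof
    assume s: "small m (b k)"
    let ?W = "b k \<inter> {g \<in> topspace \<Gamma>. f g = r m}"
    have "openin (fib (r m)) ?W" using b(1)[of k] by (auto simp: fib_def openin_subtopology)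
    moreover have "?W \<noteq> {}" using that(2) openin_subset[OF b(1)[of k]] by (auto simp: hit_def)
    ultimately have "\<not> meager_in (fib (r m)) ?W" by (rule quasi_polish_open_nonmeager[OF qp[OF rm[OF m]]])
    moreover have "meager_in (fib (r m)) ?W" using small_mono[OF s, of ?W] by (simp add: small_def)
    ultimately show False ..
  qed
  have not_hit: "small m (b k \<inter> S)" if "\<not> hit m k" for m k S
    unfolding small_def by (rule meager_in_disjoint) (use that top_fib in \<open>auto simp: hit_def\<close>)
  have hit_open: "{m \<in> space M. \<exists>g\<in>U. f g = r m} \<in> sets M" if "openin \<Gamma> U" for U
  proof -
    have "f ` U \<in> sets (borel_of X)" using op that by (intro openin_sets_borel_of) (simp add: open_map_def)
    then have "r -` (f ` U) \<inter> space M \<in> sets M" by (rule measurable_sets[OF r])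
    also have "r -` (f ` U) \<inter> space M = {m \<in> space M. \<exists>g\<in>U. f g = r m}" by (force simp: image_iff)
    finally show ?thesis .
  qed
  have hit: "{m \<in> space M. hit m k} \<in> sets M" for k unfolding hit_def by (rule hit_open[OF b(1)])
  define sec where "sec A m = {g. (m, g) \<in> A}" for A :: "('m \<times> 'g) set" and m
  define good where "good A \<longleftrightarrow> (\<forall>n. {m \<in> space M. small m (b n \<inter> sec A m)} \<in> sets M) \<and>
     (\<forall>m\<in>space M. \<forall>n. small m (b n \<inter> sec A m) \<or> (\<exists>k. b k \<subseteq> b n \<and> hit m k \<and> small m (b k - sec A m)))" for A
  have "good A" using A unfolding sets_pair_borel_of
  proof (induction rule: sigma_sets.induct)
    case (Basic A)
    then obtain a U where a: "a \<in> sets M" and U: "openin \<Gamma> U" and A_eq: "A = a \<times> U" by blast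
    have sec: "sec A m = (if m \<in> a then U else {})" for m by (auto simp: sec_def A_eq)
    have empty: "small m {}" for m unfolding small_def by (rule meager_in_disjoint) simp
    have alt: "small m (b n \<inter> U) \<or> (\<exists>k. b k \<subseteq> b n \<inter> U \<and> hit m k)" for m n
    proof (cases "\<exists>g\<in>b n \<inter> U. f g = r m")
      case True
      then obtain g where g: "g \<in> b n \<inter> U" "f g = r m" by blast
      then obtain k where "g \<in> b k" "b k \<subseteq> b n \<inter> U" using b(2)[of "b n \<inter> U" g] b(1) U by blast
      then show ?thesis using g(2) unfolding hit_def by blast
    next
      case False
      then have "small m (b n \<inter> U)"
        unfolding small_def by (intro meager_in_disjoint) (auto simp: top_fib)
      then show ?thesis ..
    qed
    have iff: "small m (b n \<inter> U) \<longleftrightarrow> \<not> (\<exists>k. b k \<subseteq> b n \<inter> U \<and> hit m k)" if "m \<in> space M" for m n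
      using alt[of m n] not_small[OF that] small_mono by blast
    show ?case unfolding good_def
    proof (intro conjI allI ballI)
      fix n
      have "{m \<in> space M. small m (b n \<inter> sec A m)} = space M - (a \<inter> (\<Union>k\<in>{k. b k \<subseteq> b n \<inter> U}. {m \<in> space M. hit m k}))"
        using iff[of _ n] empty by (auto simp: sec)
      also have "\<dots> \<in> sets M" using a hit by (intro sets.Diff sets.Int sets.countable_UN' sets.top) auto
      finally show "{m \<in> space M. small m (b n \<inter> sec A m)} \<in> sets M" .
    next
      fix m n assume "m \<in> space M"
      show "small m (b n \<inter> sec A m) \<or> (\<exists>k. b k \<subseteq> b n \<and> hit m k \<and> small m (b k - sec A m))"
      proof (cases "m \<in> a")
        case True
        then have "sec A m = U" by (simp add: sec)
        moreover have "small m (b k - U)" if "b k \<subseteq> b n \<inter> U" for k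
          using small_mono[OF empty, of "b k - U" m] that by blast
        ultimately show ?thesis using alt[of m n] by auto
      qed (simp add: sec empty)
    qed
  next
    case Empty
    have "small m {}" for m unfolding small_def by (rule meager_in_disjoint) simp
    then show ?case unfolding good_def by (simp add: sec_def)
  next
    case (Compl A)
    define A' where "A' = space M \<times> topspace \<Gamma> - A"
    have bn: "b n \<subseteq> topspace \<Gamma>" for n by (rule openin_subset[OF b(1)])
    have sec': "b n \<inter> sec A' m = b n - sec A m" "b n - sec A' m = b n \<inter> sec A m" if "m \<in> space M" for m n
      using bn[of n] that by (auto simp: sec_def A'_def)
    have alt: "small m (b n - sec A m) \<or> (\<exists>k. b k \<subseteq> b n \<and> hit m k \<and> small m (b k \<inter> sec A m))"
      if m: "m \<in> space M" for m n
    proof (rule disjCI)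
      assume none: "\<not> (\<exists>k. b k \<subseteq> b n \<and> hit m k \<and> small m (b k \<inter> sec A m))"
      define Fb where "Fb = {g \<in> topspace \<Gamma>. f g = r m}"
      define W where "W = (\<Union>l\<in>{l. small m (b l - sec A m)}. b l)"
      \<comment> \<open>On the part of \<open>b n\<close> outside \<open>W\<close> nothing is left but a nowhere dense set: \<open>W \<union> Q\<close> is dense in the fibre.\<close>
      define Q where "Q = (\<Union>l\<in>{l. b l \<inter> b n \<inter> Fb = {}}. b l)"
      have "small m (\<Union>l. if small m (b l - sec A m) then b l - sec A m else {})"
        unfolding small_def by (rule meager_in_UN) (simp add: meager_in_disjoint)
      then have W_small: "small m (W - sec A m)"
        by (rule small_mono) (auto simp: W_def split: if_splits)
      have "small m (b n - W)"
        unfolding small_def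
      proof (rule meager_in_complement)
        have "openin \<Gamma> (W \<union> Q)" unfolding W_def Q_def using b(1) by (intro openin_Un openin_Union) auto
        then show "openin (fib (r m)) ((W \<union> Q) \<inter> Fb)"
          unfolding fib_def Fb_def openin_subtopology by blast
        show "(b n - W) \<inter> ((W \<union> Q) \<inter> Fb) = {}" unfolding Q_def by blast
        fix O' assume O': "openin (fib (r m)) O'" "O' \<noteq> {}"
        then obtain P where P: "openin \<Gamma> P" "O' = P \<inter> Fb"
          unfolding fib_def Fb_def openin_subtopology by blast
        show "O' \<inter> ((W \<union> Q) \<inter> Fb) \<noteq> {}"
        proof (cases "O' \<inter> b n = {}")
          case True
          obtain g where g: "g \<in> P" "g \<in> Fb" using O'(2) P(2) by blast
          then obtain l where l: "g \<in> b l" "b l \<subseteq> P" using b(2)[OF P(1)] by blast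
          then have "b l \<inter> b n \<inter> Fb = {}" using True P(2) by blast
          then have "g \<in> Q" unfolding Q_def using l(1) by blast
          then show ?thesis using g P(2) by blast
        next
          case False
          then obtain g where g: "g \<in> P \<inter> b n" "g \<in> Fb" using P(2) by blast
          obtain k where k: "g \<in> b k" "b k \<subseteq> P \<inter> b n"
            using b(2)[OF openin_Int[OF P(1) b(1)] g(1)] by blast
          have "hit m k" using k(1) g(2) unfolding hit_def Fb_def by blast
          then have "\<not> small m (b k \<inter> sec A m)" using none k(2) by blast
          then obtain l where l: "b l \<subseteq> b k" "hit m l" "small m (b l - sec A m)"
            using Compl.IH m unfolding good_def by blast
          obtain h where h: "h \<in> b l" "f h = r m" using l(2) unfolding hit_def by blast
          have "h \<in> Fb" using h bn[of l] unfolding Fb_def by blast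
          moreover have "h \<in> W" using h(1) l(3) unfolding W_def by blast
          moreover have "h \<in> P" using h(1) l(1) k(2) by blast
          ultimately show ?thesis using P(2) by blast
        qed
      qed
      then have "small m ((b n - W) \<union> (W - sec A m))"
        using W_small unfolding small_def by (rule meager_in_Un)
      then show "small m (b n - sec A m)" by (rule small_mono) blast
    qed
    have iff: "small m (b n - sec A m) \<longleftrightarrow> \<not> (\<exists>k. b k \<subseteq> b n \<and> hit m k \<and> small m (b k \<inter> sec A m))"
      if m: "m \<in> space M" for m n
    proof -
      have "False" if "small m (b n - sec A m)" "b k \<subseteq> b n" "hit m k" "small m (b k \<inter> sec A m)" for k
      proof -
        have "small m ((b n - sec A m) \<union> (b k \<inter> sec A m))"
          using that(1,4) unfolding small_def by (rule meager_in_Un)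
        then have "small m (b k)" by (rule small_mono) (use that(2) in blast)
        then show False using not_small[OF m that(3)] by simp
      qed
      then show ?thesis using alt[OF m, of n] by blast
    qed
    have "good A'" unfolding good_def
    proof (intro conjI allI ballI)
      fix n
      have "{m \<in> space M. small m (b n \<inter> sec A' m)} =
          space M - (\<Union>k\<in>{k. b k \<subseteq> b n}. {m \<in> space M. hit m k} \<inter> {m \<in> space M. small m (b k \<inter> sec A m)})"
        using sec'(1) iff[of _ n] by auto
      also have "\<dots> \<in> sets M"
        using hit Compl.IH unfolding good_def by (intro sets.Diff sets.countable_UN' sets.Int sets.top) auto
      finally show "{m \<in> space M. small m (b n \<inter> sec A' m)} \<in> sets M" .
    next
      fix m n assume "m \<in> space M"
      then show "small m (b n \<inter> sec A' m) \<or> (\<exists>k. b k \<subseteq> b n \<and> hit m k \<and> small m (b k - sec A' m))"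
        using alt[of m n] by (simp add: sec')
    qed
    then show ?case unfolding A'_def .
  next
    case (Union A)
    have sec: "b n \<inter> sec (\<Union>i. A i) m = (\<Union>i. b n \<inter> sec (A i) m)" for n m by (auto simp: sec_def)
    have iff: "small m (b n \<inter> sec (\<Union>i. A i) m) \<longleftrightarrow> (\<forall>i. small m (b n \<inter> sec (A i) m))" for m n
    proof
      assume "small m (b n \<inter> sec (\<Union>i. A i) m)"
      then show "\<forall>i. small m (b n \<inter> sec (A i) m)" unfolding sec by (auto intro: small_mono)
    next
      assume "\<forall>i. small m (b n \<inter> sec (A i) m)"
      then show "small m (b n \<inter> sec (\<Union>i. A i) m)" unfolding sec small_def by (intro meager_in_UN) simp
    qed
    show ?case unfolding good_def
    proof (intro conjI allI ballI)
      fix n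
      have "{m \<in> space M. small m (b n \<inter> sec (\<Union>i. A i) m)} = (\<Inter>i. {m \<in> space M. small m (b n \<inter> sec (A i) m)})"
        by (auto simp: iff)
      also have "\<dots> \<in> sets M" using Union.IH unfolding good_def by (intro sets.countable_INT) auto
      finally show "{m \<in> space M. small m (b n \<inter> sec (\<Union>i. A i) m)} \<in> sets M" .
    next
      fix m n assume m: "m \<in> space M"
      show "small m (b n \<inter> sec (\<Union>i. A i) m) \<or> (\<exists>k. b k \<subseteq> b n \<and> hit m k \<and> small m (b k - sec (\<Union>i. A i) m))"
      proof (cases "\<forall>i. small m (b n \<inter> sec (A i) m)")
        case False
        then obtain i where "\<not> small m (b n \<inter> sec (A i) m)" by blast
        then obtain k where k: "b k \<subseteq> b n" "hit m k" "small m (b k - sec (A i) m)"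
          using Union.IH[of i] m unfolding good_def by blast
        have "small m (b k - sec (\<Union>i. A i) m)"
          by (rule small_mono[OF k(3)]) (auto simp: sec_def)
        then show ?thesis using k by blast
      qed (simp add: iff)
    qed
  qed
  then have g: "{m \<in> space M. small m (b n \<inter> sec A m)} \<in> sets M" for n unfolding good_def by blast
  have "small m (sec A m) \<longleftrightarrow> (\<forall>n. small m (b n \<inter> sec A m))" for m
  proof
    assume "\<forall>n. small m (b n \<inter> sec A m)"
    then have "meager_in (fib (r m)) (\<Union>n. b n \<inter> sec A m)" unfolding small_def by (intro meager_in_UN) simp
    then show "small m (sec A m)" unfolding small_def
    proof (rule meager_in_mono)
      have "topspace \<Gamma> \<subseteq> (\<Union>n. b n)" using b(2)[OF openin_topspace] by blast
      then show "sec A m \<inter> topspace (fib (r m)) \<subseteq> (\<Union>n. b n \<inter> sec A m)" unfolding top_fib by blast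
    qed
  qed (auto intro: small_mono)
  then have "{m \<in> space M. small m (sec A m)} = (\<Inter>n. {m \<in> space M. small m (b n \<inter> sec A m)})" by auto
  also have "\<dots> \<in> sets M" using g by (intro sets.countable_INT) auto
  finally show ?thesis unfolding small_def sec_def .
qed

section \<open>Borel sections of maps with largeness on their fibres\<close>

text \<open>Here \<open>L A\<close> is the set of points at whose fibre \<open>A\<close> is large. Passing to the closed graph \<open>j\<close> makes
  the domain complete and \<open>p\<close> continuous, so a limit of points of one fibre stays in that fibre. The
  finite list \<open>ch x n\<close> codes the first \<open>n\<close> choices, most recent first.\<close>

lemma borel_selector:
  fixes e :: "'a \<Rightarrow> 'w::polish_space" and p :: "'a \<Rightarrow> 'z::polish_space"
  assumes c: "borel_coding M e d" and p: "p \<in> borel_measurable M"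
    and L_sets: "\<And>A. A \<in> sets M \<Longrightarrow> L A \<in> sets M"
    and L_space: "L (space M) = space M"
    and L_UN: "\<And>A :: nat \<Rightarrow> 'a set. range A \<subseteq> sets M \<Longrightarrow> L (\<Union>i. A i) \<subseteq> (\<Union>i. L (A i))"
    and L_fibre: "\<And>A x. A \<in> sets M \<Longrightarrow> x \<in> L A \<Longrightarrow> \<exists>y\<in>A. p y = p x"
    and L_inv: "\<And>A x y. A \<in> sets M \<Longrightarrow> x \<in> space M \<Longrightarrow> y \<in> space M \<Longrightarrow> p x = p y \<Longrightarrow> x \<in> L A \<longleftrightarrow> y \<in> L A"
  obtains s where "s \<in> M \<rightarrow>\<^sub>M M" "\<And>x. x \<in> space M \<Longrightarrow> p (s x) = p x"
    "\<And>x y. x \<in> space M \<Longrightarrow> y \<in> space M \<Longrightarrow> p x = p y \<Longrightarrow> s x = s y"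
proof -
  have e: "e \<in> borel_measurable M" and d: "d \<in> restrict_space borel (e ` space M) \<rightarrow>\<^sub>M M"
    and de: "\<And>x. x \<in> space M \<Longrightarrow> d (e x) = x"
    using c unfolding borel_coding_def by auto
  have "(\<lambda>x. (p x, e x)) ` space M \<in> sets borel"
    by (rule borel_coding_graph[OF c p]) simp
  then obtain f :: "'z \<times> 'w \<Rightarrow> nat \<Rightarrow> real" where f: "f \<in> borel_measurable borel"
    and cl: "closed ((\<lambda>w. (w, f w)) ` (\<lambda>x. (p x, e x)) ` space M)"
    using borel_closed_graph_domain unfolding closed_graph_domain_def by blast
  define j where "j x = ((p x, e x), f (p x, e x))" for x
  have cl: "closed (j ` space M)" using cl by (simp add: image_image j_def)
  have j: "j \<in> borel_measurable M"
  proof -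
    have "(\<lambda>x. (p x, e x)) \<in> borel_measurable M" using p e by (simp add: borel_prod[symmetric])
    then have "(\<lambda>x. ((p x, e x), f (p x, e x))) \<in> M \<rightarrow>\<^sub>M borel \<Otimes>\<^sub>M borel"
      by (intro measurable_Pair measurable_compose[OF _ f])
    then show ?thesis by (simp add: j_def[abs_def] borel_prod)
  qed
  have e_j: "e x = snd (fst (j x))" for x by (simp add: j_def)
  have p_j: "p x = fst (fst (j x))" for x by (simp add: j_def)
  obtain v :: "nat \<Rightarrow> ('z \<times> 'w) \<times> (nat \<Rightarrow> real)" where v: "\<And>y r. 0 < r \<Longrightarrow> \<exists>n. dist (v n) y \<le> r"
    using dense_sequence by metis
  define b where "b n i = {x \<in> space M. dist (v i) (j x) \<le> (1/2) ^ n}" for n i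
  have b: "b n i \<in> sets M" for n i
    unfolding b_def using j by measurable
  define D where "D = rec_list (space M) (\<lambda>i l A. A \<inter> b (length l) i)"
  have D_simps [simp]: "D [] = space M" "D (i # l) = D l \<inter> b (length l) i" for i l
    by (simp_all add: D_def)
  have D: "D l \<in> sets M" for l by (induction l) (auto simp: b)
  have D_UN: "D l = (\<Union>i. D (i # l))" for l
  proof -
    have "\<exists>i. x \<in> b (length l) i" if "x \<in> space M" for x
      using v[of "(1/2) ^ length l" "j x"] that by (auto simp: b_def)
    then show ?thesis using sets.sets_into_space[OF D[of l]] by auto
  qed
  \<comment> \<open>The first ball in which the set chosen so far is still large.\<close>
  define nxt where "nxt l x = (LEAST i. x \<in> L (D (i # l)))" for l x
  define ch where "ch x n = rec_nat [] (\<lambda>_ l. nxt l x # l) n" for x n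
  have ch_simps [simp]: "ch x 0 = []" "ch x (Suc n) = nxt (ch x n) x # ch x n" for x n
    by (simp_all add: ch_def)
  have len: "length (ch x n) = n" for x n by (induction n) auto
  have ch_L: "x \<in> L (D (ch x n))" if "x \<in> space M" for x n
  proof (induction n)
    case (Suc n)
    have "L (\<Union>i. D (i # ch x n)) \<subseteq> (\<Union>i. L (D (i # ch x n)))"
      by (rule L_UN) (use D in blast)
    then have "L (D (ch x n)) \<subseteq> (\<Union>i. L (D (i # ch x n)))" by (simp only: D_UN[symmetric])
    then obtain i where "x \<in> L (D (i # ch x n))" using Suc by blast
    then show ?case unfolding ch_simps nxt_def by (rule LeastI)
  qed (simp add: L_space that)
  have ch_inv: "ch x n = ch y n" if "x \<in> space M" "y \<in> space M" "p x = p y" for x y n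
    by (induction n) (simp_all add: nxt_def L_inv[OF D that] del: D_simps)
  have ch_meas: "(\<lambda>x. ch x n) \<in> M \<rightarrow>\<^sub>M count_space UNIV" for n
  proof (induction n)
    case (Suc n)
    have "(\<lambda>x. nxt l x # l) \<in> M \<rightarrow>\<^sub>M count_space UNIV" for l
    proof -
      have "nxt l \<in> M \<rightarrow>\<^sub>M count_space UNIV"
        unfolding nxt_def using L_sets[OF D] by measurable
      then show ?thesis by (rule measurable_compose) simp
    qed
    from measurable_compose_countable[OF this Suc] show ?case by simp
  qed simp
  \<comment> \<open>The centre of the ball chosen at stage \<open>n\<close>, which approximates every point of that stage.\<close>
  define u where "u n x = v (hd (ch x (Suc n)))" for n x
  have u_meas: "u n \<in> borel_measurable M" for n
    unfolding u_def by (rule measurable_compose[OF ch_meas]) simp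
  have u_dist: "dist (u n x) (j y) \<le> (1/2) ^ n" if "y \<in> D (ch x (Suc n))" for n x y
    using that by (simp add: u_def b_def len)
  have D_mono: "D (ch x m) \<subseteq> D (ch x n)" if "n \<le> m" for x n m
    using that by (induction rule: dec_induct) auto
  have "\<exists>z\<in>space M. p z = p x \<and> (\<lambda>n. u n x) \<longlonglongrightarrow> j z" if x: "x \<in> space M" for x
  proof -
    have "\<exists>y\<in>D (ch x (Suc n)). p y = p x" for n by (rule L_fibre[OF D ch_L[OF x]])
    then obtain y where y: "\<And>n. y n \<in> D (ch x (Suc n))" "\<And>n. p (y n) = p x" by metis
    have dist: "dist (u n x) (j (y m)) \<le> (1/2) ^ n" if "n \<le> m" for n m
      using y(1)[of m] D_mono[of "Suc n" "Suc m" x] that by (intro u_dist) auto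
    have small: "\<exists>n. 2 * (1/2) ^ n < r" if "0 < r" for r :: real
      using real_arch_pow_inv[of "r/2" "1/2"] that by (auto simp: mult.commute)
    have "Cauchy (\<lambda>n. j (y n))"
    proof (rule metric_CauchyI)
      fix r :: real assume "0 < r"
      then obtain n :: nat where n: "2 * (1/2) ^ n < r" using small by blast
      have "dist (j (y k)) (j (y l)) < r" if "n \<le> k" "n \<le> l" for k l
        using dist[OF that(1)] dist[OF that(2)] n dist_triangle3[of "j (y k)" "j (y l)" "u n x"] by linarith
      then show "\<exists>n. \<forall>k\<ge>n. \<forall>l\<ge>n. dist (j (y k)) (j (y l)) < r" by blast
    qed
    then obtain w where w: "(\<lambda>n. j (y n)) \<longlonglongrightarrow> w"
      using Cauchy_convergent convergent_def by blast
    have "j (y n) \<in> j ` space M" for n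
      using y(1)[of n] sets.sets_into_space[OF D[of "ch x (Suc n)"]] by blast
    then have "w \<in> j ` space M" using cl w closed_sequentially by metis
    then obtain z where z: "z \<in> space M" "w = j z" by blast
    have "(\<lambda>n. fst (fst (j (y n)))) \<longlonglongrightarrow> fst (fst w)" by (intro tendsto_fst w)
    then have "(\<lambda>n. p x) \<longlonglongrightarrow> p z" using y(2) by (simp add: z(2) p_j[symmetric])
    then have "p z = p x" by (simp add: LIMSEQ_const_iff)
    moreover have "(\<lambda>n. u n x) \<longlonglongrightarrow> w"
    proof (rule tendsto_dist_iff[THEN iffD2])
      have "(\<lambda>n. (1/2 :: real) ^ n + dist (j (y n)) w) \<longlonglongrightarrow> 0 + 0"
        using w by (intro tendsto_add LIMSEQ_realpow_zero) (auto simp flip: tendsto_dist_iff)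
      moreover have "dist (u n x) w \<le> (1/2) ^ n + dist (j (y n)) w" for n
        using dist[of n n] dist_triangle[of "u n x" w "j (y n)"] by simp
      ultimately show "(\<lambda>n. dist (u n x) w) \<longlonglongrightarrow> 0"
        using tendsto_sandwich[of "\<lambda>_. 0" "\<lambda>n. dist (u n x) w" sequentially "\<lambda>n. (1/2) ^ n + dist (j (y n)) w" 0]
        by simp
    qed
    ultimately show ?thesis using z by blast
  qed
  then obtain s where s: "\<And>x. x \<in> space M \<Longrightarrow> s x \<in> space M" "\<And>x. x \<in> space M \<Longrightarrow> p (s x) = p x"
      "\<And>x. x \<in> space M \<Longrightarrow> (\<lambda>n. u n x) \<longlonglongrightarrow> j (s x)"
    by metis
  have "(\<lambda>x. j (s x)) \<in> borel_measurable M"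
    by (rule borel_measurable_LIMSEQ_metric[OF u_meas s(3)])
  then have "(\<lambda>x. e (s x)) \<in> borel_measurable M"
    unfolding e_j borel_prod[symmetric] by measurable
  then have "(\<lambda>x. e (s x)) \<in> M \<rightarrow>\<^sub>M restrict_space borel (e ` space M)"
    using s(1) by (intro measurable_restrict_space2) auto
  then have "(\<lambda>x. d (e (s x))) \<in> M \<rightarrow>\<^sub>M M" by (rule measurable_compose[OF _ d])
  then have "s \<in> M \<rightarrow>\<^sub>M M" using de s(1) by (simp cong: measurable_cong)
  moreover have "s x = s y" if "x \<in> space M" "y \<in> space M" "p x = p y" for x y
  proof -
    have "u n x = u n y" for n unfolding u_def by (simp only: ch_inv[OF that])
    then have "(\<lambda>n. u n x) \<longlonglongrightarrow> j (s y)" using s(3)[OF that(2)] by simp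
    with s(3)[OF that(1)] have "j (s x) = j (s y)" by (rule LIMSEQ_unique)
    then show ?thesis using s(1) that de by (metis e_j)
  qed
  ultimately show thesis using s(2) that by blast
qed

text \<open>Factoring \<open>s\<close> through \<open>p\<close> as \<open>t\<close> describes the image of \<open>p\<close> without quantifiers, as the set of
  \<open>y\<close> with \<open>p (t y) = y\<close>.\<close>

lemma borel_section:
  fixes e :: "'a \<Rightarrow> nat \<Rightarrow> real" and e' :: "'b \<Rightarrow> 'z::polish_space"
  assumes c: "borel_coding M e d" and c': "borel_coding N e' d'" and p: "p \<in> M \<rightarrow>\<^sub>M N"
    and s: "s \<in> M \<rightarrow>\<^sub>M M" "\<And>x. x \<in> space M \<Longrightarrow> p (s x) = p x"
    "\<And>x y. x \<in> space M \<Longrightarrow> y \<in> space M \<Longrightarrow> p x = p y \<Longrightarrow> s x = s y"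
  shows "p ` space M \<in> sets N"
    and "\<exists>t. t \<in> restrict_space N (p ` space M) \<rightarrow>\<^sub>M M \<and> (\<forall>x\<in>space M. t (p x) = s x)"
proof -
  have e: "e \<in> borel_measurable M" and d: "d \<in> restrict_space borel (e ` space M) \<rightarrow>\<^sub>M M"
    and de: "\<And>x. x \<in> space M \<Longrightarrow> d (e x) = x" and eM: "e ` space M \<in> sets borel"
    using c unfolding borel_coding_def by auto
  have e': "e' \<in> borel_measurable N" and de': "\<And>x. x \<in> space N \<Longrightarrow> d' (e' x) = x"
    using c' unfolding borel_coding_def by auto
  have pN: "p x \<in> space N" if "x \<in> space M" for x using p that by (rule measurable_space)
  have sM: "s x \<in> space M" if "x \<in> space M" for x using s(1) that by (rule measurable_space)
  obtain t where t: "t \<in> borel_measurable borel" "\<And>x. x \<in> space M \<Longrightarrow> t (e' (p x)) = e (s x)"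
  proof (rule borel_factorization[OF c])
    show "(\<lambda>x. e' (p x)) \<in> borel_measurable M" by (rule measurable_compose[OF p e'])
    show "(\<lambda>x. e (s x)) \<in> borel_measurable M" by (rule measurable_compose[OF s(1) e])
    show "e (s x) = e (s y)" if "x \<in> space M" "y \<in> space M" "e' (p x) = e' (p y)" for x y
      using that s(3) de' pN by metis
  qed (use that in blast)
  define T where "T = {y \<in> space N. t (e' y) \<in> e ` space M}"
  have t': "(\<lambda>y. t (e' y)) \<in> borel_measurable N" by (rule measurable_compose[OF e' t(1)])
  have T: "T \<in> sets N"
    using measurable_sets[OF t' eM] by (simp add: T_def vimage_def Int_def conj_commute)
  define q where "q y = d (t (e' y))" for y
  have q: "q \<in> restrict_space N T \<rightarrow>\<^sub>M M"
    unfolding q_def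
    by (rule measurable_compose[OF _ d], rule measurable_restrict_space3[OF t']) (auto simp: T_def)
  have q_p: "q (p x) = s x" if "x \<in> space M" for x
    using t(2)[OF that] de sM that by (simp add: q_def)
  have pT: "p x \<in> T" if "x \<in> space M" for x
    using t(2)[OF that] sM pN that by (simp add: T_def)
  have spT: "space (restrict_space N T) = T" using T sets.sets_into_space by (auto simp: space_restrict_space)
  \<comment> \<open>On \<open>T\<close> the value \<open>t (e' y)\<close> codes a point, and the image consists of the \<open>y\<close> that this point is mapped to.\<close>
  have eq: "p ` space M = {y \<in> space (restrict_space N T). e' (p (q y)) = e' y}"
  proof (intro equalityI subsetI)
    fix y assume y: "y \<in> {y \<in> space (restrict_space N T). e' (p (q y)) = e' y}"
    then have "q y \<in> space M" using measurable_space[OF q] by blast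
    moreover have "p (q y) = y"
      using y pN[OF \<open>q y \<in> space M\<close>] de' by (metis (mono_tags, lifting) T_def mem_Collect_eq spT)
    ultimately show "y \<in> p ` space M" by force
  next
    fix y assume "y \<in> p ` space M"
    then obtain x where "x \<in> space M" "y = p x" by blast
    then show "y \<in> {y \<in> space (restrict_space N T). e' (p (q y)) = e' y}"
      using pT q_p s(2) by (simp add: spT)
  qed
  have "{y \<in> space (restrict_space N T). e' (p (q y)) = e' y} \<in> sets (restrict_space N T)"
    by (intro measurable_Collect_eq measurable_restrict_space1[OF e'] measurable_compose[OF q measurable_compose[OF p e']])
  then show "p ` space M \<in> sets N" unfolding eq[symmetric] using T by (simp add: sets_restrict_space_iff)
  have "q \<in> restrict_space N (p ` space M) \<rightarrow>\<^sub>M M"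
    by (rule measurable_restrict_mono[OF q]) (use pT in auto)
  then show "\<exists>t. t \<in> restrict_space N (p ` space M) \<rightarrow>\<^sub>M M \<and> (\<forall>x\<in>space M. t (p x) = s x)"
    using q_p by blast
qed

text \<open>Large section uniformization. Largeness is only defined at points of the domain, so the image of \<open>p\<close>
  is not known to be Borel beforehand; a selector on the domain comes first, and its factorization
  through \<open>p\<close> then yields the image and the section together.\<close>

theorem borel_large_section:
  fixes M :: "'a measure" and N :: "'b measure" and p :: "'a \<Rightarrow> 'b"
  assumes M: "standard_borel M" and N: "standard_borel N" and p: "p \<in> M \<rightarrow>\<^sub>M N"
    and L_sets: "\<And>A. A \<in> sets M \<Longrightarrow> L A \<in> sets M"
    and L_space: "L (space M) = space M"
    and L_UN: "\<And>A :: nat \<Rightarrow> 'a set. range A \<subseteq> sets M \<Longrightarrow> L (\<Union>i. A i) \<subseteq> (\<Union>i. L (A i))"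
    and L_fibre: "\<And>A x. A \<in> sets M \<Longrightarrow> x \<in> L A \<Longrightarrow> \<exists>y\<in>A. p y = p x"
    and L_inv: "\<And>A x y. A \<in> sets M \<Longrightarrow> x \<in> space M \<Longrightarrow> y \<in> space M \<Longrightarrow> p x = p y \<Longrightarrow> x \<in> L A \<Longrightarrow> y \<in> L A"
  shows "p ` space M \<in> sets N"
    and "\<exists>t. t \<in> restrict_space N (p ` space M) \<rightarrow>\<^sub>M M \<and> (\<forall>y\<in>p ` space M. t y \<in> space M \<and> p (t y) = y)"
proof -
  obtain e :: "'a \<Rightarrow> nat \<Rightarrow> real" and d where c: "borel_coding M e d"
    using M by (rule standard_borel_imp_coding)
  obtain e' :: "'b \<Rightarrow> nat \<Rightarrow> real" and d' where c': "borel_coding N e' d'"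
    using N by (rule standard_borel_imp_coding)
  have e': "e' \<in> borel_measurable N" and de': "\<And>y. y \<in> space N \<Longrightarrow> d' (e' y) = y"
    using c' unfolding borel_coding_def by auto
  have pN: "p x \<in> space N" if "x \<in> space M" for x using measurable_space[OF p that] .
  have e'_inj: "e' (p x) = e' (p y) \<longleftrightarrow> p x = p y" if "x \<in> space M" "y \<in> space M" for x y
    using de'[OF pN[OF that(1)]] de'[OF pN[OF that(2)]] by metis
  obtain s where s: "s \<in> M \<rightarrow>\<^sub>M M" "\<And>x. x \<in> space M \<Longrightarrow> e' (p (s x)) = e' (p x)"
    "\<And>x y. x \<in> space M \<Longrightarrow> y \<in> space M \<Longrightarrow> e' (p x) = e' (p y) \<Longrightarrow> s x = s y"
  proof (rule borel_selector[OF c measurable_compose[OF p e'] L_sets L_space L_UN])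
    show "\<exists>y\<in>A. e' (p y) = e' (p x)" if Ax: "A \<in> sets M" "x \<in> L A" for A x
    proof -
      obtain y where "y \<in> A" "p y = p x" using L_fibre[OF Ax] by (elim bexE)
      then show ?thesis by (intro bexI[of _ y]) simp_all
    qed
    show "x \<in> L A \<longleftrightarrow> y \<in> L A" if "A \<in> sets M" "x \<in> space M" "y \<in> space M" "e' (p x) = e' (p y)" for A x y
      using L_inv[of A x y] L_inv[of A y x] that e'_inj[OF that(2,3)] by auto
  qed (assumption, assumption, rule that)
  have sM: "s x \<in> space M" if "x \<in> space M" for x using measurable_space[OF s(1) that] .
  have ps: "p (s x) = p x" if "x \<in> space M" for x using s(2)[OF that] e'_inj[OF sM[OF that] that] by simp
  have s_eq: "s x = s y" if "x \<in> space M" "y \<in> space M" "p x = p y" for x y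
    by (rule s(3)[OF that(1,2)]) (simp add: that(3))
  note sec = borel_section[OF c c' p s(1) ps s_eq]
  show "p ` space M \<in> sets N" by (rule sec(1))
  obtain t where t: "t \<in> restrict_space N (p ` space M) \<rightarrow>\<^sub>M M" "\<forall>x\<in>space M. t (p x) = s x" using sec(2) by blast
  then show "\<exists>t. t \<in> restrict_space N (p ` space M) \<rightarrow>\<^sub>M M \<and> (\<forall>y\<in>p ` space M. t y \<in> space M \<and> p (t y) = y)"
    using sM ps by (intro exI[of _ t]) simp
qed

text \<open>The inverse in the Lusin-Souslin theorem: for injective \<open>p\<close> the identity is constant on the fibres, and
  \<open>borel_section\<close> applies to it.\<close>

lemma borel_inverse_of_injection:
  fixes M :: "'a measure" and N :: "'b measure" and p :: "'a \<Rightarrow> 'b"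
  assumes M: "standard_borel M" and N: "standard_borel N" and p: "p \<in> M \<rightarrow>\<^sub>M N" and inj: "inj_on p (space M)"
  shows "\<exists>t. t \<in> restrict_space N (p ` space M) \<rightarrow>\<^sub>M M \<and> (\<forall>x\<in>space M. t (p x) = x)"
proof -
  obtain e :: "'a \<Rightarrow> nat \<Rightarrow> real" and d where c: "borel_coding M e d"
    using M by (rule standard_borel_imp_coding)
  obtain e' :: "'b \<Rightarrow> nat \<Rightarrow> real" and d' where c': "borel_coding N e' d'"
    using N by (rule standard_borel_imp_coding)
  show ?thesis
    using borel_section(2)[OF c c' p, of "\<lambda>x. x"] inj by (simp add: inj_on_eq_iff)
qed

lemma standard_borel_Collect_eq:
  fixes N :: "'b measure"
  assumes N: "standard_borel N" and f: "f \<in> M \<rightarrow>\<^sub>M N" and g: "g \<in> M \<rightarrow>\<^sub>M N"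
  shows "{x \<in> space M. f x = g x} \<in> sets M"
proof -
  obtain e :: "'b \<Rightarrow> nat \<Rightarrow> real" and d where c: "borel_coding N e d"
    using N by (rule standard_borel_imp_coding)
  then have e: "e \<in> borel_measurable N" and de: "\<And>y. y \<in> space N \<Longrightarrow> d (e y) = y"
    unfolding borel_coding_def by auto
  have "e (f x) = e (g x) \<longleftrightarrow> f x = g x" if "x \<in> space M" for x
    using de[OF measurable_space[OF f that]] de[OF measurable_space[OF g that]] by metis
  then have "{x \<in> space M. f x = g x} = {x \<in> space M. e (f x) = e (g x)}" by auto
  also have "\<dots> \<in> sets M"
    by (intro measurable_Collect_eq measurable_compose[OF f e] measurable_compose[OF g e])
  finally show ?thesis .
qed

lemma measurable_borel_ofI:
  assumes "f \<in> space M \<rightarrow> topspace X" "\<And>U. openin X U \<Longrightarrow> f -` U \<inter> space M \<in> sets M"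
  shows "f \<in> M \<rightarrow>\<^sub>M borel_of X"
  unfolding borel_of_def
proof (rule measurable_measure_of)
  show "{U. openin X U} \<subseteq> Pow (topspace X)" using openin_subset by blast
qed (use assms in auto)

lemma continuous_map_measurable:
  assumes "continuous_map X Y f" shows "f \<in> borel_of X \<rightarrow>\<^sub>M borel_of Y"
proof (rule measurable_borel_ofI)
  show "f \<in> space (borel_of X) \<rightarrow> topspace Y" using assms by (simp add: space_borel_of continuous_map_def)
  fix U assume "openin Y U"
  then have "openin X {x \<in> topspace X. f x \<in> U}" using openin_continuous_map_preimage[OF assms] by simp
  moreover have "f -` U \<inter> space (borel_of X) = {x \<in> topspace X. f x \<in> U}" by (auto simp: space_borel_of)
  ultimately show "f -` U \<inter> space (borel_of X) \<in> sets (borel_of X)" by (simp add: openin_sets_borel_of)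
qed

lemma openin_prod_topology_measurable:
  assumes X: "second_countable X" and Y: "second_countable Y" and U: "openin (prod_topology X Y) U"
  shows "U \<in> sets (borel_of X \<Otimes>\<^sub>M borel_of Y)"
proof -
  obtain b where b: "\<And>n::nat. openin X (b n)" "\<And>U x. openin X U \<Longrightarrow> x \<in> U \<Longrightarrow> \<exists>n. x \<in> b n \<and> b n \<subseteq> U"
    using X by (rule second_countable_sequence) (rule that)
  obtain c where c: "\<And>n::nat. openin Y (c n)" "\<And>U x. openin Y U \<Longrightarrow> x \<in> U \<Longrightarrow> \<exists>n. x \<in> c n \<and> c n \<subseteq> U"
    using Y by (rule second_countable_sequence) (rule that)
  have "U = (\<Union>(i, j)\<in>{(i, j). b i \<times> c j \<subseteq> U}. b i \<times> c j)"
  proof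
    show "U \<subseteq> (\<Union>(i, j)\<in>{(i, j). b i \<times> c j \<subseteq> U}. b i \<times> c j)"
    proof
      fix z assume z: "z \<in> U"
      obtain x y where xy: "z = (x, y)" by (rule prod.exhaust)
      obtain V W where VW: "openin X V" "openin Y W" "x \<in> V" "y \<in> W" "V \<times> W \<subseteq> U"
        using U[unfolded openin_prod_topology_alt] z[unfolded xy] by (elim allE impE) (assumption, elim exE conjE)
      obtain i where i: "x \<in> b i" "b i \<subseteq> V" using b(2)[OF VW(1,3)] by blast
      obtain j where j: "y \<in> c j" "c j \<subseteq> W" using c(2)[OF VW(2,4)] by blast
      have "b i \<times> c j \<subseteq> U" using i(2) j(2) VW(5) by blast
      then show "z \<in> (\<Union>(i, j)\<in>{(i, j). b i \<times> c j \<subseteq> U}. b i \<times> c j)" using i(1) j(1) xy by blast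
    qed
  qed blast
  also have "\<dots> \<in> sets (borel_of X \<Otimes>\<^sub>M borel_of Y)"
    using b(1) c(1) by (intro sets.countable_UN') (auto intro!: pair_measureI openin_sets_borel_of)
  finally show ?thesis .
qed

section \<open>Groupoid calculus and measurability of the structure maps\<close>

context groupoid
begin

lemma mult_closed:
  assumes "a \<in> mors G" "b \<in> mors G" "src G a = tgt G b"
  shows "mult G a b \<in> mors G" "src G (mult G a b) = src G b" "tgt G (mult G a b) = tgt G a"
  using mult_hom[of a b] assms unfolding composable_def homset_def by auto

lemma invm_closed:
  assumes "a \<in> mors G"
  shows "invm G a \<in> mors G" "src G (invm G a) = tgt G a" "tgt G (invm G a) = src G a"
  using invm_hom[OF assms] unfolding homset_def by auto

lemma ident_closed:
  assumes "x \<in> objs G"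
  shows "ident G x \<in> mors G" "src G (ident G x) = x" "tgt G (ident G x) = x"
  using ident_hom[OF assms] unfolding homset_def by auto

lemma assoc:
  assumes "a \<in> mors G" "b \<in> mors G" "c \<in> mors G" "src G a = tgt G b" "src G b = tgt G c"
  shows "mult G (mult G a b) c = mult G a (mult G b c)"
  by (rule mult_assoc) (use assms in \<open>auto simp: composable_def\<close>)

lemma ident_left: "a \<in> mors G \<Longrightarrow> x = tgt G a \<Longrightarrow> mult G (ident G x) a = a"
  using ident_mult by simp

lemma ident_right: "a \<in> mors G \<Longrightarrow> x = src G a \<Longrightarrow> mult G a (ident G x) = a"
  using mult_ident by simp

lemma invm_mult_cancel:
  assumes "a \<in> mors G" "b \<in> mors G" "src G a = tgt G b"
  shows "mult G (invm G a) (mult G a b) = b"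
  using assoc[of "invm G a" a b] assms by (simp add: invm_closed invm_mult ident_mult)

lemma mult_invm_cancel:
  assumes "a \<in> mors G" "b \<in> mors G" "tgt G a = tgt G b"
  shows "mult G a (mult G (invm G a) b) = b"
  using assoc[of a "invm G a" b] assms by (simp add: invm_closed mult_invm ident_mult)

lemma invm_unique:
  assumes "a \<in> mors G" "b \<in> mors G" "src G a = tgt G b" "mult G a b = ident G (tgt G a)"
  shows "invm G a = b"
proof -
  have "mult G (invm G a) (mult G a b) = invm G a"
    unfolding assms(4) using assms(1) by (simp add: invm_closed ident_right)
  then show ?thesis using invm_mult_cancel[OF assms(1-3)] by simp
qed

lemma invm_invm: "a \<in> mors G \<Longrightarrow> invm G (invm G a) = a"
  by (rule invm_unique) (simp_all add: invm_closed invm_mult)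

lemma invm_mult_distrib:
  assumes "a \<in> mors G" "b \<in> mors G" "src G a = tgt G b"
  shows "invm G (mult G a b) = mult G (invm G b) (invm G a)"
  by (rule invm_unique)
    (use assms in \<open>simp_all add: mult_closed invm_closed assoc mult_invm_cancel mult_invm\<close>)

lemmas groupoid_simps = mult_closed invm_closed ident_closed src_closed tgt_closed assoc ident_left ident_right
  invm_mult_cancel mult_invm_cancel invm_invm invm_mult_distrib invm_mult mult_invm

end

lemma (in standard_borel_groupoid) measurable_mult_compose:
  assumes a: "a \<in> M \<rightarrow>\<^sub>M mor_alg G" and b: "b \<in> M \<rightarrow>\<^sub>M mor_alg G"
    and ab: "\<And>x. x \<in> space M \<Longrightarrow> src G (a x) = tgt G (b x)"
  shows "(\<lambda>x. mult G (a x) (b x)) \<in> M \<rightarrow>\<^sub>M mor_alg G"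
proof -
  have "(\<lambda>x. (a x, b x)) \<in> M \<rightarrow>\<^sub>M restrict_space (mor_alg G \<Otimes>\<^sub>M mor_alg G) (composable G)"
    using ab measurable_space[OF a] measurable_space[OF b]
    by (intro measurable_restrict_space2 measurable_Pair a b) (auto simp: composable_def space_mor_alg)
  from measurable_compose[OF this measurable_mult] show ?thesis by simp
qed

lemma borel_groupoid_of_simps [simp]:
  "objs (borel_groupoid_of G) = objs G" "mors (borel_groupoid_of G) = mors G"
  "src (borel_groupoid_of G) = src G" "tgt (borel_groupoid_of G) = tgt G"
  "ident (borel_groupoid_of G) = ident G" "mult (borel_groupoid_of G) = mult G"
  "invm (borel_groupoid_of G) = invm G"
  "obj_alg (borel_groupoid_of G) = borel_of (obj_top G)"
  "mor_alg (borel_groupoid_of G) = borel_of (mor_top G)"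
  "homset (borel_groupoid_of G) x y = homset G x y"
  "composable (borel_groupoid_of G) = composable G"
  by (simp_all add: borel_groupoid_of_def homset_def composable_def)

lemma borel_groupoid_of_standard:
  fixes G :: "('o, 'm) top_groupoid_data"
  assumes "open_quasi_polish_groupoid G"
  shows "standard_borel_groupoid (borel_groupoid_of G)"
proof -
  interpret open_quasi_polish_groupoid G by fact
  have mult: "(\<lambda>(g, h). mult G g h) \<in>
      restrict_space (borel_of (mor_top G) \<Otimes>\<^sub>M borel_of (mor_top G)) (composable G) \<rightarrow>\<^sub>M borel_of (mor_top G)"
    (is "_ \<in> ?R \<rightarrow>\<^sub>M _")
  proof (rule measurable_borel_ofI)
    have sp: "space ?R = composable G"
      by (auto simp: space_restrict_space space_pair_measure space_borel_of topspace_mor_top composable_def)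
    show "(\<lambda>(g, h). mult G g h) \<in> space ?R \<rightarrow> topspace (mor_top G)"
      unfolding sp topspace_mor_top using mult_closed by (auto simp: composable_def)
    fix U assume "openin (mor_top G) U"
    then have "openin (subtopology (prod_topology (mor_top G) (mor_top G)) (composable G))
       {z \<in> topspace (subtopology (prod_topology (mor_top G) (mor_top G)) (composable G)). (case z of (g, h) \<Rightarrow> mult G g h) \<in> U}"
      using openin_continuous_map_preimage[OF continuous_mult] by simp
    then obtain V where V: "openin (prod_topology (mor_top G) (mor_top G)) V"
      "{z \<in> topspace (subtopology (prod_topology (mor_top G) (mor_top G)) (composable G)). (case z of (g, h) \<Rightarrow> mult G g h) \<in> U}
        = V \<inter> composable G"
      unfolding openin_subtopology by blast
    have "topspace (subtopology (prod_topology (mor_top G) (mor_top G)) (composable G)) = composable G"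
      by (auto simp: topspace_mor_top composable_def)
    then have "(\<lambda>(g, h). mult G g h) -` U \<inter> space ?R = composable G \<inter> V"
      unfolding sp using V(2) by (simp add: vimage_def Int_def conj_commute)
    moreover have "V \<in> sets (borel_of (mor_top G) \<Otimes>\<^sub>M borel_of (mor_top G))"
      by (rule openin_prod_topology_measurable[OF _ _ V(1)])
        (simp_all add: quasi_polish_second_countable quasi_polish_mor)
    ultimately show "(\<lambda>(g, h). mult G g h) -` U \<inter> space ?R \<in> sets ?R"
      by (auto simp: sets_restrict_space)
  qed
  show ?thesis
    by unfold_locales
      (use mult src_closed tgt_closed ident_hom mult_hom invm_hom mult_assoc mult_ident ident_mult invm_mult mult_invm
        in \<open>auto simp: space_borel_of topspace_obj_top topspace_mor_top quasi_polish_obj quasi_polish_mor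
          quasi_polish_standard_borel continuous_src continuous_tgt continuous_ident continuous_invm
          intro!: continuous_map_measurable\<close>)
qed

section \<open>Selecting an object and an arrow over the essential image\<close>

locale full_borel_functor =
  open_quasi_polish_groupoid G + H: standard_borel_groupoid H + borel_functor "borel_groupoid_of G" H Fo Fm
  for G :: "('a, 'b) top_groupoid_data" and H :: "('c, 'd) borel_groupoid_data"
    and Fo :: "'a \<Rightarrow> 'c" and Fm :: "'b \<Rightarrow> 'd" +
  assumes full: "full_functor G H Fo Fm"
begin

lemma F_obj: "x \<in> objs G \<Longrightarrow> Fo x \<in> objs H"
  using obj_closed by simp

lemma F_mor:
  assumes "g \<in> mors G"
  shows "Fm g \<in> mors H" "src H (Fm g) = Fo (src G g)" "tgt H (Fm g) = Fo (tgt G g)"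
  using mor_hom[of g] assms by (simp_all add: homset_def)

lemma F_mult: "g \<in> mors G \<Longrightarrow> h \<in> mors G \<Longrightarrow> src G g = tgt G h \<Longrightarrow> Fm (mult G g h) = mult H (Fm g) (Fm h)"
  using map_mult[of g h] by (simp add: composable_def)

lemma F_full:
  assumes "x \<in> objs G" "y \<in> objs G" "h \<in> homset H (Fo x) (Fo y)"
  obtains g where "g \<in> mors G" "src G g = x" "tgt G g = y" "Fm g = h"
proof -
  have "h \<in> Fm ` homset G x y" using full assms unfolding full_functor_def by simp
  then obtain g where "g \<in> homset G x y" "h = Fm g" by (elim imageE)
  then show thesis by (intro that[of g]) (simp_all add: homset_def)
qed

lemma Fo_measurable: "Fo \<in> borel_of (obj_top G) \<rightarrow>\<^sub>M obj_alg H"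
  and Fm_measurable: "Fm \<in> borel_of (mor_top G) \<rightarrow>\<^sub>M mor_alg H"
  using measurable_obj measurable_mor by simp_all

lemma src_measurable: "src G \<in> borel_of (mor_top G) \<rightarrow>\<^sub>M borel_of (obj_top G)"
  and tgt_measurable: "tgt G \<in> borel_of (mor_top G) \<rightarrow>\<^sub>M borel_of (obj_top G)"
  by (intro continuous_map_measurable continuous_src continuous_tgt)+

lemma standard_borel_top:
  "standard_borel (borel_of (obj_top G))" "standard_borel (borel_of (mor_top G))"
  by (intro quasi_polish_standard_borel quasi_polish_obj quasi_polish_mor)+

definition arrows_over :: "('a \<times> 'd) set" where
  "arrows_over = {(x, h). x \<in> objs G \<and> h \<in> mors H \<and> src H h = Fo x}"

definition arrows_alg :: "('a \<times> 'd) measure" where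
  "arrows_alg = restrict_space (borel_of (obj_top G) \<Otimes>\<^sub>M mor_alg H) arrows_over"

lemma arrows_over_sets: "arrows_over \<in> sets (borel_of (obj_top G) \<Otimes>\<^sub>M mor_alg H)" (is "_ \<in> sets ?P")
proof -
  have "{z \<in> space ?P. src H (snd z) = Fo (fst z)} \<in> sets ?P"
    by (intro standard_borel_Collect_eq[OF H.standard_borel_obj] measurable_compose[OF measurable_snd H.measurable_src]
        measurable_compose[OF measurable_fst Fo_measurable])
  also have "{z \<in> space ?P. src H (snd z) = Fo (fst z)} = arrows_over"
    by (auto simp: arrows_over_def space_pair_measure space_borel_of topspace_obj_top H.space_mor_alg)
  finally show ?thesis .
qed

lemma space_arrows_alg: "space arrows_alg = arrows_over"
  using sets.sets_into_space[OF arrows_over_sets] by (auto simp: arrows_alg_def space_restrict_space)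

lemma standard_borel_arrows_alg: "standard_borel arrows_alg"
  unfolding arrows_alg_def
  by (intro standard_borel_restrict_space standard_borel_pair standard_borel_top H.standard_borel_mor arrows_over_sets)

lemma arrows_alg_measurable:
  "fst \<in> arrows_alg \<rightarrow>\<^sub>M borel_of (obj_top G)" "snd \<in> arrows_alg \<rightarrow>\<^sub>M mor_alg H"
  unfolding arrows_alg_def by (intro measurable_restrict_space1 measurable_fst measurable_snd)+

definition act :: "'b \<Rightarrow> 'a \<times> 'd \<Rightarrow> 'a \<times> 'd" where
  "act g r = (tgt G g, mult H (snd r) (invm H (Fm g)))"

lemma act_closed:
  assumes "r \<in> arrows_over" "g \<in> mors G" "src G g = fst r"
  shows "act g r \<in> arrows_over" "tgt H (snd (act g r)) = tgt H (snd r)"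
  using assms F_mor[of g] tgt_closed[of g]
  by (auto simp: arrows_over_def act_def H.groupoid_simps)

text \<open>The sections of this set at \<open>r\<close> are the sets of arrows whose category decides whether \<open>B\<close> is large at
  \<open>r\<close>. As they come from a single Borel set, the category quantifier applies.\<close>

definition translates :: "('a \<times> 'd) set \<Rightarrow> (('a \<times> 'd) \<times> 'b) set" where
  "translates B = {(r, g). r \<in> arrows_over \<and> g \<in> mors G \<and> src G g = fst r \<and> act g r \<in> B}"

lemma translates_sets:
  assumes B: "B \<in> sets arrows_alg"
  shows "translates B \<in> sets (arrows_alg \<Otimes>\<^sub>M borel_of (mor_top G))" (is "_ \<in> sets ?P")
proof -
  let ?S = "{z \<in> space ?P. src G (snd z) = fst (fst z)}"
  let ?R = "restrict_space ?P ?S"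
  have S: "?S \<in> sets ?P"
    by (intro standard_borel_Collect_eq[OF standard_borel_top(1)] measurable_compose[OF measurable_snd src_measurable]
        measurable_compose[OF measurable_fst arrows_alg_measurable(1)])
  have spP: "space ?P = arrows_over \<times> mors G"
    by (simp add: space_pair_measure space_arrows_alg space_borel_of topspace_mor_top)
  have spR: "space ?R = {z \<in> arrows_over \<times> mors G. src G (snd z) = fst (fst z)}"
    unfolding spP[symmetric] by (auto simp: space_restrict_space)
  have snd: "snd \<in> ?R \<rightarrow>\<^sub>M borel_of (mor_top G)" and fst: "fst \<in> ?R \<rightarrow>\<^sub>M arrows_alg"
    by (intro measurable_restrict_space1 measurable_fst measurable_snd)+
  have "(\<lambda>z. act (snd z) (fst z)) \<in> ?R \<rightarrow>\<^sub>M arrows_alg"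
    unfolding arrows_alg_def[THEN arg_cong[where f="measurable ?R"]]
  proof (rule measurable_restrict_space2)
    show "(\<lambda>z. act (snd z) (fst z)) \<in> ?R \<rightarrow>\<^sub>M borel_of (obj_top G) \<Otimes>\<^sub>M mor_alg H"
      unfolding act_def
    proof (intro measurable_Pair H.measurable_mult_compose)
      show "(\<lambda>z. tgt G (snd z)) \<in> ?R \<rightarrow>\<^sub>M borel_of (obj_top G)"
        by (rule measurable_compose[OF snd tgt_measurable])
      show "(\<lambda>z. snd (fst z)) \<in> ?R \<rightarrow>\<^sub>M mor_alg H"
        by (rule measurable_compose[OF fst arrows_alg_measurable(2)])
      show "(\<lambda>z. invm H (Fm (snd z))) \<in> ?R \<rightarrow>\<^sub>M mor_alg H"
        by (rule measurable_compose[OF snd measurable_compose[OF Fm_measurable H.measurable_invm]])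
      show "src H (snd (fst z)) = tgt H (invm H (Fm (snd z)))" if "z \<in> space ?R" for z
        using that F_mor[of "snd z"] unfolding spR by (auto simp: arrows_over_def H.groupoid_simps)
    qed
    show "(\<lambda>z. act (snd z) (fst z)) \<in> space ?R \<rightarrow> arrows_over"
      unfolding spR using act_closed(1) by auto
  qed
  then have "(\<lambda>z. act (snd z) (fst z)) -` B \<inter> space ?R \<in> sets ?R" using B by (rule measurable_sets)
  also have "(\<lambda>z. act (snd z) (fst z)) -` B \<inter> space ?R = translates B"
    unfolding spR translates_def by auto
  finally show ?thesis using S by (simp add: sets_restrict_space_iff)
qed

abbreviation fibre :: "'a \<Rightarrow> 'b topology" where
  "fibre x \<equiv> subtopology (mor_top G) {g \<in> topspace (mor_top G). src G g = x}"

lemma fibre_quasi_polish: "x \<in> objs G \<Longrightarrow> quasi_polish (fibre x)"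
  by (rule quasi_polish_fibre[OF quasi_polish_mor quasi_polish_obj continuous_src]) (simp add: topspace_obj_top)

definition large :: "('a \<times> 'd) set \<Rightarrow> ('a \<times> 'd) set" where
  "large B = {r \<in> arrows_over. \<not> meager_in (fibre (fst r)) {g. (r, g) \<in> translates B}}"

lemma large_sets:
  assumes "B \<in> sets arrows_alg" shows "large B \<in> sets arrows_alg"
proof -
  have "{r \<in> space arrows_alg. meager_in (fibre (fst r)) {g. (r, g) \<in> translates B}} \<in> sets arrows_alg"
    by (rule category_quantifier_measurable[OF quasi_polish_second_countable[OF quasi_polish_mor] open_src _
          arrows_alg_measurable(1) translates_sets[OF assms]])
      (simp add: fibre_quasi_polish topspace_obj_top)
  then have "space arrows_alg - {r \<in> space arrows_alg. meager_in (fibre (fst r)) {g. (r, g) \<in> translates B}} \<in> sets arrows_alg"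
    by (rule sets.compl_sets)
  also have "space arrows_alg - {r \<in> space arrows_alg. meager_in (fibre (fst r)) {g. (r, g) \<in> translates B}} = large B"
    by (auto simp: large_def space_arrows_alg)
  finally show ?thesis .
qed

text \<open>The space of arrows with a given source is Baire and contains a unit, so it is not meager in itself.\<close>

lemma large_arrows: "large arrows_over = arrows_over"
proof -
  have "\<not> meager_in (fibre (fst r)) {g. (r, g) \<in> translates arrows_over}" if r: "r \<in> arrows_over" for r
  proof
    assume m: "meager_in (fibre (fst r)) {g. (r, g) \<in> translates arrows_over}"
    have x: "fst r \<in> objs G" using r by (auto simp: arrows_over_def)
    have eq: "{g. (r, g) \<in> translates arrows_over} = topspace (fibre (fst r))"
      using r act_closed(1)[OF r] by (auto simp: translates_def topspace_mor_top)
    have "ident G (fst r) \<in> topspace (fibre (fst r))"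
      using x by (simp add: topspace_mor_top ident_closed)
    then have "\<not> meager_in (fibre (fst r)) (topspace (fibre (fst r)))"
      by (intro quasi_polish_open_nonmeager fibre_quasi_polish x openin_topspace) blast
    with m show False unfolding eq by simp
  qed
  then show ?thesis by (auto simp: large_def)
qed

lemma large_UN: "large (\<Union>i::nat. B i) \<subseteq> (\<Union>i. large (B i))"
proof
  fix r assume r: "r \<in> large (\<Union>i. B i)"
  have eq: "{g. (r, g) \<in> translates (\<Union>i. B i)} = (\<Union>i. {g. (r, g) \<in> translates (B i)})"
    by (auto simp: translates_def)
  have "\<exists>i. \<not> meager_in (fibre (fst r)) {g. (r, g) \<in> translates (B i)}"
  proof (rule ccontr)
    assume "\<not> ?thesis"
    then have "meager_in (fibre (fst r)) {g. (r, g) \<in> translates (\<Union>i. B i)}"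
      unfolding eq by (intro meager_in_UN) simp
    with r show False by (simp add: large_def)
  qed
  with r show "r \<in> (\<Union>i. large (B i))" by (auto simp: large_def)
qed

lemma large_meets_fibre:
  assumes "r \<in> large B" shows "\<exists>s\<in>B. tgt H (snd s) = tgt H (snd r)"
proof -
  have r: "r \<in> arrows_over" using assms by (simp add: large_def)
  have "{g. (r, g) \<in> translates B} \<noteq> {}"
  proof
    assume "{g. (r, g) \<in> translates B} = {}"
    then show False using assms meager_in_disjoint[of "{g. (r, g) \<in> translates B}" "fibre (fst r)"]
      by (simp add: large_def)
  qed
  then obtain g where "g \<in> mors G" "src G g = fst r" "act g r \<in> B" by (auto simp: translates_def)
  then show ?thesis using act_closed(2)[OF r] by blast
qed

lemma right_translation_continuous:
  assumes k: "k \<in> mors G"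
  shows "continuous_map (fibre (tgt G k)) (fibre (src G k)) (\<lambda>g. mult G g k)"
proof -
  let ?C = "subtopology (prod_topology (mor_top G) (mor_top G)) (composable G)"
  have top: "topspace (fibre x) = {g \<in> mors G. src G g = x}" for x by (auto simp: topspace_mor_top)
  have "continuous_map (fibre (tgt G k)) ?C (\<lambda>g. (g, k))"
    unfolding continuous_map_in_subtopology
  proof
    have "continuous_map (fibre (tgt G k)) (mor_top G) (\<lambda>g. g)"
      by (intro continuous_map_from_subtopology) simp
    moreover have "continuous_map (fibre (tgt G k)) (mor_top G) (\<lambda>g. k)"
      using k by (simp add: topspace_mor_top)
    ultimately show "continuous_map (fibre (tgt G k)) (prod_topology (mor_top G) (mor_top G)) (\<lambda>g. (g, k))"
      by (simp add: continuous_map_pairwise comp_def)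
    show "(\<lambda>g. (g, k)) \<in> topspace (fibre (tgt G k)) \<rightarrow> composable G"
      unfolding top using k by (auto simp: composable_def)
  qed
  from continuous_map_compose[OF this continuous_mult]
  have "continuous_map (fibre (tgt G k)) (mor_top G) (\<lambda>g. mult G g k)" by (simp add: comp_def)
  moreover have "(\<lambda>g. mult G g k) \<in> topspace (fibre (tgt G k)) \<rightarrow> {g \<in> topspace (mor_top G). src G g = src G k}"
    unfolding top using k by (auto simp: topspace_mor_top mult_closed)
  ultimately show ?thesis by (simp add: continuous_map_in_subtopology)
qed

text \<open>The translation that matches the arrows out of two points of one orbit, used to see that
  largeness depends on the orbit only.\<close>

lemma right_translation_homeomorphic:
  assumes k: "k \<in> mors G"
  shows "homeomorphic_map (fibre (tgt G k)) (fibre (src G k)) (\<lambda>g. mult G g k)"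
proof -
  have "homeomorphic_maps (fibre (tgt G k)) (fibre (src G k)) (\<lambda>g. mult G g k) (\<lambda>g. mult G g (invm G k))"
    unfolding homeomorphic_maps_def
  proof (intro conjI ballI)
    show "continuous_map (fibre (tgt G k)) (fibre (src G k)) (\<lambda>g. mult G g k)"
      by (rule right_translation_continuous[OF k])
    show "continuous_map (fibre (src G k)) (fibre (tgt G k)) (\<lambda>g. mult G g (invm G k))"
      using right_translation_continuous[of "invm G k"] k by (simp add: invm_closed)
  qed (use k in \<open>auto simp: topspace_mor_top groupoid_simps\<close>)
  then show ?thesis by (rule homeomorphic_maps_imp_map)
qed

text \<open>Fullness enters here: it makes each fibre of the target map a single orbit, because \<open>k\<close> can be chosen
  over the arrow \<open>(snd s)\<^sup>-\<^sup>1 (snd r)\<close>.\<close>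

lemma same_target_translate:
  assumes r: "r \<in> arrows_over" and s: "s \<in> arrows_over" and rs: "tgt H (snd r) = tgt H (snd s)"
  obtains k where "k \<in> mors G" "src G k = fst r" "tgt G k = fst s"
    "\<And>g. g \<in> mors G \<Longrightarrow> src G g = fst s \<Longrightarrow> act (mult G g k) r = act g s"
proof -
  have r': "fst r \<in> objs G" "snd r \<in> mors H" "src H (snd r) = Fo (fst r)"
    and s': "fst s \<in> objs G" "snd s \<in> mors H" "src H (snd s) = Fo (fst s)"
    using r s by (auto simp: arrows_over_def)
  have "mult H (invm H (snd s)) (snd r) \<in> homset H (Fo (fst r)) (Fo (fst s))"
    using r' s' rs by (simp add: homset_def H.groupoid_simps)
  then obtain k where k: "k \<in> mors G" "src G k = fst r" "tgt G k = fst s" "Fm k = mult H (invm H (snd s)) (snd r)"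
    by (rule F_full[OF r'(1) s'(1)])
  have "act (mult G g k) r = act g s" if g: "g \<in> mors G" "src G g = fst s" for g
    using g k(1-3) r' s' rs F_mor[OF g(1)] by (simp add: act_def F_mult k(4) H.groupoid_simps mult_closed)
  with k show thesis by (intro that)
qed

lemma large_invariant:
  assumes r: "r \<in> arrows_over" and s: "s \<in> arrows_over" and rs: "tgt H (snd r) = tgt H (snd s)"
    and large: "s \<in> large B"
  shows "r \<in> large B"
proof -
  obtain k where k: "k \<in> mors G" "src G k = fst r" "tgt G k = fst s"
    "\<And>g. g \<in> mors G \<Longrightarrow> src G g = fst s \<Longrightarrow> act (mult G g k) r = act g s"
    using r s rs by (rule same_target_translate) (rule that)
  have "meager_in (fibre (fst s)) {g. (s, g) \<in> translates B}"
    if "meager_in (fibre (fst r)) {g. (r, g) \<in> translates B}"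
  proof -
    have "meager_in (fibre (tgt G k))
        {g \<in> topspace (fibre (tgt G k)). mult G g k \<in> {g. (r, g) \<in> translates B}}"
      using that by (intro meager_in_homeomorphic_vimage[OF right_translation_homeomorphic[OF k(1)]]) (simp add: k(2))
    then have "meager_in (fibre (fst s)) {g \<in> topspace (fibre (fst s)). mult G g k \<in> {g. (r, g) \<in> translates B}}"
      by (simp only: k(3))
    then show ?thesis
    proof (rule meager_in_mono)
      show "{g. (s, g) \<in> translates B} \<inter> topspace (fibre (fst s))
          \<subseteq> {g \<in> topspace (fibre (fst s)). mult G g k \<in> {g. (r, g) \<in> translates B}}"
        using k r by (auto simp: translates_def mult_closed topspace_mor_top)
    qed
  qed
  then show ?thesis using large r by (auto simp: large_def)
qed

lemma target_image: "(\<lambda>r. tgt H (snd r)) ` arrows_over = essential_image G H Fo"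
proof (intro equalityI subsetI)
  fix y assume "y \<in> (\<lambda>r. tgt H (snd r)) ` arrows_over"
  then obtain x h where "x \<in> objs G" "h \<in> mors H" "src H h = Fo x" "y = tgt H h"
    by (auto simp: arrows_over_def)
  then show "y \<in> essential_image G H Fo"
    unfolding essential_image_def homset_def using H.tgt_closed by blast
next
  fix y assume "y \<in> essential_image G H Fo"
  then obtain x h where "x \<in> objs G" "h \<in> homset H (Fo x) y" unfolding essential_image_def by blast
  then have "(x, h) \<in> arrows_over" "y = tgt H (snd (x, h))" by (simp_all add: arrows_over_def homset_def)
  then show "y \<in> (\<lambda>r. tgt H (snd r)) ` arrows_over" by blast
qed

theorem essential_image_selection:
  shows "essential_image G H Fo \<in> sets (obj_alg H)"
    and "\<exists>x h. (\<lambda>y. (x y, h y)) \<in> restrict_space (obj_alg H) (essential_image G H Fo)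
            \<rightarrow>\<^sub>M borel_of (obj_top G) \<Otimes>\<^sub>M mor_alg H \<and>
          (\<forall>y\<in>essential_image G H Fo. x y \<in> objs G \<and> h y \<in> homset H (Fo (x y)) y)"
proof -
  let ?p = "\<lambda>r :: 'a \<times> 'd. tgt H (snd r)"
  have p: "?p \<in> arrows_alg \<rightarrow>\<^sub>M obj_alg H"
    by (rule measurable_compose[OF arrows_alg_measurable(2) H.measurable_tgt])
  have all: "large (space arrows_alg) = space arrows_alg"
    by (simp only: space_arrows_alg large_arrows)
  have UN: "large (\<Union>i. A i) \<subseteq> (\<Union>i. large (A i))" if "range A \<subseteq> sets arrows_alg" for A :: "nat \<Rightarrow> ('a \<times> 'd) set"
    by (rule large_UN)
  have meets: "\<exists>s\<in>B. ?p s = ?p r" if "B \<in> sets arrows_alg" "r \<in> large B" for B r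
    using that(2) by (rule large_meets_fibre)
  have inv: "s \<in> large B"
    if "B \<in> sets arrows_alg" "r \<in> space arrows_alg" "s \<in> space arrows_alg" "?p r = ?p s" "r \<in> large B" for B r s
    using that(2,3,5) that(4)[symmetric] unfolding space_arrows_alg by (intro large_invariant[of s r B])
  note sel = borel_large_section[OF standard_borel_arrows_alg H.standard_borel_obj p large_sets all UN meets inv]
  have 1: "?p ` space arrows_alg \<in> sets (obj_alg H)" by (rule sel(1))
  have 2: "\<exists>t. t \<in> restrict_space (obj_alg H) (?p ` space arrows_alg) \<rightarrow>\<^sub>M arrows_alg \<and>
      (\<forall>y\<in>?p ` space arrows_alg. t y \<in> space arrows_alg \<and> ?p (t y) = y)" by (rule sel(2))
  show "essential_image G H Fo \<in> sets (obj_alg H)" using 1 by (simp add: space_arrows_alg target_image)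
  obtain t where t: "t \<in> restrict_space (obj_alg H) (essential_image G H Fo) \<rightarrow>\<^sub>M arrows_alg"
      "\<forall>y\<in>essential_image G H Fo. t y \<in> arrows_over \<and> ?p (t y) = y"
    using 2 unfolding space_arrows_alg target_image by (elim exE conjE)
  have "t \<in> restrict_space (obj_alg H) (essential_image G H Fo) \<rightarrow>\<^sub>M borel_of (obj_top G) \<Otimes>\<^sub>M mor_alg H"
    using t(1) unfolding arrows_alg_def measurable_restrict_space2_iff by simp
  moreover have "fst (t y) \<in> objs G \<and> snd (t y) \<in> homset H (Fo (fst (t y))) y" if "y \<in> essential_image G H Fo" for y
    using t(2) that by (auto simp: arrows_over_def homset_def)
  ultimately show "\<exists>x h. (\<lambda>y. (x y, h y)) \<in> restrict_space (obj_alg H) (essential_image G H Fo)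
            \<rightarrow>\<^sub>M borel_of (obj_top G) \<Otimes>\<^sub>M mor_alg H \<and>
          (\<forall>y\<in>essential_image G H Fo. x y \<in> objs G \<and> h y \<in> homset H (Fo (x y)) y)"
    by (intro exI[of _ "\<lambda>y. fst (t y)"] exI[of _ "\<lambda>y. snd (t y)"]) simp
qed

end

section \<open>Full and faithful functors\<close>

lemma full_subgroupoid_simps [simp]:
  "objs (full_subgroupoid H E) = objs H \<inter> E"
  "mors (full_subgroupoid H E) = {h \<in> mors H. src H h \<in> E \<and> tgt H h \<in> E}"
  "src (full_subgroupoid H E) = src H" "tgt (full_subgroupoid H E) = tgt H"
  "ident (full_subgroupoid H E) = ident H" "mult (full_subgroupoid H E) = mult H"
  "invm (full_subgroupoid H E) = invm H"
  "obj_alg (full_subgroupoid H E) = restrict_space (obj_alg H) E"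
  "mor_alg (full_subgroupoid H E) = restrict_space (mor_alg H) {h \<in> mors H. src H h \<in> E \<and> tgt H h \<in> E}"
  by (simp_all add: full_subgroupoid_def Let_def)

text \<open>Subspaces of standard Borel spaces on Borel sets are standard Borel; all structure maps are
  restrictions.\<close>

lemma full_subgroupoid_standard:
  fixes H :: "('c, 'd) borel_groupoid_data"
  assumes "standard_borel_groupoid H" and E: "E \<in> sets (obj_alg H)"
  shows "standard_borel_groupoid (full_subgroupoid H E)"
proof -
  interpret H: standard_borel_groupoid H by fact
  let ?K = "full_subgroupoid H E"
  let ?N = "{h \<in> mors H. src H h \<in> E \<and> tgt H h \<in> E}"
  have EH: "E \<subseteq> objs H" using sets.sets_into_space[OF E] by (simp add: H.space_obj_alg)
  have "(src H -` E \<inter> space (mor_alg H)) \<inter> (tgt H -` E \<inter> space (mor_alg H)) \<in> sets (mor_alg H)"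
    by (intro sets.Int measurable_sets[OF H.measurable_src E] measurable_sets[OF H.measurable_tgt E])
  also have "(src H -` E \<inter> space (mor_alg H)) \<inter> (tgt H -` E \<inter> space (mor_alg H)) = ?N"
    by (auto simp: H.space_mor_alg)
  finally have N: "?N \<in> sets (mor_alg H)" .
  have spN: "space (restrict_space (mor_alg H) ?N) = ?N" and spE: "space (restrict_space (obj_alg H) E) = E"
    using EH by (auto simp: space_restrict_space H.space_mor_alg H.space_obj_alg)
  have mult: "(\<lambda>(g, h). mult H g h) \<in>
     restrict_space (restrict_space (mor_alg H) ?N \<Otimes>\<^sub>M restrict_space (mor_alg H) ?N) (composable ?K)
       \<rightarrow>\<^sub>M restrict_space (mor_alg H) ?N" (is "_ \<in> ?R \<rightarrow>\<^sub>M _")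
  proof (rule measurable_restrict_space2)
    have sp: "space ?R = composable ?K"
      by (auto simp: space_restrict_space space_pair_measure H.space_mor_alg composable_def)
    have 1: "fst \<in> ?R \<rightarrow>\<^sub>M mor_alg H" "snd \<in> ?R \<rightarrow>\<^sub>M mor_alg H"
      by (auto intro!: measurable_restrict_space1 measurable_compose[OF measurable_fst] measurable_compose[OF measurable_snd]
          simp: measurable_ident_sets)
    have "(\<lambda>z. mult H (fst z) (snd z)) \<in> ?R \<rightarrow>\<^sub>M mor_alg H"
    proof (rule H.measurable_mult_compose[OF 1])
      fix z assume "z \<in> space ?R"
      then have "z \<in> composable ?K" unfolding sp .
      then show "src H (fst z) = tgt H (snd z)" by (auto simp: composable_def)
    qed
    then show "(\<lambda>(g, h). mult H g h) \<in> ?R \<rightarrow>\<^sub>M mor_alg H" by (simp add: split_beta')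
    show "(\<lambda>(g, h). mult H g h) \<in> space ?R \<rightarrow> ?N"
      unfolding sp by (auto simp: composable_def H.groupoid_simps)
  qed
  show ?thesis
  proof (unfold_locales)
    show "standard_borel (obj_alg ?K)" "standard_borel (mor_alg ?K)"
      using standard_borel_restrict_space[OF H.standard_borel_obj E]
        standard_borel_restrict_space[OF H.standard_borel_mor N] by simp_all
    show "(\<lambda>(g, h). mult ?K g h) \<in> restrict_space (mor_alg ?K \<Otimes>\<^sub>M mor_alg ?K) (composable ?K) \<rightarrow>\<^sub>M mor_alg ?K"
      using mult by simp
    show "src ?K \<in> mor_alg ?K \<rightarrow>\<^sub>M obj_alg ?K" "tgt ?K \<in> mor_alg ?K \<rightarrow>\<^sub>M obj_alg ?K"
      unfolding full_subgroupoid_simps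
      by (auto intro!: measurable_restrict_space3 H.measurable_src H.measurable_tgt)
    show "invm ?K \<in> mor_alg ?K \<rightarrow>\<^sub>M mor_alg ?K"
      unfolding full_subgroupoid_simps
      by (auto intro!: measurable_restrict_space3 H.measurable_invm simp: H.groupoid_simps)
    show "ident ?K \<in> obj_alg ?K \<rightarrow>\<^sub>M mor_alg ?K"
      unfolding full_subgroupoid_simps
      using EH by (auto intro!: measurable_restrict_space3 H.measurable_ident simp: H.groupoid_simps subset_iff)
  qed (use EH in \<open>auto simp: homset_def composable_def spN spE H.groupoid_simps subset_iff\<close>)
qed

context full_borel_functor
begin

definition triples_alg :: "('a \<times> 'a \<times> 'd) measure" where
  "triples_alg = borel_of (obj_top G) \<Otimes>\<^sub>M (borel_of (obj_top G) \<Otimes>\<^sub>M mor_alg H)"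

text \<open>The image of \<open>g \<mapsto> (src g, tgt g, F g)\<close> for full \<open>F\<close>, see \<open>borel_lift\<close>.\<close>

definition liftable :: "('a \<times> 'a \<times> 'd) set" where
  "liftable = {(x, y, h). x \<in> objs G \<and> y \<in> objs G \<and> h \<in> homset H (Fo x) (Fo y)}"

lemma faithful_eq:
  assumes "faithful_functor G Fm" "g \<in> mors G" "h \<in> mors G" "src G g = src G h" "tgt G g = tgt G h" "Fm g = Fm h"
  shows "g = h"
proof -
  have "inj_on Fm (homset G (src G g) (tgt G g))"
    using assms src_closed tgt_closed unfolding faithful_functor_def by simp
  then show ?thesis using assms by (auto simp: homset_def dest: inj_onD)
qed

text \<open>For a full and faithful functor the arrow of \<open>G\<close> over a given arrow of \<open>H\<close> with given end points is
  unique, and it depends on these data in a Borel way because injective Borel maps have Borel inverses.\<close>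

lemma borel_lift:
  assumes faithful: "faithful_functor G Fm"
  obtains l where "l \<in> restrict_space triples_alg liftable \<rightarrow>\<^sub>M borel_of (mor_top G)"
    "\<And>x y h. (x, y, h) \<in> liftable \<Longrightarrow> l (x, y, h) \<in> homset G x y \<and> Fm (l (x, y, h)) = h"
proof -
  define J where "J g = (src G g, tgt G g, Fm g)" for g
  have J: "J \<in> borel_of (mor_top G) \<rightarrow>\<^sub>M triples_alg"
    unfolding J_def triples_alg_def by (intro measurable_Pair src_measurable tgt_measurable Fm_measurable)
  have sp: "space (borel_of (mor_top G)) = mors G" by (simp add: space_borel_of topspace_mor_top)
  have inj: "inj_on J (mors G)"
    by (rule inj_onI) (simp add: J_def faithful_eq[OF faithful])
  have im: "J ` mors G = liftable"
  proof (intro equalityI subsetI)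
    fix z assume "z \<in> J ` mors G"
    then show "z \<in> liftable" using F_mor src_closed tgt_closed by (auto simp: J_def liftable_def homset_def)
  next
    fix z assume "z \<in> liftable"
    then obtain x y h where z: "z = (x, y, h)" "x \<in> objs G" "y \<in> objs G" "h \<in> homset H (Fo x) (Fo y)"
      by (auto simp: liftable_def)
    obtain g where "g \<in> mors G" "src G g = x" "tgt G g = y" "Fm g = h" by (rule F_full[OF z(2-4)])
    then show "z \<in> J ` mors G" by (auto simp: z(1) J_def)
  qed
  have "standard_borel triples_alg"
    unfolding triples_alg_def by (intro standard_borel_pair standard_borel_top H.standard_borel_mor)
  from borel_inverse_of_injection[OF standard_borel_top(2) this J]
  obtain l where l: "l \<in> restrict_space triples_alg liftable \<rightarrow>\<^sub>M borel_of (mor_top G)" "\<forall>g\<in>mors G. l (J g) = g"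
    using inj unfolding sp im by blast
  have "l (x, y, h) \<in> homset G x y \<and> Fm (l (x, y, h)) = h" if "(x, y, h) \<in> liftable" for x y h
  proof -
    have "(x, y, h) \<in> J ` mors G" using that im by simp
    then obtain g where g: "(x, y, h) = J g" "g \<in> mors G" by (elim imageE)
    then have "l (x, y, h) = g" using l(2) by simp
    then show ?thesis using g by (simp add: J_def homset_def)
  qed
  with l(1) show thesis by (rule that)
qed

text \<open>The inverse functor sends \<open>y\<close> to \<open>x y\<close> and an arrow \<open>k\<close> to the lift of its conjugate by the chosen
  arrows \<open>h\<close>; these arrows form one natural isomorphism and their lifts the other. Every identity
  between arrows of \<open>G\<close> is checked after applying the faithful functor.\<close>

theorem faithful_borel_equivalence:
  assumes faithful: "faithful_functor G Fm"
  shows "borel_equivalence (borel_groupoid_of G) (full_subgroupoid H (essential_image G H Fo)) Fo Fm"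
proof -
  define E where "E = essential_image G H Fo"
  define K where "K = full_subgroupoid H E"
  have E: "E \<in> sets (obj_alg H)" unfolding E_def by (rule essential_image_selection(1))
  have EH: "E \<subseteq> objs H" by (auto simp: E_def essential_image_def)
  have Gs: "standard_borel_groupoid (borel_groupoid_of G)"
    by (rule borel_groupoid_of_standard) (rule open_quasi_polish_groupoid_axioms)
  have Ks: "standard_borel_groupoid K"
    unfolding K_def by (rule full_subgroupoid_standard[OF H.standard_borel_groupoid_axioms E])
  interpret K: standard_borel_groupoid K by (rule Ks)
  obtain x h where xh: "(\<lambda>y. (x y, h y)) \<in> restrict_space (obj_alg H) E \<rightarrow>\<^sub>M borel_of (obj_top G) \<Otimes>\<^sub>M mor_alg H"
      "\<forall>y\<in>E. x y \<in> objs G \<and> h y \<in> homset H (Fo (x y)) y"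
    using essential_image_selection(2) unfolding E_def by (elim exE conjE)
  have x: "x y \<in> objs G" and h: "h y \<in> mors H" "src H (h y) = Fo (x y)" "tgt H (h y) = y" if "y \<in> E" for y
    using xh(2) that by (auto simp: homset_def)
  have x_meas: "x \<in> obj_alg K \<rightarrow>\<^sub>M borel_of (obj_top G)" and h_meas: "h \<in> obj_alg K \<rightarrow>\<^sub>M mor_alg H"
    using measurable_compose[OF xh(1) measurable_fst] measurable_compose[OF xh(1) measurable_snd]
    by (simp_all add: K_def)
  obtain l where l: "l \<in> restrict_space triples_alg liftable \<rightarrow>\<^sub>M borel_of (mor_top G)"
      "\<And>x y h. (x, y, h) \<in> liftable \<Longrightarrow> l (x, y, h) \<in> homset G x y \<and> Fm (l (x, y, h)) = h"
    using faithful by (rule borel_lift) (rule that)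
  have l_meas: "(\<lambda>z. l (u z, v z, w z)) \<in> M \<rightarrow>\<^sub>M borel_of (mor_top G)"
    if "u \<in> M \<rightarrow>\<^sub>M borel_of (obj_top G)" "v \<in> M \<rightarrow>\<^sub>M borel_of (obj_top G)" "w \<in> M \<rightarrow>\<^sub>M mor_alg H"
      "\<And>z. z \<in> space M \<Longrightarrow> (u z, v z, w z) \<in> liftable" for u v w and M :: "'z measure"
  proof (rule measurable_compose[OF measurable_restrict_space2 l(1)])
    show "(\<lambda>z. (u z, v z, w z)) \<in> M \<rightarrow>\<^sub>M triples_alg"
      unfolding triples_alg_def by (intro measurable_Pair that(1-3))
  qed (use that(4) in auto)
  have Fo_E: "Fo z \<in> E" if "z \<in> objs G" for z
    using that F_obj[OF that] H.ident_hom[of "Fo z"] unfolding E_def essential_image_def by blast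
  have K_mor: "k \<in> mors K \<longleftrightarrow> k \<in> mors H \<and> src H k \<in> E \<and> tgt H k \<in> E" for k by (simp add: K_def)
  have K_obj: "objs K = E" using EH by (auto simp: K_def)
  have K_simps: "src K = src H" "tgt K = tgt H" "ident K = ident H" "mult K = mult H"
    by (simp_all add: K_def)
  have F_to_K: "borel_functor (borel_groupoid_of G) K Fo Fm"
  proof (unfold_locales)
    show "Fo \<in> obj_alg (borel_groupoid_of G) \<rightarrow>\<^sub>M obj_alg K"
      using Fo_E by (auto simp: K_def space_borel_of topspace_obj_top intro!: measurable_restrict_space2 Fo_measurable)
    show "Fm \<in> mor_alg (borel_groupoid_of G) \<rightarrow>\<^sub>M mor_alg K"
      using Fo_E F_mor src_closed tgt_closed
      by (auto simp: K_def space_borel_of topspace_mor_top intro!: measurable_restrict_space2 Fm_measurable)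
    show "Fm (ident (borel_groupoid_of G) z) = ident K (Fo z)" if "z \<in> objs (borel_groupoid_of G)" for z
      using map_ident[of z] that by (simp add: K_simps)
  qed (use Fo_E F_mor src_closed tgt_closed F_mult K_obj in
        \<open>auto simp: homset_def composable_def K_mor K_simps\<close>)

  \<comment> \<open>The conjugate of \<open>k\<close> by the chosen arrows, an arrow between objects in the image of \<open>F\<close>.\<close>
  define w where "w k = mult H (invm H (h (tgt H k))) (mult H k (h (src H k)))" for k
  have w: "(x (src H k), x (tgt H k), w k) \<in> liftable" if "k \<in> mors K" for k
    using that x h by (auto simp: liftable_def homset_def w_def K_mor H.groupoid_simps)
  define Fm' where "Fm' k = l (x (src H k), x (tgt H k), w k)" for k
  have Fm': "Fm' k \<in> mors G" "src G (Fm' k) = x (src H k)" "tgt G (Fm' k) = x (tgt H k)" "Fm (Fm' k) = w k"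
    if "k \<in> mors K" for k
    using l(2)[OF w[OF that]] by (simp_all add: Fm'_def homset_def)
  have src_K: "src H \<in> mor_alg K \<rightarrow>\<^sub>M obj_alg K" and tgt_K: "tgt H \<in> mor_alg K \<rightarrow>\<^sub>M obj_alg K"
    using K.measurable_src K.measurable_tgt by (simp_all add: K_simps)
  have id_K: "(\<lambda>k. k) \<in> mor_alg K \<rightarrow>\<^sub>M mor_alg H"
    unfolding K_def by (auto intro!: measurable_restrict_space1)
  have w_meas: "w \<in> mor_alg K \<rightarrow>\<^sub>M mor_alg H"
    unfolding w_def
    by (intro H.measurable_mult_compose id_K measurable_compose[OF src_K h_meas]
        measurable_compose[OF measurable_compose[OF tgt_K h_meas] H.measurable_invm])
      (use h in \<open>auto simp: K.space_mor_alg K_mor H.groupoid_simps\<close>)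
  have Fm'_meas: "Fm' \<in> mor_alg K \<rightarrow>\<^sub>M borel_of (mor_top G)"
    unfolding Fm'_def
    by (intro l_meas measurable_compose[OF src_K x_meas] measurable_compose[OF tgt_K x_meas] w_meas)
      (simp add: K.space_mor_alg w)
  have F': "borel_functor K (borel_groupoid_of G) x Fm'"
  proof (unfold_locales)
    show "x \<in> obj_alg K \<rightarrow>\<^sub>M obj_alg (borel_groupoid_of G)" "Fm' \<in> mor_alg K \<rightarrow>\<^sub>M mor_alg (borel_groupoid_of G)"
      using x_meas Fm'_meas by simp_all
    show "x y \<in> objs (borel_groupoid_of G)" if "y \<in> objs K" for y using that x by (simp add: K_obj)
    show "Fm' k \<in> homset (borel_groupoid_of G) (x (src K k)) (x (tgt K k))" if "k \<in> mors K" for k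
      using Fm'[OF that] by (simp add: homset_def K_simps)
    show "Fm' (ident K y) = ident (borel_groupoid_of G) (x y)" if y: "y \<in> objs K" for y
    proof -
      have i: "ident K y \<in> mors K" using K.ident_closed(1)[OF y] .
      have yE: "y \<in> E" "y \<in> objs H" using y K_obj EH by auto
      have "w (ident K y) = ident H (Fo (x y))"
        using yE h[OF yE(1)] by (simp add: w_def K_simps H.groupoid_simps)
      also have "\<dots> = Fm (ident G (x y))" using map_ident[of "x y"] x[OF yE(1)] by simp
      finally have "Fm (Fm' (ident K y)) = Fm (ident G (x y))" using Fm'(4)[OF i] by simp
      then have "Fm' (ident K y) = ident G (x y)"
        using Fm'(1-3)[OF i] yE x[OF yE(1)]
        by (intro faithful_eq[OF faithful]) (simp_all add: ident_closed K_simps H.groupoid_simps)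
      then show ?thesis by simp
    qed
    show "Fm' (mult K k m) = mult (borel_groupoid_of G) (Fm' k) (Fm' m)" if km: "(k, m) \<in> composable K" for k m
    proof -
      have k: "k \<in> mors K" and m: "m \<in> mors K" and eq: "src H k = tgt H m"
        using km by (auto simp: composable_def K_simps)
      have kH: "k \<in> mors H" "src H k \<in> E" "tgt H k \<in> E" and mH: "m \<in> mors H" "src H m \<in> E" "tgt H m \<in> E"
        using k m K_mor by auto
      have km': "mult K k m \<in> mors K" using K.mult_closed(1)[OF k m] eq by (simp add: K_simps)
      have "Fm (mult G (Fm' k) (Fm' m)) = mult H (w k) (w m)"
        using Fm'[OF k] Fm'[OF m] eq by (simp add: F_mult)
      also have "\<dots> = w (mult K k m)"
        using kH mH h[OF kH(2)] h[OF kH(3)] h[OF mH(2)] h[OF mH(3)] eq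
        by (simp add: w_def K_simps H.groupoid_simps)
      finally have "Fm (Fm' (mult K k m)) = Fm (mult G (Fm' k) (Fm' m))" using Fm'(4)[OF km'] by simp
      then have "Fm' (mult K k m) = mult G (Fm' k) (Fm' m)"
        using Fm'[OF k] Fm'[OF m] Fm'[OF km'] eq kH mH
        by (intro faithful_eq[OF faithful]) (simp_all add: mult_closed K_simps H.mult_closed)
      then show ?thesis by simp
    qed
  qed
  have eta: "borel_nat_iso K K (Fo \<circ> x) (Fm \<circ> Fm') id id h"
    unfolding borel_nat_iso_def
  proof (intro conjI ballI)
    show "h \<in> obj_alg K \<rightarrow>\<^sub>M mor_alg K"
      unfolding K_def full_subgroupoid_simps
      by (rule measurable_restrict_space2)
        (use h_meas h x Fo_E EH in \<open>auto simp: K_def space_restrict_space\<close>)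
    show "h y \<in> homset K ((Fo \<circ> x) y) (id y)" if "y \<in> objs K" for y
      using that h x Fo_E by (auto simp: K_obj homset_def K_mor K_simps)
    show "mult K (h (tgt K k)) ((Fm \<circ> Fm') k) = mult K (id k) (h (src K k))" if k: "k \<in> mors K" for k
    proof -
      have kH: "k \<in> mors H" "src H k \<in> E" "tgt H k \<in> E" using k K_mor by auto
      show ?thesis using kH h[OF kH(2)] h[OF kH(3)] Fm'(4)[OF k] by (simp add: w_def K_simps H.groupoid_simps)
    qed
  qed
  define eps where "eps z = l (x (Fo z), z, h (Fo z))" for z
  have lift_eps: "(x (Fo z), z, h (Fo z)) \<in> liftable" if "z \<in> objs G" for z
    using that x[OF Fo_E] h[OF Fo_E] by (simp add: liftable_def homset_def)
  have eps: "eps z \<in> mors G" "src G (eps z) = x (Fo z)" "tgt G (eps z) = z" "Fm (eps z) = h (Fo z)"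
    if "z \<in> objs G" for z
    using l(2)[OF lift_eps[OF that]] by (simp_all add: eps_def homset_def)
  have Fo_K: "Fo \<in> borel_of (obj_top G) \<rightarrow>\<^sub>M obj_alg K"
    using borel_functor.measurable_obj[OF F_to_K] by simp
  have eps_iso: "borel_nat_iso (borel_groupoid_of G) (borel_groupoid_of G) (x \<circ> Fo) (Fm' \<circ> Fm) id id eps"
    unfolding borel_nat_iso_def borel_groupoid_of_simps
  proof (intro conjI ballI)
    show "eps \<in> borel_of (obj_top G) \<rightarrow>\<^sub>M borel_of (mor_top G)"
      unfolding eps_def
      by (intro l_meas measurable_compose[OF Fo_K x_meas] measurable_compose[OF Fo_K h_meas] measurable_ident_sets)
        (simp_all add: space_borel_of topspace_obj_top lift_eps)
    show "eps z \<in> homset G ((x \<circ> Fo) z) (id z)" if "z \<in> objs G" for z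
      using eps[OF that] by (simp add: homset_def)
    show "mult G (eps (tgt G g)) ((Fm' \<circ> Fm) g) = mult G (id g) (eps (src G g))" if g: "g \<in> mors G" for g
    proof -
      have zs: "src G g \<in> objs G" "tgt G g \<in> objs G" using g by (simp_all add: src_closed tgt_closed)
      note Fg = F_mor[OF g]
      have FgK: "Fm g \<in> mors K" using Fg Fo_E zs by (simp add: K_mor)
      note e1 = eps[OF zs(1)] and e2 = eps[OF zs(2)] and f = Fm'[OF FgK]
      have "Fm (mult G (eps (tgt G g)) (Fm' (Fm g))) = mult H (h (Fo (tgt G g))) (w (Fm g))"
        using e2 f Fg by (simp add: F_mult)
      also have "\<dots> = mult H (Fm g) (h (Fo (src G g)))"
        using Fg h[OF Fo_E[OF zs(1)]] h[OF Fo_E[OF zs(2)]] by (simp add: w_def H.groupoid_simps)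
      also have "\<dots> = Fm (mult G g (eps (src G g)))" using g e1 by (simp add: F_mult)
      finally have "mult G (eps (tgt G g)) (Fm' (Fm g)) = mult G g (eps (src G g))"
        using g e1 e2 f Fg by (intro faithful_eq[OF faithful]) (simp_all add: mult_closed)
      then show ?thesis by simp
    qed
  qed
  show ?thesis
    unfolding borel_equivalence_def E_def[symmetric] K_def[symmetric]
    using Gs Ks F_to_K F' eta eps_iso by blast
qed

end

theorem theorem1p10:
  fixes G :: "('a, 'b) top_groupoid_data"
    and H :: "('c, 'd) borel_groupoid_data"
    and Fo :: "'a \<Rightarrow> 'c"
    and Fm :: "'b \<Rightarrow> 'd"
  assumes "open_quasi_polish_groupoid G"
    and "standard_borel_groupoid H"
    and "borel_functor (borel_groupoid_of G) H Fo Fm"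
    and "full_functor G H Fo Fm"
  shows "essential_image G H Fo \<in> sets (obj_alg H) \<and>
    (\<exists>x h. (\<lambda>y. (x y, h y)) \<in> restrict_space (obj_alg H) (essential_image G H Fo)
               \<rightarrow>\<^sub>M obj_alg (borel_groupoid_of G) \<Otimes>\<^sub>M mor_alg H \<and>
           (\<forall>y\<in>essential_image G H Fo. x y \<in> objs G \<and> h y \<in> homset H (Fo (x y)) y)) \<and>
    (faithful_functor G Fm \<longrightarrow>
       borel_equivalence (borel_groupoid_of G)
         (full_subgroupoid H (essential_image G H Fo)) Fo Fm)"
proof -
  interpret F: full_borel_functor G H Fo Fm
    using assms by (simp add: full_borel_functor_def full_borel_functor_axioms_def)
  show ?thesis
    using F.essential_image_selection F.faithful_borel_equivalence by simp
qed

end
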